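(* Let $\mathcal{R} = (0,4\pi)\times(0,2\pi) \subset \mathbb{R}^2$ and, for $0 < a \le 1$, let $C_a = (0,a]\times\{\pi\}$ and $\mathcal{R}_a = \mathcal{R}\setminus C_a$. For all sufficiently small $a>0$, the Extended Courant Property for $\mathcal{R}_a$ is false with the Neumann condition on $C_a$ and either the Dirichlet or the Neumann condition on $\partial\mathcal{R}$; that is, for each of these two choices of boundary condition on $\partial \mathcal{R}$ there exist an integer $m \ge 1$ and a linear combination $v$ of eigenfunctions of the corresponding realization of $-\Delta$ in $\mathcal{R}_a$ associated with eigenvalues less than or equal to $\lambda_m$ such that $\beta_0(v) > \kappa(\lambda_m)$.
   Context: The realization of $-\Delta$ in $\mathcal{R}_a$ is the self-adjoint operator with the Neumann condition on (both sides of) the crack $C_a$ and the Dirichlet, respectively Neumann, condition on $\partial\mathcal{R}$; i.e. the operator associated with the quadratic form $\int_{\mathcal{R}_a}|\nabla u|^2$ on the space of $u\in H^1(\mathcal{R}_a)$ with zero trace on $\partial\mathcal{R}$, respectively on all of $H^1(\mathcal{R}_a)$. Its eigenvalues are listed in nondecreasing order, counted with multiplicity and starting with index $1$: $\lambda_1 < \lambda_2 \le \lambda_3 \le \cdots$. For an eigenvalue $\lambda$, set $\kappa(\lambda) = \min\{k \mid \lambda_k = \lambda\}$. For a real continuous function $v$ on $\Omega=\mathcal{R}_a$, the nodal set is $\mathcal{Z}(v) = \overline{\{x \in \Omega \mid v(x) = 0\}}$, and $\beta_0(v)$ denotes the number of connected components of $\Omega \setminus \mathcal{Z}(v)$ (nodal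 domains). The Extended Courant Property for $\Omega$ with the given boundary conditions is the assertion: for every $m \ge 1$ and every real linear combination $v$ of real eigenfunctions associated with eigenvalues $\le \lambda_m$, one has $\beta_0(v) \le \kappa(\lambda_m) \le m$. *)

theory Defs
  imports "HOL-Analysis.Analysis" "HOL-Library.Function_Algebras" "HOL-Library.Extended_Nat"
begin

section \<open>The Sobolev space $H^1$\<close>

definition square_integrable ::
    "'a measure \<Rightarrow> ('a \<Rightarrow> 'b::real_normed_vector) \<Rightarrow> bool" where
  "square_integrable M f \<longleftrightarrow>
     f \<in> borel_measurable M \<and> integrable M (\<lambda>x. (norm (f x))\<^sup>2)"

fun C_k :: "nat \<Rightarrow> ('a::euclidean_space \<Rightarrow> real) \<Rightarrow> bool" where
  "C_k 0 f = continuous_on UNIV f"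
| "C_k (Suc k) f =
     (f differentiable_on UNIV \<and> (\<forall>b\<in>Basis. C_k k (\<lambda>x. frechet_derivative f (at x) b)))"

definition test_function :: "'a::euclidean_space set \<Rightarrow> ('a \<Rightarrow> real) \<Rightarrow> bool" where
  "test_function \<Omega> \<phi> \<longleftrightarrow>
     (\<forall>k. C_k k \<phi>) \<and> compact (closure {x. \<phi> x \<noteq> 0}) \<and> closure {x. \<phi> x \<noteq> 0} \<subseteq> \<Omega>"

definition has_L2_gradient ::
    "'a::euclidean_space set \<Rightarrow> ('a \<Rightarrow> real) \<Rightarrow> ('a \<Rightarrow> 'a) \<Rightarrow> bool" where
  "has_L2_gradient \<Omega> u G \<longleftrightarrow>
     square_integrable (lebesgue_on \<Omega>) G \<and>
     (\<forall>\<phi>. test_function \<Omega> \<phi> \<longrightarrow>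
        (\<forall>b\<in>Basis.
           (LINT x|lebesgue_on \<Omega>. u x * frechet_derivative \<phi> (at x) b) =
           - (LINT x|lebesgue_on \<Omega>. (G x \<bullet> b) * \<phi> x)))"

definition H1 :: "'a::euclidean_space set \<Rightarrow> ('a \<Rightarrow> real) set" where
  "H1 \<Omega> = {u. square_integrable (lebesgue_on \<Omega>) u \<and> (\<exists>G. has_L2_gradient \<Omega> u G)}"

text \<open>For \<open>u \<in> H1 \<Omega>\<close> the weak gradient is unique up to a null set, so the integrals below do not
  depend on the representative chosen here.\<close>

definition weak_grad :: "'a::euclidean_space set \<Rightarrow> ('a \<Rightarrow> real) \<Rightarrow> 'a \<Rightarrow> 'a" where
  "weak_grad \<Omega> u = (SOME G. has_L2_gradient \<Omega> u G)"

definition dirichlet_form ::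
    "'a::euclidean_space set \<Rightarrow> ('a \<Rightarrow> real) \<Rightarrow> ('a \<Rightarrow> real) \<Rightarrow> real" where
  "dirichlet_form \<Omega> u v = (LINT x|lebesgue_on \<Omega>. weak_grad \<Omega> u x \<bullet> weak_grad \<Omega> v x)"

definition H1_dist2 ::
    "'a::euclidean_space set \<Rightarrow> ('a \<Rightarrow> real) \<Rightarrow> ('a \<Rightarrow> real) \<Rightarrow> real" where
  "H1_dist2 \<Omega> u w =
     (LINT x|lebesgue_on \<Omega>. (u x - w x)\<^sup>2) +
     (LINT x|lebesgue_on \<Omega>. (norm (weak_grad \<Omega> u x - weak_grad \<Omega> w x))\<^sup>2)"


section \<open>The rectangle with a crack\<close>

definition rect :: "(real \<times> real) set" where
  "rect = {0<..<4*pi} \<times> {0<..<2*pi}"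

definition crack :: "real \<Rightarrow> (real \<times> real) set" where
  "crack a = {0<..a} \<times> {pi}"

definition cracked :: "real \<Rightarrow> (real \<times> real) set" where
  "cracked a = rect - crack a"

text \<open>The squared \<open>L\<^sup>2\<close> norm for arclength on the boundary of \<^const>\<open>rect\<close>.\<close>

definition boundary_norm2 :: "(real \<times> real \<Rightarrow> real) \<Rightarrow> real" where
  "boundary_norm2 w =
     integral {0..4*pi} (\<lambda>x. (w (x, 0))\<^sup>2 + (w (x, 2*pi))\<^sup>2) +
     integral {0..2*pi} (\<lambda>y. (w (0, y))\<^sup>2 + (w (4*pi, y))\<^sup>2)"

text \<open>The trace on the boundary of \<^const>\<open>rect\<close> is the extension by continuity, from \<open>H\<^sup>1\<close> to \<open>L\<^sup>2\<close> of
  that boundary, of the restriction map on those \<open>H\<^sup>1\<close> functions which are continuous up to the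
  boundary of \<^const>\<open>rect\<close> (they form a dense subspace, and may jump across the crack).
  A function thus has zero trace iff it is an \<open>H\<^sup>1\<close> limit of such functions \<open>w n\<close> whose restrictions
  tend to 0.\<close>

definition zero_trace :: "real \<Rightarrow> (real \<times> real \<Rightarrow> real) \<Rightarrow> bool" where
  "zero_trace a u \<longleftrightarrow>
     (\<exists>w :: nat \<Rightarrow> real \<times> real \<Rightarrow> real.
        (\<forall>n. w n \<in> H1 (cracked a) \<and> continuous_on (cracked a \<union> frontier rect) (w n)) \<and>
        (\<lambda>n. H1_dist2 (cracked a) u (w n)) \<longlonglongrightarrow> 0 \<and>
        (\<lambda>n. boundary_norm2 (w n)) \<longlonglongrightarrow> 0)"

datatype boundary_condition = Dirichlet | Neumann

fun form_domain :: "boundary_condition \<Rightarrow> real \<Rightarrow> (real \<times> real \<Rightarrow> real) set" where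
  "form_domain Dirichlet a = {u \<in> H1 (cracked a). zero_trace a u}"
| "form_domain Neumann a = H1 (cracked a)"

text \<open>The graph of the operator associated with the form: \<open>u\<close> is in its domain and \<open>- \<Delta> u = f\<close>.\<close>

definition neg_laplacian ::
    "boundary_condition \<Rightarrow> real \<Rightarrow> (real \<times> real \<Rightarrow> real) \<Rightarrow> (real \<times> real \<Rightarrow> real) \<Rightarrow> bool" where
  "neg_laplacian bc a u f \<longleftrightarrow>
     u \<in> form_domain bc a \<and> square_integrable (lebesgue_on (cracked a)) f \<and>
     (\<forall>v\<in>form_domain bc a.
        dirichlet_form (cracked a) u v = (LINT x|lebesgue_on (cracked a). f x * v x))"


section \<open>Eigenvalues\<close>

interpretation real_fun: vector_space "\<lambda>(c::real) (f :: real \<times> real \<Rightarrow> real) x. c * f x"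
  by unfold_locales (auto simp: algebra_simps)

text \<open>By interior regularity every \<open>L\<^sup>2\<close> eigenfunction has exactly one representative that is
  continuous on \<^term>\<open>cracked a\<close>; its (irrelevant) values elsewhere are fixed to be 0, so that
  the dimension of this space of functions is the dimension of the eigenspace in \<open>L\<^sup>2\<close>.\<close>

definition eigenspace ::
    "boundary_condition \<Rightarrow> real \<Rightarrow> real \<Rightarrow> (real \<times> real \<Rightarrow> real) set" where
  "eigenspace bc a \<mu> =
     {u. continuous_on (cracked a) u \<and> (\<forall>x. x \<notin> cracked a \<longrightarrow> u x = 0) \<and>
         neg_laplacian bc a u (\<lambda>x. \<mu> * u x)}"

definition eigenvalue :: "boundary_condition \<Rightarrow> real \<Rightarrow> real \<Rightarrow> bool" where
  "eigenvalue bc a \<mu> \<longleftrightarrow> (\<exists>u\<in>eigenspace bc a \<mu>. u \<noteq> 0)"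

definition multiplicity :: "boundary_condition \<Rightarrow> real \<Rightarrow> real \<Rightarrow> nat" where
  "multiplicity bc a \<mu> = real_fun.dim (eigenspace bc a \<mu>)"

text \<open>The number of eigenvalues \<open>\<le> \<mu>\<close>, with multiplicity; the spectrum is discrete with finite
  multiplicities, so the sum is finite.\<close>

definition eigenvalue_count :: "boundary_condition \<Rightarrow> real \<Rightarrow> real \<Rightarrow> nat" where
  "eigenvalue_count bc a \<mu> = (\<Sum>\<nu> | eigenvalue bc a \<nu> \<and> \<nu> \<le> \<mu>. multiplicity bc a \<nu>)"

text \<open>The \<open>k\<close>-th entry (\<open>k \<ge> 1\<close>) of the nondecreasing list of eigenvalues with multiplicity.\<close>

definition eigval :: "boundary_condition \<Rightarrow> real \<Rightarrow> nat \<Rightarrow> real" where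
  "eigval bc a k = (LEAST \<mu>. k \<le> eigenvalue_count bc a \<mu>)"

definition kappa :: "boundary_condition \<Rightarrow> real \<Rightarrow> real \<Rightarrow> nat" where
  "kappa bc a \<mu> = (LEAST k. 1 \<le> k \<and> eigval bc a k = \<mu>)"

definition eigenfunction_combinations ::
    "boundary_condition \<Rightarrow> real \<Rightarrow> real \<Rightarrow> (real \<times> real \<Rightarrow> real) set" where
  "eigenfunction_combinations bc a \<mu> = real_fun.span (\<Union>\<nu>\<in>{..\<mu>}. eigenspace bc a \<nu>)"


section \<open>Nodal domains and the Extended Courant Property\<close>

definition nodal_set :: "'a::topological_space set \<Rightarrow> ('a \<Rightarrow> real) \<Rightarrow> 'a set" where
  "nodal_set \<Omega> v = closure {x \<in> \<Omega>. v x = 0}"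

definition beta0 :: "'a::topological_space set \<Rightarrow> ('a \<Rightarrow> real) \<Rightarrow> enat" where
  "beta0 \<Omega> v =
     (let D = components (\<Omega> - nodal_set \<Omega> v) in if finite D then enat (card D) else \<infinity>)"

definition extended_courant_property :: "boundary_condition \<Rightarrow> real \<Rightarrow> bool" where
  "extended_courant_property bc a \<longleftrightarrow>
     (\<forall>m\<ge>1. \<forall>v\<in>eigenfunction_combinations bc a (eigval bc a m).
        beta0 (cracked a) v \<le> enat (kappa bc a (eigval bc a m)) \<and>
        kappa bc a (eigval bc a m) \<le> m)"

end

theory Submission
  imports Defs
begin

text \<open>Every vertical line \<open>x = c\<close> with \<open>0 < c < a\<close> meets the crack, so that it cuts \<^term>\<open>cracked a\<close> into three
pieces: two on its left, separated by the crack, and one on its right. With the Neumann condition on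
the crack, functions that are even with respect to the height \<open>pi\<close> do not feel the crack, and among
the eigenfunctions are \<open>1\<close> and \<open>cos (x / 4)\<close> in the Neumann case, \<open>sin (x / 4) * sin (y / 2)\<close> and
\<open>sin (x / 4) * cos (x / 4) * sin (y / 2)\<close> in the Dirichlet case. In both cases the second function
minus \<open>cos (c / 4)\<close> times the first one vanishes exactly on the line \<open>x = c\<close>, hence has three nodal
domains. The Extended Courant Property therefore fails as soon as the eigenvalue of the second function
is the second eigenvalue of the cracked rectangle, for then its \<open>kappa\<close> is at most 2.

What has to be excluded is that the crack creates further small eigenvalues or multiplicities. Call
\<open>mode k\<close> the product of the first function with \<open>cos (x / 4) ^ k\<close>. Since \<open>- \<Delta>\<close> maps \<open>mode k\<close> to a
combination of \<open>mode k\<close> and \<open>mode (k - 2)\<close>, the integrals of an eigenfunction \<open>u\<close> against the modes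
satisfy a two-term recursion (\<open>mode_weak_equation\<close>). If \<open>u\<close> has an eigenvalue at most that of \<open>mode 1\<close>
and is orthogonal to those of \<open>mode 0\<close> and \<open>mode 1\<close> that have the same eigenvalue, all these integrals
vanish. By the Weierstrass theorem \<open>u\<close> then integrates to zero on almost every vertical line, against
the weight 1 in the Neumann case and \<open>sin (y / 2)\<close> in the Dirichlet case (\<open>vertical_projection_zero\<close>).
For such functions there is a Poincare inequality, which a nonzero eigenfunction with so small an eigenvalue violates
(\<open>gap_neumann\<close>, \<open>gap_dirichlet\<close>): to the right of the crack it comes from one-dimensional inequalities
on vertical lines, and the thin strip on the left is controlled along horizontal lines, which are
parallel to the crack. The eigenvalues lie so far below the limits set by these inequalities that very
crude one-dimensional estimates are enough; \<open>a \<le> 1 / 8\<close> suffices.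

The analytic work is the passage from weak derivatives to lines. Products of smooth functions of one
variable, approximating indicator functions, serve as test functions; with Fubini's theorem and a
du Bois-Reymond lemma they show that a weakly differentiable function is absolutely continuous on almost
every line. This yields the uniqueness of the weak gradient, and integration by parts up to the boundary,
where the definition of the zero trace enters only through boundary integrals of continuous functions.\<close>


section \<open>Smooth functions\<close>

definition smooth :: "('a::euclidean_space \<Rightarrow> real) \<Rightarrow> bool" where
  "smooth f \<longleftrightarrow> (\<forall>k. C_k k f)"

lemma C_k_SucI:
  assumes "\<And>x. (f has_derivative D x) (at x)" "\<And>b. b \<in> Basis \<Longrightarrow> C_k k (\<lambda>x. D x b)"
  shows "C_k (Suc k) f"
proof -
  have "frechet_derivative f (at x) = D x" for x
    using frechet_derivative_at[OF assms(1)[of x]] by simp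
  moreover have "f differentiable_on UNIV"
    using assms(1) by (auto simp: differentiable_on_def differentiable_def)
  ultimately show ?thesis using assms(2) by simp
qed

lemma C_k_Suc_has_derivative:
  assumes "C_k (Suc k) f"
  shows "(f has_derivative frechet_derivative f (at x)) (at x)"
  using assms by (auto simp: differentiable_on_def frechet_derivative_works)

lemma C_k_SucD: "C_k (Suc k) f \<Longrightarrow> C_k k f"
proof (induction k arbitrary: f)
  case 0
  then show ?case by (simp add: differentiable_imp_continuous_on)
qed auto

lemma C_k_const: "C_k k (\<lambda>x. c)"
proof (induction k arbitrary: c)
  case (Suc k)
  show ?case by (rule C_k_SucI[where D="\<lambda>x h. 0"]) (auto intro: Suc)
qed auto

lemma C_k_add: "C_k k f \<Longrightarrow> C_k k g \<Longrightarrow> C_k k (\<lambda>x. f x + g x)"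
proof (induction k arbitrary: f g)
  case 0
  then show ?case by (simp add: continuous_on_add continuous_on_mult)
next
  case (Suc k)
  show ?case
    by (rule C_k_SucI[OF has_derivative_add[OF C_k_Suc_has_derivative C_k_Suc_has_derivative]])
      (use Suc in auto)
qed

lemma C_k_mult: "C_k k f \<Longrightarrow> C_k k g \<Longrightarrow> C_k k (\<lambda>x. f x * g x)"
proof (induction k arbitrary: f g)
  case 0
  then show ?case by (simp add: continuous_on_add continuous_on_mult)
next
  case (Suc k)
  show ?case
    by (rule C_k_SucI[OF has_derivative_mult[OF C_k_Suc_has_derivative C_k_Suc_has_derivative]])
      (use Suc C_k_SucD[OF Suc.prems(1)] C_k_SucD[OF Suc.prems(2)] in \<open>auto intro!: C_k_add\<close>)
qed

text \<open>The condition on basis vectors makes the class of compositions closed under partial derivatives. It holds for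
the projections \<^const>\<open>fst\<close> and \<^const>\<open>snd\<close>, for which the lemma is needed.\<close>

lemma C_k_compose_linear:
  assumes L: "bounded_linear L" and "\<And>b. b \<in> Basis \<Longrightarrow> L b \<in> Basis \<or> L b = 0"
  shows "C_k k f \<Longrightarrow> C_k k (\<lambda>x. f (L x))"
proof (induction k arbitrary: f)
  case 0
  then show ?case
    by (auto intro!: continuous_on_compose2[of UNIV f] linear_continuous_on[OF L])
next
  case (Suc k)
  note d = C_k_Suc_has_derivative[OF Suc.prems]
  show ?case
  proof (rule C_k_SucI)
    show "((\<lambda>x. f (L x)) has_derivative (\<lambda>h. frechet_derivative f (at (L x)) (L h))) (at x)" for x
      using diff_chain_at[OF bounded_linear_imp_has_derivative[OF L] d[of "L x"]]
      by (simp add: o_def)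
  next
    fix b :: 'a assume "b \<in> Basis"
    then have "L b \<in> Basis \<or> L b = 0" by (rule assms)
    then show "C_k k (\<lambda>x. frechet_derivative f (at (L x)) (L b))"
    proof
      assume "L b = 0"
      then have "frechet_derivative f (at (L x)) (L b) = 0" for x
        using has_derivative_linear[OF d] linear_0 by auto
      then show ?thesis by (simp add: C_k_const)
    qed (use Suc in auto)
  qed
qed

lemma smooth_const [simp]: "smooth (\<lambda>x. c)"
  and smooth_add: "smooth f \<Longrightarrow> smooth g \<Longrightarrow> smooth (\<lambda>x. f x + g x)"
  and smooth_mult: "smooth f \<Longrightarrow> smooth g \<Longrightarrow> smooth (\<lambda>x. f x * g x)"
  by (auto simp: smooth_def C_k_const C_k_add C_k_mult)

lemma smooth_diff: "smooth f \<Longrightarrow> smooth g \<Longrightarrow> smooth (\<lambda>x. f x - g x)"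
  using smooth_add[of f "\<lambda>x. (-1) * g x"] smooth_mult[of "\<lambda>x. -1" g] by simp

lemma smooth_has_derivative:
  "smooth f \<Longrightarrow> (f has_derivative frechet_derivative f (at x)) (at x)"
  by (rule C_k_Suc_has_derivative[of 0]) (simp only: smooth_def)

lemma smooth_continuous: "smooth f \<Longrightarrow> continuous_on S f"
  using continuous_on_subset[of UNIV f S] by (simp add: smooth_def C_k.simps(1)[symmetric] del: C_k.simps)

lemma smooth_frechet_derivative:
  "smooth f \<Longrightarrow> b \<in> Basis \<Longrightarrow> smooth (\<lambda>x. frechet_derivative f (at x) b)"
  unfolding smooth_def
proof
  fix k assume "\<forall>k. C_k k f" "b \<in> Basis"
  then have "C_k (Suc k) f" by blast
  then show "C_k k (\<lambda>x. frechet_derivative f (at x) b)" using \<open>b \<in> Basis\<close> by simp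
qed

lemma smooth_fst: "smooth f \<Longrightarrow> smooth (\<lambda>z::real \<times> real. f (fst z))"
  and smooth_snd: "smooth f \<Longrightarrow> smooth (\<lambda>z::real \<times> real. f (snd z))"
proof -
  have "fst b \<in> Basis \<or> fst b = 0" "snd b \<in> Basis \<or> snd b = 0"
    if "b \<in> Basis" for b :: "real \<times> real"
    using that by (auto simp: Basis_prod_def)
  note C_k_compose_linear[OF bounded_linear_fst this(1)]
    C_k_compose_linear[OF bounded_linear_snd this(2)]
  then show "smooth f \<Longrightarrow> smooth (\<lambda>z::real \<times> real. f (fst z))"
    "smooth f \<Longrightarrow> smooth (\<lambda>z::real \<times> real. f (snd z))"
    by (simp_all add: smooth_def)
qed

lemma frechet_derivative_real:
  assumes "(f has_real_derivative D) (at x)"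
  shows "frechet_derivative f (at x) h = D * h"
  using fun_cong[OF frechet_derivative_at[OF assms[unfolded has_field_derivative_def]], of h] by simp

text \<open>Iterated derivatives need not be computed: it is enough to exhibit a class of functions that
differentiation does not leave.\<close>

lemma smooth_real_coinduct:
  assumes "P f" "\<And>f. P f \<Longrightarrow> \<exists>f'. P f' \<and> (\<forall>x::real. (f has_real_derivative f' x) (at x))"
  shows "smooth f"
proof -
  have "C_k k f" if "P f" for k f
    using that
  proof (induction k arbitrary: f)
    case 0
    then obtain f' where "\<forall>x. (f has_real_derivative f' x) (at x)" using assms(2) by blast
    then show ?case by (auto intro!: DERIV_continuous_on)
  next
    case (Suc k)
    then obtain f' where f': "P f'" "\<forall>x. (f has_real_derivative f' x) (at x)"
      using assms(2) by blast
    show ?case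
    proof (rule C_k_SucI)
      show "(f has_derivative (\<lambda>h. f' x * h)) (at x)" for x
        using f'(2) by (simp add: has_field_derivative_def)
      show "C_k k (\<lambda>x. f' x * b)" if "b \<in> Basis" for b
        using that Suc.IH[OF f'(1)] by simp
    qed
  qed
  with assms(1) show ?thesis by (auto simp: smooth_def)
qed

lemma smooth_real_deriv:
  fixes f :: "real \<Rightarrow> real"
  assumes "smooth f"
  shows "(f has_real_derivative deriv f x) (at x)" "smooth (deriv f)"
proof -
  have fd: "(f has_real_derivative frechet_derivative f (at x) 1) (at x)" for x
  proof -
    obtain D where D: "(f has_real_derivative D) (at x)"
      using smooth_has_derivative[OF assms, of x] has_real_derivative by blast
    with frechet_derivative_real[OF D, of 1] show ?thesis by simp
  qed
  then have eq: "deriv f = (\<lambda>x. frechet_derivative f (at x) 1)"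
    by (auto simp: DERIV_imp_deriv)
  show "(f has_real_derivative deriv f x) (at x)" using fd eq by simp
  show "smooth (deriv f)" unfolding eq by (rule smooth_frechet_derivative[OF assms]) simp
qed

lemma smooth_antiderivative:
  fixes f :: "real \<Rightarrow> real"
  assumes "smooth f" and F: "\<And>x. (F has_real_derivative f x) (at x)"
  shows "smooth F"
proof (rule smooth_real_coinduct[where P="\<lambda>g. smooth g \<or> g = F"])
  fix g assume "smooth g \<or> g = F"
  then show "\<exists>g'. (smooth g' \<or> g' = F) \<and> (\<forall>x. (g has_real_derivative g' x) (at x))"
    using assms smooth_real_deriv by blast
qed simp

lemma smooth_ident [simp]: "smooth (\<lambda>x::real. x)"
  by (rule smooth_antiderivative[of "\<lambda>x. 1"]) auto

lemma smooth_trig: "smooth (\<lambda>x. c * cos (w * x :: real) + d * sin (w * x))"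
proof (rule smooth_real_coinduct[where P="\<lambda>g. \<exists>c d. g = (\<lambda>x. c * cos (w * x) + d * sin (w * x))"])
  fix g assume "\<exists>c d. g = (\<lambda>x. c * cos (w * x) + d * sin (w * x))"
  then obtain c d where g: "g = (\<lambda>x. c * cos (w * x) + d * sin (w * x))" by blast
  have "(g has_real_derivative (d * w) * cos (w * x) + (- c * w) * sin (w * x)) (at x)" for x
    unfolding g by (auto intro!: derivative_eq_intros simp: algebra_simps)
  then show "\<exists>f'. (\<exists>c d. f' = (\<lambda>x. c * cos (w * x) + d * sin (w * x))) \<and>
      (\<forall>x. (g has_real_derivative f' x) (at x))"
    by (intro exI[of _ "\<lambda>x. (d * w) * cos (w * x) + (- c * w) * sin (w * x)"]) blast
qed blast

lemma smooth_exp_compose: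
  fixes f :: "real \<Rightarrow> real"
  assumes "smooth f"
  shows "smooth (\<lambda>x. exp (f x))"
proof (rule smooth_real_coinduct[where P="\<lambda>g. \<exists>h. smooth h \<and> g = (\<lambda>x. h x * exp (f x))"])
  show "\<exists>h. smooth h \<and> (\<lambda>x. exp (f x)) = (\<lambda>x. h x * exp (f x))"
    by (rule exI[of _ "\<lambda>x. 1"]) simp
next
  fix g assume "\<exists>h. smooth h \<and> g = (\<lambda>x. h x * exp (f x))"
  then obtain h where h: "smooth h" "g = (\<lambda>x. h x * exp (f x))" by blast
  have "(g has_real_derivative (deriv h x + h x * deriv f x) * exp (f x)) (at x)" for x
    unfolding h
    using DERIV_mult[OF smooth_real_deriv(1)[OF h(1)]
        DERIV_chain2[OF DERIV_exp smooth_real_deriv(1)[OF assms]]]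
    by (simp add: algebra_simps)
  moreover have "smooth (\<lambda>x. deriv h x + h x * deriv f x)"
    by (intro smooth_add smooth_mult smooth_real_deriv h assms)
  ultimately show "\<exists>f'. (\<exists>h. smooth h \<and> f' = (\<lambda>x. h x * exp (f x))) \<and>
      (\<forall>x. (g has_real_derivative f' x) (at x))"
    by (intro exI[of _ "\<lambda>x. (deriv h x + h x * deriv f x) * exp (f x)"]) blast
qed

text \<open>The functions \<open>p (1 / x) * exp (- 1 / x)\<close>, extended by 0 to the left half-line: with an arbitrary
polynomial \<open>p\<close> they form a class that is closed under differentiation.\<close>

definition flat_exp :: "real poly \<Rightarrow> real \<Rightarrow> real" where
  "flat_exp p x = (if 0 < x then poly p (1 / x) * exp (- (1 / x)) else 0)"

lemma flat_exp_has_derivative: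
  "(flat_exp p has_real_derivative flat_exp (monom 1 2 * (p - pderiv p)) x) (at x)"
proof -
  consider "x > 0" | "x < 0" | "x = 0" by linarith
  then show ?thesis
  proof cases
    case 1
    have inv: "((\<lambda>x. 1 / x) has_real_derivative - (1 / x\<^sup>2)) (at x)"
      using DERIV_inverse[of x] 1 by (simp add: inverse_eq_divide power2_eq_square)
    have "((\<lambda>x. poly p (1 / x) * exp (- (1 / x))) has_real_derivative
        flat_exp (monom 1 2 * (p - pderiv p)) x) (at x)"
      using DERIV_mult[OF DERIV_chain2[OF poly_DERIV[of p] inv]
          DERIV_chain2[OF DERIV_exp DERIV_minus[OF inv]]] 1
      by (simp add: flat_exp_def poly_monom algebra_simps power_one_over)
    moreover have "eventually (\<lambda>x. flat_exp p x = poly p (1 / x) * exp (- (1 / x))) (nhds x)"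
      using eventually_nhds_in_open[of "{0<..}" x] 1
      by (auto elim!: eventually_mono simp: flat_exp_def)
    ultimately show ?thesis by (subst DERIV_cong_ev[OF refl _ refl]) auto
  next
    case 2
    have "((\<lambda>x. 0) has_real_derivative 0) (at x)" by simp
    moreover have "eventually (\<lambda>x. flat_exp p x = 0) (nhds x)"
      using eventually_nhds_in_open[of "{..<0}" x] 2
      by (auto elim!: eventually_mono simp: flat_exp_def)
    ultimately show ?thesis using 2
      by (subst DERIV_cong_ev[OF refl _ refl]) (auto simp: flat_exp_def)
  next
    case 3
    have pow: "((\<lambda>x. poly q x * exp (- x)) \<longlongrightarrow> 0) at_top" for q :: "real poly"
    proof -
      have "((\<lambda>x. \<Sum>i\<le>degree q. coeff q i * (x ^ i / exp x)) \<longlongrightarrow> (\<Sum>i\<le>degree q. coeff q i * 0)) at_top"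
        by (intro tendsto_intros tendsto_power_div_exp_0)
      then show ?thesis by (simp add: poly_altdef sum_distrib_right exp_minus divide_inverse mult.assoc)
    qed
    have "((\<lambda>h. (flat_exp p (0 + h) - flat_exp p 0) / h) \<longlongrightarrow> 0) (at 0)"
    proof (rule filterlim_split_at)
      show "((\<lambda>h. (flat_exp p (0 + h) - flat_exp p 0) / h) \<longlongrightarrow> 0) (at_left 0)"
        by (rule tendsto_eventually)
          (auto simp: flat_exp_def eventually_at_filter)
      have "((\<lambda>h. poly (monom 1 1 * p) (inverse h) * exp (- inverse h)) \<longlongrightarrow> 0) (at_right (0::real))"
        by (rule filterlim_compose[OF pow filterlim_inverse_at_top_right])
      then show "((\<lambda>h. (flat_exp p (0 + h) - flat_exp p 0) / h) \<longlongrightarrow> 0) (at_right 0)"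
        by (rule Lim_transform_eventually)
          (auto simp: flat_exp_def eventually_at_filter poly_monom field_simps)
    qed
    then show ?thesis using 3 by (simp add: DERIV_def flat_exp_def)
  qed
qed

lemma smooth_flat_exp: "smooth (flat_exp p)"
  by (rule smooth_real_coinduct[where P="\<lambda>g. \<exists>p. g = flat_exp p"])
    (auto intro: flat_exp_has_derivative)

lemma smooth_compose_affine:
  fixes f :: "real \<Rightarrow> real"
  assumes "smooth f"
  shows "smooth (\<lambda>x. f (c * x + d))"
proof (rule smooth_real_coinduct[where P="\<lambda>g. \<exists>h r. smooth h \<and> g = (\<lambda>x. r * h (c * x + d))"])
  show "\<exists>h r. smooth h \<and> (\<lambda>x. f (c * x + d)) = (\<lambda>x. r * h (c * x + d))"
    by (rule exI[of _ f], rule exI[of _ 1]) (simp add: assms)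
next
  fix g assume "\<exists>h r. smooth h \<and> g = (\<lambda>x. r * h (c * x + d))"
  then obtain h r where h: "smooth h" "g = (\<lambda>x. r * h (c * x + d))" by blast
  have "(g has_real_derivative (r * c) * deriv h (c * x + d)) (at x)" for x
  proof -
    have "((\<lambda>x. c * x + d) has_real_derivative c) (at x)"
      using DERIV_add[OF DERIV_cmult_Id DERIV_const, of c d x] by simp
    from DERIV_cmult[OF DERIV_chain2[OF smooth_real_deriv(1)[OF h(1)] this], of r]
    show ?thesis unfolding h by (simp add: mult_ac)
  qed
  then show "\<exists>f'. (\<exists>h r. smooth h \<and> f' = (\<lambda>x. r * h (c * x + d))) \<and>
      (\<forall>x. (g has_real_derivative f' x) (at x))"
    using smooth_real_deriv(2)[OF h(1)]
    by (intro exI[of _ "\<lambda>x. (r * c) * deriv h (c * x + d)"]) blast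
qed

text \<open>Smooth functions increasing to the indicator function of an open interval.\<close>

definition plateau :: "real \<Rightarrow> real \<Rightarrow> nat \<Rightarrow> real \<Rightarrow> real" where
  "plateau s t n x = 1 - exp (- real n * (flat_exp 1 (x - s) * flat_exp 1 (t - x)))"

lemma smooth_plateau: "smooth (plateau s t n)"
proof -
  have "smooth (\<lambda>x. flat_exp 1 (x - s))" "smooth (\<lambda>x. flat_exp 1 (t - x))"
    using smooth_compose_affine[OF smooth_flat_exp, of 1 1 "-s"]
      smooth_compose_affine[OF smooth_flat_exp, of 1 "-1" t] by (simp_all add: add.commute)
  then show ?thesis unfolding plateau_def[abs_def]
    by (intro smooth_diff smooth_const smooth_exp_compose smooth_mult)
qed

lemma plateau_range: "0 \<le> plateau s t n x" "plateau s t n x \<le> 1"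
  by (auto simp: plateau_def flat_exp_def)

lemma plateau_eq_0: "x \<notin> {s<..<t} \<Longrightarrow> plateau s t n x = 0"
  by (auto simp: plateau_def flat_exp_def)

lemma plateau_pos: "s < x \<Longrightarrow> x < t \<Longrightarrow> 0 < n \<Longrightarrow> 0 < plateau s t n x"
  by (auto simp: plateau_def flat_exp_def)

lemma plateau_tendsto: "(\<lambda>n. plateau s t n x) \<longlonglongrightarrow> indicator {s<..<t} x"
proof (cases "x \<in> {s<..<t}")
  case True
  define q where "q = exp (- (flat_exp 1 (x - s) * flat_exp 1 (t - x)))"
  have q: "0 \<le> q" "q < 1" using True by (auto simp: q_def flat_exp_def)
  have "plateau s t n x = 1 - q ^ n" for n
    by (simp add: plateau_def q_def exp_of_nat_mult[symmetric])
  moreover have "(\<lambda>n. 1 - q ^ n) \<longlonglongrightarrow> 1 - 0"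
    by (intro tendsto_intros LIMSEQ_realpow_zero q)
  ultimately show ?thesis using True by simp
qed (simp add: plateau_eq_0)

section \<open>One-dimensional weak derivatives\<close>

text \<open>Rational end points are enough because the integral depends continuously on them. Two finite
measures which agree on half-lines are equal, and this applies to the positive and the negative part.\<close>

lemma AE_eq_0_if_integral_intervals_0:
  fixes R :: "real \<Rightarrow> real"
  assumes R: "integrable lborel R"
    and zero: "\<And>s t. s \<in> \<rat> \<Longrightarrow> t \<in> \<rat> \<Longrightarrow> \<alpha> < s \<Longrightarrow> s < t \<Longrightarrow> t < \<beta> \<Longrightarrow> (LINT x:{s<..<t}|lborel. R x) = 0"
  shows "AE x in lborel. \<alpha> < x \<and> x < \<beta> \<longrightarrow> R x = 0"
proof -
  define f where "f = (\<lambda>x. indicator {\<alpha><..<\<beta>} x * R x)"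
  have f[measurable]: "integrable lborel f"
    using integrable_real_mult_indicator[OF _ R, of "{\<alpha><..<\<beta>}"] by (simp add: f_def mult.commute)
  have half: "(LINT x:{y<..}|lborel. f x) = 0" for y
  proof (cases "max \<alpha> y < \<beta>")
    case True
    define a where "a = max \<alpha> y"
    have "\<exists>s\<in>\<rat>. a < s \<and> s < min (a + 1 / Suc n) \<beta>" for n
      using True by (intro Rats_dense_in_real) (auto simp: a_def)
    then obtain s where s: "\<And>n. s n \<in> \<rat>" "\<And>n. a < s n" "\<And>n. s n < a + 1 / Suc n" "\<And>n. s n < \<beta>"
      by (metis min_less_iff_conj)
    have "\<exists>t\<in>\<rat>. max (s n) (\<beta> - 1 / Suc n) < t \<and> t < \<beta>" for n
      using s(4)[of n] by (intro Rats_dense_in_real) auto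
    then obtain t where t: "\<And>n. t n \<in> \<rat>" "\<And>n. s n < t n" "\<And>n. \<beta> - 1 / Suc n < t n" "\<And>n. t n < \<beta>"
      by (metis max_less_iff_conj)
    have inv: "(\<lambda>n. 1 / real (Suc n)) \<longlonglongrightarrow> 0"
      by (rule LIMSEQ_Suc[OF lim_1_over_n])
    have lim: "(\<lambda>n. LINT x|lborel. indicator {s n<..<t n} x * f x) \<longlonglongrightarrow> (LINT x|lborel. indicator {a<..<\<beta>} x * f x)"
    proof (rule integral_dominated_convergence[where w="\<lambda>x. norm (f x)"])
      show "AE x in lborel. (\<lambda>n. indicator {s n<..<t n} x * f x) \<longlonglongrightarrow> indicator {a<..<\<beta>} x * f x"
      proof (intro AE_I2 tendsto_mult_right tendsto_eventually)
        fix x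
        show "eventually (\<lambda>n. indicator {s n<..<t n} x = (indicator {a<..<\<beta>} x :: real)) sequentially"
        proof (cases "x \<in> {a<..<\<beta>}")
          case True
          then have "eventually (\<lambda>n. 1 / real (Suc n) < min (x - a) (\<beta> - x)) sequentially"
            by (intro order_tendstoD[OF inv]) auto
          then show ?thesis
          proof eventually_elim
            case (elim n)
            then have "s n < x" "x < t n" using s(3)[of n] t(3)[of n] by linarith+
            then show ?case using True by simp
          qed
        next
          case False
          have "x \<notin> {s n<..<t n}" for n using False s(2)[of n] t(4)[of n] by auto
          then show ?thesis using False by simp
        qed
      qed
    qed (use f in \<open>auto split: split_indicator\<close>)
    have "(LINT x|lborel. indicator {s n<..<t n} x * f x) = 0" for n
    proof -
      have "(LINT x|lborel. indicator {s n<..<t n} x * f x) = (LINT x:{s n<..<t n}|lborel. R x)"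
        unfolding set_lebesgue_integral_def
        using s(2)[of n] t(4)[of n]
        by (intro Bochner_Integration.integral_cong) (auto simp: f_def a_def split: split_indicator)
      then show ?thesis using zero[of "s n" "t n"] s[of n] t[of n] by (auto simp: a_def)
    qed
    then have "(LINT x|lborel. indicator {a<..<\<beta>} x * f x) = 0"
      using lim LIMSEQ_unique[OF tendsto_const] by fastforce
    moreover have "indicator {a<..<\<beta>} x * f x = indicator {y<..} x * f x" for x
      by (auto simp: a_def f_def split: split_indicator)
    ultimately show ?thesis by (simp add: set_lebesgue_integral_def)
  next
    case False
    then have "(\<lambda>x. indicator {y<..} x * f x) = (\<lambda>x. 0)"
      by (auto simp: f_def fun_eq_iff split: split_indicator)
    then show ?thesis by (simp add: set_lebesgue_integral_def)
  qed
  define P N where "P = density lborel (\<lambda>x. ennreal (f x))" and "N = density lborel (\<lambda>x. ennreal (- f x))"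
  have emP: "emeasure P A = ennreal (LINT x|lborel. indicator A x * max 0 (f x))"
    and emN: "emeasure N A = ennreal (LINT x|lborel. indicator A x * max 0 (- f x))" if "A \<in> sets borel" for A
  proof -
    have *: "integrable lborel (\<lambda>x. indicator A x * max 0 (c * f x))" for c :: real
      using that f by (intro integrable_mult_indicator[of _ _ "\<lambda>x. max 0 (c * f x)", simplified real_scaleR_def])
        (auto intro!: Bochner_Integration.integrable_max)
    show "emeasure P A = ennreal (LINT x|lborel. indicator A x * max 0 (f x))"
      using that f *[of 1] unfolding P_def
      by (subst emeasure_density) (auto intro!: nn_integral_cong simp: nn_integral_eq_integral[symmetric] max_def ennreal_neg split: split_indicator)
    show "emeasure N A = ennreal (LINT x|lborel. indicator A x * max 0 (- f x))"
      using that f *[of "-1"] unfolding N_def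
      by (subst emeasure_density) (auto intro!: nn_integral_cong simp: nn_integral_eq_integral[symmetric] max_def ennreal_neg split: split_indicator)
  qed
  have split: "(LINT x|lborel. indicator A x * max 0 (f x)) - (LINT x|lborel. indicator A x * max 0 (- f x))
      = (LINT x:A|lborel. f x)" if "A \<in> sets borel" for A
  proof -
    have *: "integrable lborel (\<lambda>x. indicator A x * max 0 (c * f x))" for c :: real
      using that f by (intro integrable_mult_indicator[of _ _ "\<lambda>x. max 0 (c * f x)", simplified real_scaleR_def])
        (auto intro!: Bochner_Integration.integrable_max)
    show ?thesis
      using *[of 1] *[of "-1"] unfolding set_lebesgue_integral_def
      by (subst Bochner_Integration.integral_diff[symmetric], simp, simp)
        (intro Bochner_Integration.integral_cong, auto split: split_indicator)
  qed
  have nonneg: "0 \<le> (LINT x|lborel. indicator A x * max 0 (c * f x))" for c A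
    by (rule Bochner_Integration.integral_nonneg) auto
  have "P = N"
  proof (rule measure_eqI_lessThan)
    show "emeasure P {x<..} = emeasure N {x<..}" for x
      using split[of "{x<..}"] half[of x] by (simp add: emP emN)
  qed (auto simp: P_def[symmetric] emP, auto simp: P_def N_def)
  then have all: "(LINT x:A|lborel. f x) = 0" if "A \<in> sets borel" for A
    using split[OF that] emP[OF that] emN[OF that] nonneg[of A 1] nonneg[of A "-1"] by simp
  have "AE x in lborel. f x = 0"
    by (rule density_unique_real[OF f, of "\<lambda>x. 0"]) (use all in \<open>auto simp: set_lebesgue_integral_def\<close>)
  then show ?thesis
    by eventually_elim (auto simp: f_def)
qed

lemma integrable_indicator_interval [simp]: "integrable lborel (indicat_real {s..t::real})"
  by (rule integrable_real_indicator) (auto simp: emeasure_lborel_Icc_eq)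

definition bump :: "real \<Rightarrow> real \<Rightarrow> (real \<Rightarrow> real) \<Rightarrow> bool" where
  "bump s t f \<longleftrightarrow> smooth f \<and> (\<forall>x. x \<notin> {s..t} \<longrightarrow> f x = 0)"

lemma bump_deriv: "bump s t f \<Longrightarrow> bump s t (deriv f)"
proof -
  assume f: "bump s t f"
  have "deriv f x = 0" if "x \<notin> {s..t}" for x
  proof -
    have "eventually (\<lambda>x. x \<in> - {s..t}) (nhds x)"
      using that by (intro eventually_nhds_in_open) auto
    then have "eventually (\<lambda>x. f x = 0) (nhds x)"
      by eventually_elim (use f in \<open>auto simp: bump_def\<close>)
    then have "deriv f x = deriv (\<lambda>x. 0) x" by (rule deriv_cong_ev) simp
    then show ?thesis by simp
  qed
  with f show ?thesis by (auto simp: bump_def intro: smooth_real_deriv)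
qed

lemma bump_mono: "bump s t f \<Longrightarrow> s' \<le> s \<Longrightarrow> t \<le> t' \<Longrightarrow> bump s' t' f"
  by (auto simp: bump_def)

lemma bump_plateau: "bump s t (plateau s t n)"
  by (auto simp: bump_def smooth_plateau intro!: plateau_eq_0)

lemma smooth_measurable: "smooth f \<Longrightarrow> f \<in> borel_measurable borel"
  by (intro borel_measurable_continuous_onI smooth_continuous)

lemma smooth_bounded_on_interval:
  fixes p :: "real \<Rightarrow> real"
  assumes "smooth p"
  obtains B where "0 \<le> B" "\<And>x. x \<in> {s..t} \<Longrightarrow> \<bar>p x\<bar> \<le> B"
proof -
  have "bounded (p ` {s..t})"
    by (intro compact_imp_bounded compact_continuous_image smooth_continuous assms) simp
  then obtain B where "\<And>x. x \<in> {s..t} \<Longrightarrow> \<bar>p x\<bar> \<le> B"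
    unfolding bounded_iff by fastforce
  then have "\<bar>p x\<bar> \<le> max B 0" if "x \<in> {s..t}" for x using that by fastforce
  then show ?thesis using that[of "max B 0"] by simp
qed

lemma bump_bounded:
  assumes "bump s t f"
  obtains B where "0 \<le> B" "\<And>x. \<bar>f x\<bar> \<le> B"
proof -
  from assms have "smooth f" by (simp add: bump_def)
  then obtain B where B: "0 \<le> B" "\<And>x. x \<in> {s..t} \<Longrightarrow> \<bar>f x\<bar> \<le> B"
    using smooth_bounded_on_interval by blast
  have "\<bar>f x\<bar> \<le> B" for x
    using assms B(1) B(2)[of x] by (cases "x \<in> {s..t}") (auto simp: bump_def)
  then show ?thesis using that B(1) by blast
qed

lemma integrable_mult_bounded:
  fixes h g :: "'a \<Rightarrow> real"
  assumes "integrable M g" "h \<in> borel_measurable M" "\<And>x. \<bar>h x\<bar> \<le> B"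
  shows "integrable M (\<lambda>x. g x * h x)" "integrable M (\<lambda>x. h x * g x)"
proof -
  show *: "integrable M (\<lambda>x. g x * h x)"
  proof (rule Bochner_Integration.integrable_bound[where f="\<lambda>x. B * g x"])
    have "\<bar>g x\<bar> * \<bar>h x\<bar> \<le> \<bar>B\<bar> * \<bar>g x\<bar>" for x
      using mult_right_mono[of "\<bar>h x\<bar>" "\<bar>B\<bar>" "\<bar>g x\<bar>"] assms(3)[of x] by (simp add: mult.commute)
    then show "AE x in M. norm (g x * h x) \<le> norm (B * g x)"
      by (intro AE_I2) (simp add: abs_mult)
  qed (use assms in auto)
  then show "integrable M (\<lambda>x. h x * g x)" by (simp add: mult.commute)
qed

lemma bump_integrable: "bump s t f \<Longrightarrow> integrable lborel f"
proof -
  assume f: "bump s t f"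
  then have "integrable lborel (\<lambda>x. indicator {s..t} x *\<^sub>R f x)"
    by (intro borel_integrable_compact smooth_continuous) (auto simp: bump_def)
  then show ?thesis
    by (rule Bochner_Integration.integrable_cong[THEN iffD1, rotated -1])
      (use f in \<open>auto simp: bump_def split: split_indicator\<close>)
qed

text \<open>Testing against derivatives of bumps thus means testing against all bumps of mean zero, which determines
a function up to an additive constant.\<close>

lemma bump_antiderivative:
  assumes h: "bump s t h" and "s \<le> t" and zero: "(LINT x|lborel. h x) = 0"
  shows "\<exists>F. bump s t F \<and> deriv F = h"
proof -
  have cont: "continuous_on A h" for A using h by (auto simp: bump_def smooth_continuous)
  have "\<exists>F. \<forall>x :: real. - \<infinity> < ereal x \<longrightarrow> ereal x < \<infinity> \<longrightarrow> (F has_vector_derivative h x) (at x)"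
    by (rule einterval_antiderivative) (use cont[of UNIV] in \<open>auto simp: continuous_on_eq_continuous_at\<close>)
  then obtain F0 where F0: "\<And>x. (F0 has_real_derivative h x) (at x)"
    by (auto simp: has_real_derivative_iff_has_vector_derivative)
  define F where "F = (\<lambda>x. F0 x - F0 s)"
  have F: "(F has_real_derivative h x) (at x)" for x
    unfolding F_def using DERIV_diff[OF F0 DERIV_const] by simp
  note Fw = has_field_derivative_at_within[OF F]
  have "F x = 0" if "x \<le> s" for x
  proof (cases "x = s")
    case False
    have "F x = F s"
    proof (rule DERIV_isconst_end[where f=F, symmetric])
      show "continuous_on {x..s} F" by (rule DERIV_continuous_on[OF Fw])
      show "(F has_real_derivative 0) (at y)" if "x < y" "y < s" for y
        using F[of y] h that by (auto simp: bump_def)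
    qed (use that False in auto)
    then show ?thesis by (simp add: F_def)
  qed (simp add: F_def)
  moreover have Ft: "F t = 0"
  proof -
    have "(LINT x|lborel. indicator {s..t} x *\<^sub>R h x) = F t - F s"
      by (rule integral_FTC_atLeastAtMost)
        (use \<open>s \<le> t\<close> cont Fw in \<open>auto simp: has_real_derivative_iff_has_vector_derivative[symmetric]\<close>)
    moreover have "(LINT x|lborel. indicator {s..t} x *\<^sub>R h x) = (LINT x|lborel. h x)"
      using h by (intro Bochner_Integration.integral_cong) (auto simp: bump_def split: split_indicator)
    ultimately show ?thesis using zero by (simp add: F_def)
  qed
  moreover have "F x = 0" if "t \<le> x" for x
  proof (cases "x = t")
    case False
    have "F x = F t"
    proof (rule DERIV_isconst_end[where f=F])
      show "continuous_on {t..x} F" by (rule DERIV_continuous_on[OF Fw])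
      show "(F has_real_derivative 0) (at y)" if "t < y" "y < x" for y
        using F[of y] h that by (auto simp: bump_def)
    qed (use that False in auto)
    then show ?thesis using Ft by simp
  qed (simp add: Ft)
  moreover have "smooth F" by (rule smooth_antiderivative[OF _ F]) (use h in \<open>simp add: bump_def\<close>)
  moreover have "deriv F = h" using F by (auto simp: DERIV_imp_deriv)
  ultimately show ?thesis by (intro exI[of _ F]) (auto simp: bump_def)
qed

definition primitive :: "(real \<Rightarrow> real) \<Rightarrow> real \<Rightarrow> real \<Rightarrow> real" where
  "primitive g \<alpha> t = (LINT x:{\<alpha>..t}|lborel. g x)"

lemma integrable_times_prod:
  fixes f g :: "real \<Rightarrow> real"
  assumes f: "integrable lborel f" and g: "integrable lborel g"
  shows "integrable (lborel \<Otimes>\<^sub>M lborel) (\<lambda>(x, t). f x * g t)"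
proof (rule lborel_pair.Fubini_integrable)
  show "(\<lambda>(x, t). f x * g t) \<in> borel_measurable (lborel \<Otimes>\<^sub>M lborel)"
    using borel_measurable_integrable[OF f] borel_measurable_integrable[OF g] by measurable
  show "integrable lborel (\<lambda>x. \<integral>y. norm (case (x, y) of (x, t) \<Rightarrow> f x * g t) \<partial>lborel)"
    using f by (auto simp: abs_mult)
  show "AE x in lborel. integrable lborel (\<lambda>y. case (x, y) of (x, t) \<Rightarrow> f x * g t)"
    using g by auto
qed

text \<open>Fubini's theorem on the triangle below the diagonal; no regularity of \<open>g\<close> beyond
integrability is available, since \<open>g\<close> will be a weak derivative.\<close>

lemma integral_by_parts_primitive:
  fixes g :: "real \<Rightarrow> real"
  assumes g: "integrable lborel g" and "smooth p" and "\<alpha> \<le> \<beta>"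
  shows "set_integrable lborel {\<alpha>..\<beta>} (\<lambda>t. primitive g \<alpha> t * deriv p t)"
    "(LINT t:{\<alpha>..\<beta>}|lborel. primitive g \<alpha> t * deriv p t) =
      primitive g \<alpha> \<beta> * p \<beta> - (LINT x:{\<alpha>..\<beta>}|lborel. g x * p x)"
proof -
  note dp = smooth_real_deriv[OF \<open>smooth p\<close>]
  note dpw = has_field_derivative_at_within[OF dp(1)]
  define I where "I = indicat_real {\<alpha>..\<beta>}"
  have [measurable]: "g \<in> borel_measurable borel" "deriv p \<in> borel_measurable borel"
    using g smooth_measurable[OF dp(2)] by auto
  have idp: "integrable lborel (\<lambda>t. I t * deriv p t)"
    using borel_integrable_compact[of "{\<alpha>..\<beta>}" "deriv p"] smooth_continuous[OF dp(2)]
    by (simp add: I_def)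
  have ig: "integrable lborel (\<lambda>x. I x * g x)"
    using integrable_real_mult_indicator[OF _ g, of "{\<alpha>..\<beta>}"] by (simp add: I_def mult.commute)
  define J where "J = (\<lambda>z::real \<times> real. if fst z \<le> snd z then 1 else 0 :: real)"
  have "J \<in> borel_measurable (lborel \<Otimes>\<^sub>M lborel)"
  proof -
    have "closed {z::real \<times> real. fst z \<le> snd z}" by (intro closed_Collect_le continuous_intros)
    then have "indicator {z::real \<times> real. fst z \<le> snd z} \<in> borel_measurable (borel :: (real \<times> real) measure)"
      by (rule borel_measurable_indicator[OF borel_closed])
    moreover have "J = indicator {z. fst z \<le> snd z}" by (auto simp: J_def fun_eq_iff)
    ultimately have "J \<in> borel_measurable borel" by metis
    then show ?thesis unfolding lborel_prod measurable_lborel2 .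
  qed
  moreover have "\<bar>J z\<bar> \<le> 1" for z by (simp add: J_def)
  ultimately have "integrable (lborel \<Otimes>\<^sub>M lborel) (\<lambda>z. (case z of (x, t) \<Rightarrow> (I x * g x) * (I t * deriv p t)) * J z)"
    using integrable_mult_bounded(1)[OF integrable_times_prod[OF ig idp], of J 1] by blast
  then have int: "integrable (lborel \<Otimes>\<^sub>M lborel) (\<lambda>(x, t). (I x * g x) * (I t * deriv p t) * (if x \<le> t then 1 else 0))"
    by (simp add: case_prod_beta' J_def)
  have inner_t: "(\<integral>x. (I x * g x) * (I t * deriv p t) * (if x \<le> t then 1 else 0) \<partial>lborel) = indicator {\<alpha>..\<beta>} t *\<^sub>R (primitive g \<alpha> t * deriv p t)" for t
  proof -
    have "(\<integral>x. (I x * g x) * (I t * deriv p t) * (if x \<le> t then 1 else 0) \<partial>lborel)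
       = (\<integral>x. (I t * deriv p t) * (indicator {\<alpha>..t} x *\<^sub>R g x) \<partial>lborel)"
      by (intro Bochner_Integration.integral_cong) (auto simp: I_def split: split_indicator)
    also have "\<dots> = (I t * deriv p t) * (\<integral>x. indicator {\<alpha>..t} x *\<^sub>R g x \<partial>lborel)"
      by (rule integral_mult_right_zero)
    finally show ?thesis by (simp add: I_def primitive_def set_lebesgue_integral_def mult_ac)
  qed
  have inner_x: "(\<integral>t. (I x * g x) * (I t * deriv p t) * (if x \<le> t then 1 else 0) \<partial>lborel) = I x * g x * (p \<beta> - p x)" for x
  proof (cases "x \<in> {\<alpha>..\<beta>}")
    case True
    have "(\<integral>t. (I x * g x) * (I t * deriv p t) * (if x \<le> t then 1 else 0) \<partial>lborel) = (\<integral>t. (I x * g x) * (indicator {x..\<beta>} t *\<^sub>R deriv p t) \<partial>lborel)"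
      using True by (intro Bochner_Integration.integral_cong) (auto simp: I_def split: split_indicator)
    also have "\<dots> = I x * g x * (p \<beta> - p x)"
      using True dp smooth_continuous[OF dp(2)]
      by (subst integral_mult_right_zero, subst integral_FTC_atLeastAtMost)
        (auto simp: has_real_derivative_iff_has_vector_derivative[symmetric] dpw)
    finally show ?thesis .
  qed (simp add: I_def)
  show "set_integrable lborel {\<alpha>..\<beta>} (\<lambda>t. primitive g \<alpha> t * deriv p t)"
    using lborel_pair.integrable_snd[OF int] unfolding inner_t set_integrable_def .
  have "(LINT t:{\<alpha>..\<beta>}|lborel. primitive g \<alpha> t * deriv p t) = (\<integral>x. I x * g x * (p \<beta> - p x) \<partial>lborel)"
    using lborel_pair.Fubini_integral[OF int] unfolding inner_t inner_x set_lebesgue_integral_def .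
  also have "\<dots> = (\<integral>x. p \<beta> * (I x * g x) - I x * (g x * p x) \<partial>lborel)"
    by (simp add: algebra_simps)
  also have "\<dots> = (\<integral>x. p \<beta> * (I x * g x) \<partial>lborel) - (\<integral>x. I x * (g x * p x) \<partial>lborel)"
  proof (rule Bochner_Integration.integral_diff)
    obtain B where B: "0 \<le> B" "\<And>x. x \<in> {\<alpha>..\<beta>} \<Longrightarrow> \<bar>p x\<bar> \<le> B"
      using smooth_bounded_on_interval[OF \<open>smooth p\<close>] by blast
    have "integrable lborel (\<lambda>x. g x * (I x * p x))"
    proof (rule integrable_mult_bounded[OF g])
      show "\<bar>I x * p x\<bar> \<le> B" for x using B(1) B(2)[of x] by (auto simp: I_def split: split_indicator)
    qed (use smooth_measurable[OF \<open>smooth p\<close>] in \<open>auto simp: I_def\<close>)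
    then show "integrable lborel (\<lambda>x. I x * (g x * p x))" by (simp add: mult_ac)
  qed (use ig in auto)
  also have "\<dots> = primitive g \<alpha> \<beta> * p \<beta> - (LINT x:{\<alpha>..\<beta>}|lborel. g x * p x)"
    by (simp add: I_def primitive_def set_lebesgue_integral_def)
  finally show "(LINT t:{\<alpha>..\<beta>}|lborel. primitive g \<alpha> t * deriv p t) =
      primitive g \<alpha> \<beta> * p \<beta> - (LINT x:{\<alpha>..\<beta>}|lborel. g x * p x)" .
qed

lemma bump_integral_by_parts_primitive:
  assumes g: "integrable lborel g" and f: "bump s t f" and st: "\<alpha> < s" "t < \<beta>" "s \<le> t"
  shows "(LINT x|lborel. indicator {\<alpha>..\<beta>} x * primitive g \<alpha> x * deriv f x) = - (LINT x|lborel. g x * f x)"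
proof -
  have "(LINT x:{\<alpha>..\<beta>}|lborel. g x * f x) = (LINT x|lborel. g x * f x)"
    unfolding set_lebesgue_integral_def
    using f st by (intro Bochner_Integration.integral_cong) (auto simp: bump_def split: split_indicator)
  moreover have "f \<beta> = 0" using f st by (auto simp: bump_def)
  ultimately show ?thesis
    using integral_by_parts_primitive(2)[OF g, of f \<alpha> \<beta>] f st
    by (simp add: bump_def set_lebesgue_integral_def mult.assoc)
qed

lemma primitive_bounded:
  assumes "integrable lborel g"
  shows "\<bar>primitive g \<alpha> t\<bar> \<le> (LINT x|lborel. \<bar>g x\<bar>)"
proof -
  have "\<bar>primitive g \<alpha> t\<bar> \<le> (LINT x|lborel. \<bar>indicator {\<alpha>..t} x *\<^sub>R g x\<bar>)"
    unfolding primitive_def set_lebesgue_integral_def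
    by (rule integral_abs_bound)
  also have "\<dots> \<le> (LINT x|lborel. \<bar>g x\<bar>)"
    using assms
    by (intro integral_mono integrable_abs integrable_mult_indicator)
      (auto simp: abs_mult split: split_indicator)
  finally show ?thesis .
qed

lemma primitive_diff:
  assumes "integrable lborel g" "\<alpha> \<le> s" "s \<le> t"
  shows "primitive g \<alpha> t - primitive g \<alpha> s = (LINT x:{s..t}|lborel. g x)"
proof -
  have i: "integrable lborel (\<lambda>x. indicator A x *\<^sub>R g x)" if "A \<in> sets borel" for A
    using that assms(1) by (intro integrable_mult_indicator) auto
  have "AE x in lborel. x \<noteq> s" by (rule AE_lborel_singleton)
  then have "(LINT x|lborel. indicator {\<alpha>..t} x *\<^sub>R g x - indicator {\<alpha>..s} x *\<^sub>R g x)
      = (LINT x|lborel. indicator {s..t} x *\<^sub>R g x)"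
    using assms(1)
    by (intro integral_cong_AE) (measurable, auto elim!: eventually_mono split: split_indicator intro: order_trans[OF assms(2)] order_trans[OF _ assms(3)] assms(2,3))
  then show ?thesis
    by (simp add: primitive_def set_lebesgue_integral_def i del: real_scaleR_def)
qed

lemma primitive_continuous:
  assumes g: "integrable lborel g"
  shows "continuous_on UNIV (primitive g \<alpha>)"
proof (rule continuous_on_sequentiallyI)
  fix X :: "nat \<Rightarrow> real" and t assume X: "X \<longlonglongrightarrow> t"
  have [measurable]: "g \<in> borel_measurable borel" using g by auto
  show "(\<lambda>n. primitive g \<alpha> (X n)) \<longlonglongrightarrow> primitive g \<alpha> t"
    unfolding primitive_def set_lebesgue_integral_def
  proof (rule integral_dominated_convergence[where w="\<lambda>x. norm (g x)"])
    have "AE x in lborel. x \<noteq> t" by (rule AE_lborel_singleton)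
    then show "AE x in lborel. (\<lambda>n. indicator {\<alpha>..X n} x *\<^sub>R g x) \<longlonglongrightarrow> indicator {\<alpha>..t} x *\<^sub>R g x"
    proof eventually_elim
      case (elim x)
      have "eventually (\<lambda>n. indicator {\<alpha>..X n} x = (indicator {\<alpha>..t} x :: real)) sequentially"
      proof (cases "x < t")
        case True
        then have "eventually (\<lambda>n. x < X n) sequentially" by (rule order_tendstoD(1)[OF X])
        then show ?thesis by eventually_elim (use True in \<open>auto simp: indicator_def\<close>)
      next
        case False
        then have "eventually (\<lambda>n. X n < x) sequentially" using elim by (intro order_tendstoD(2)[OF X]) auto
        then show ?thesis by eventually_elim (use False elim in \<open>auto simp: indicator_def\<close>)
      qed
      then show ?case by (intro tendsto_scaleR tendsto_const tendsto_eventually)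
    qed
  qed (use g in \<open>auto split: split_indicator\<close>)
qed

text \<open>The du Bois-Reymond lemma. Countably many test functions are needed in order to apply it on almost every
line. They are the antiderivatives of the plateaus with rational end points, made mean-free by subtracting
a multiple of one fixed bump \<open>k0\<close>; the additive constant \<open>e\<close> is the integral of the difference of the two
functions against \<open>k0\<close>.\<close>

lemma countable_test_functions:
  fixes \<alpha> \<beta> :: real
  assumes "\<alpha> < \<beta>"
  obtains T where "countable T"
    "\<And>f. f \<in> T \<Longrightarrow> \<exists>s t. \<alpha> < s \<and> s \<le> t \<and> t < \<beta> \<and> bump s t f"
    "\<And>u g. integrable lborel u \<Longrightarrow> integrable lborel g \<Longrightarrow>
      (\<And>f. f \<in> T \<Longrightarrow> (LINT x|lborel. u x * deriv f x) = - (LINT x|lborel. g x * f x)) \<Longrightarrow>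
      \<exists>e. AE x in lborel. \<alpha> < x \<and> x < \<beta> \<longrightarrow> u x = e + primitive g \<alpha> x"
proof -
  obtain s0 where s0: "\<alpha> < s0" "s0 < \<beta>" using dense[OF assms] by blast
  obtain t0 where t0: "s0 < t0" "t0 < \<beta>" using dense[OF s0(2)] by blast
  define I0 where "I0 = (LINT x|lborel. plateau s0 t0 1 x)"
  have ip: "integrable lborel (plateau s t n)" for s t n by (rule bump_integrable[OF bump_plateau])
  have "I0 > 0"
  proof -
    have "I0 \<noteq> 0"
    proof
      assume "I0 = 0"
      then have "AE x in lborel. plateau s0 t0 1 x = 0"
        using integral_nonneg_eq_0_iff_AE[OF ip] plateau_range(1) by (auto simp: I0_def)
      then have "AE x in lborel. x \<notin> {s0<..<t0}"
        by eventually_elim (use plateau_pos[of s0 _ t0 1] in force)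
      then have "{s0<..<t0} \<in> null_sets lborel" by (subst AE_iff_null_sets) auto
      then show False using t0 by (simp add: null_sets_def)
    qed
    moreover have "0 \<le> I0" unfolding I0_def by (rule Bochner_Integration.integral_nonneg) (rule plateau_range)
    ultimately show ?thesis by simp
  qed
  define k0 where "k0 = (\<lambda>x. plateau s0 t0 1 x * (1 / I0))"
  have k0: "bump s0 t0 k0" "integrable lborel k0" "(LINT x|lborel. k0 x) = 1"
    using smooth_mult[OF smooth_plateau[of s0 t0 1] smooth_const[of "1 / I0"]]
      plateau_eq_0[of _ s0 t0 1] ip[of s0 t0 1] \<open>I0 > 0\<close>
    unfolding k0_def bump_def by (auto simp: I0_def field_simps simp del: One_nat_def)
  define c where "c = (\<lambda>s t n. LINT x|lborel. plateau s t n x)"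
  define h where "h = (\<lambda>s t n x. plateau s t n x - c s t n * k0 x)"
  have "\<exists>F. bump (min s s0) (max t t0) F \<and> deriv F = h s t n" if "s < t" for s t n
  proof (rule bump_antiderivative)
    have "bump (min s s0) (max t t0) (plateau s t n)" "bump (min s s0) (max t t0) k0"
      by (auto intro: bump_mono[OF bump_plateau] bump_mono[OF k0(1)])
    then show "bump (min s s0) (max t t0) (h s t n)"
      by (auto simp: h_def bump_def intro!: smooth_diff smooth_mult)
    show "(LINT x|lborel. h s t n x) = 0"
      using ip k0 by (simp add: h_def c_def)
  qed (use that in auto)
  then obtain F where F: "\<And>s t n. s < t \<Longrightarrow> bump (min s s0) (max t t0) (F s t n)" "\<And>s t n. s < t \<Longrightarrow> deriv (F s t n) = h s t n"
    by metis
  define T where "T = (\<lambda>(s, t, n). F s t n) ` {(s, t, n). s \<in> \<rat> \<and> t \<in> \<rat> \<and> \<alpha> < s \<and> s < t \<and> t < \<beta>}"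
  show ?thesis
  proof (rule that[of T])
    have "countable (\<rat> \<times> \<rat> \<times> (UNIV :: nat set))" by (intro countable_SIGMA countable_rat) auto
    then show "countable T"
      unfolding T_def by (rule countable_image[OF countable_subset[rotated]]) auto
    show "\<exists>s t. \<alpha> < s \<and> s \<le> t \<and> t < \<beta> \<and> bump s t f" if "f \<in> T" for f
    proof -
      from that obtain s t n where "f = F s t n" "\<alpha> < s" "s < t" "t < \<beta>" by (auto simp: T_def)
      with F(1)[of s t n] s0 t0 show ?thesis
        by (intro exI[of _ "min s s0"] exI[of _ "max t t0"]) auto
    qed
  next
    fix u g :: "real \<Rightarrow> real"
    assume u: "integrable lborel u" and g: "integrable lborel g"
      and weak: "\<And>f. f \<in> T \<Longrightarrow> (LINT x|lborel. u x * deriv f x) = - (LINT x|lborel. g x * f x)"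
    define E where "E = (\<lambda>x. indicator {\<alpha>..\<beta>} x * (u x - primitive g \<alpha> x))"
    have mp[measurable]: "primitive g \<alpha> \<in> borel_measurable borel"
      by (rule borel_measurable_continuous_onI[OF primitive_continuous[OF g]])
    have iA: "integrable lborel (\<lambda>x. indicator {\<alpha>..\<beta>} x * primitive g \<alpha> x)"
    proof (rule integrable_mult_bounded)
      show "integrable lborel (indicat_real {\<alpha>..\<beta>})" by simp
    qed (use primitive_bounded[OF g] in auto)
    have iu: "integrable lborel (\<lambda>x. indicator {\<alpha>..\<beta>} x * u x)"
      using integrable_real_mult_indicator[OF _ u, of "{\<alpha>..\<beta>}"] by (simp add: mult.commute)
    have iE: "integrable lborel E"
      using Bochner_Integration.integrable_diff[OF iu iA] by (simp add: E_def right_diff_distrib)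
    define e where "e = (LINT x|lborel. E x * k0 x)"
    have Eh: "(LINT x|lborel. E x * plateau s t n x) = c s t n * e"
      if st: "s \<in> \<rat>" "t \<in> \<rat>" "\<alpha> < s" "s < t" "t < \<beta>" for s t n
    proof -
      let ?f = "F s t n" and ?s = "min s s0" and ?t = "max t t0"
      have f: "bump ?s ?t ?f" "?f \<in> T"
        using F(1)[OF st(4)] st unfolding T_def by (auto intro: rev_image_eqI[of "(s, t, n)"])
      have dfm: "deriv ?f \<in> borel_measurable lborel"
        using smooth_measurable[of "deriv ?f"] bump_deriv[OF f(1)] by (auto simp: bump_def)
      obtain B where B: "\<And>x. \<bar>deriv ?f x\<bar> \<le> B" using bump_bounded[OF bump_deriv[OF f(1)]] by metis
      have 1: "(LINT x|lborel. indicator {\<alpha>..\<beta>} x * primitive g \<alpha> x * deriv ?f x) = - (LINT x|lborel. g x * ?f x)"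
        by (rule bump_integral_by_parts_primitive[OF g f(1)]) (use st s0 t0 in auto)
      have 2: "(LINT x|lborel. indicator {\<alpha>..\<beta>} x * u x * deriv ?f x) = (LINT x|lborel. u x * deriv ?f x)"
      proof (intro Bochner_Integration.integral_cong refl)
        have "bump \<alpha> \<beta> (deriv ?f)"
          by (rule bump_mono[OF bump_deriv[OF f(1)]]) (use st s0 t0 in auto)
        then show "indicator {\<alpha>..\<beta>} x * u x * deriv ?f x = u x * deriv ?f x" for x
          by (auto simp: bump_def split: split_indicator)
      qed
      have "(LINT x|lborel. E x * deriv ?f x) = (LINT x|lborel. indicator {\<alpha>..\<beta>} x * u x * deriv ?f x) - (LINT x|lborel. indicator {\<alpha>..\<beta>} x * primitive g \<alpha> x * deriv ?f x)"
        using integrable_mult_bounded(1)[OF iA dfm B] integrable_mult_bounded(1)[OF iu dfm B]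
        by (subst Bochner_Integration.integral_diff[symmetric]) (auto simp: E_def algebra_simps)
      also have "\<dots> = 0" using 1 2 weak[OF f(2)] by simp
      finally have "(LINT x|lborel. E x * h s t n x) = 0" using F(2)[OF st(4)] by simp
      moreover have "(LINT x|lborel. E x * h s t n x) = (LINT x|lborel. E x * plateau s t n x) - (LINT x|lborel. c s t n * (E x * k0 x))"
      proof -
        obtain B where B: "\<And>x. \<bar>k0 x\<bar> \<le> B" using bump_bounded[OF k0(1)] by metis
        have "integrable lborel (\<lambda>x. E x * k0 x)"
          using integrable_mult_bounded(1)[OF iE _ B] k0 by (auto simp: bump_def intro: smooth_measurable)
        then have "integrable lborel (\<lambda>x. c s t n * (E x * k0 x))" by (rule integrable_mult_right)
        moreover have "integrable lborel (\<lambda>x. E x * plateau s t n x)"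
          using integrable_mult_bounded(1)[OF iE, of "plateau s t n" 1] plateau_range[of s t n]
          by (auto intro: smooth_measurable smooth_plateau)
        ultimately show ?thesis
          using Bochner_Integration.integral_diff[of lborel "\<lambda>x. E x * plateau s t n x" "\<lambda>x. c s t n * (E x * k0 x)"]
          by (simp add: h_def right_diff_distrib mult.left_commute)
      qed
      ultimately show ?thesis by (simp add: e_def)
    qed
    define R where "R = (\<lambda>x. E x - e * indicator {\<alpha>..\<beta>} x)"
    have iR: "integrable lborel R"
      unfolding R_def by (intro Bochner_Integration.integrable_diff iE integrable_mult_right integrable_indicator_interval)
    have "AE x in lborel. \<alpha> < x \<and> x < \<beta> \<longrightarrow> R x = 0"
    proof (rule AE_eq_0_if_integral_intervals_0[OF iR])
      fix s t assume st: "s \<in> \<rat>" "t \<in> \<rat>" "\<alpha> < s" "s < t" "t < \<beta>"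
      have "(\<lambda>n. LINT x|lborel. E x * plateau s t n x) \<longlonglongrightarrow> (LINT x|lborel. E x * indicator {s<..<t} x)"
      proof (rule integral_dominated_convergence[where w="\<lambda>x. norm (E x)"])
        show "AE x in lborel. norm (E x * plateau s t n x) \<le> norm (E x)" for n
          using plateau_range[of s t n] by (auto simp: abs_mult intro!: mult_left_le)
        show "(\<lambda>x. E x * plateau s t n x) \<in> borel_measurable lborel" for n
          using iE smooth_measurable[OF smooth_plateau[of s t n]] by auto
      qed (use iE in \<open>auto intro!: tendsto_intros plateau_tendsto\<close>)
      moreover have "(\<lambda>n. c s t n * e) \<longlonglongrightarrow> (t - s) * e"
      proof -
        have "(\<lambda>n. c s t n) \<longlonglongrightarrow> (LINT x|lborel. indicator {s<..<t} x)"
          unfolding c_def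
        proof (rule integral_dominated_convergence[where w="indicator {s..t}"])
          show "AE x in lborel. norm (plateau s t n x) \<le> indicator {s..t} x" for n
            using plateau_range[of s t n] plateau_eq_0[of _ s t n] by (auto simp: indicator_def)
          show "plateau s t n \<in> borel_measurable lborel" for n
            using smooth_measurable[OF smooth_plateau[of s t n]] by auto
        qed (auto intro!: plateau_tendsto)
        then show ?thesis using st by (intro tendsto_mult_right) auto
      qed
      ultimately have "(LINT x|lborel. E x * indicator {s<..<t} x) = (t - s) * e"
        using Eh[OF st] LIMSEQ_unique by auto
      moreover have "(LINT x:{s<..<t}|lborel. R x) = (LINT x|lborel. E x * indicator {s<..<t} x - e * indicator {s<..<t} x)"
        unfolding set_lebesgue_integral_def
        using st by (intro Bochner_Integration.integral_cong) (auto simp: R_def split: split_indicator)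
      moreover have "integrable lborel (\<lambda>x. E x * indicator {s<..<t} x)"
        by (rule integrable_real_mult_indicator) (auto intro: iE)
      ultimately show "(LINT x:{s<..<t}|lborel. R x) = 0"
        using st by simp
    qed
    then show "\<exists>e. AE x in lborel. \<alpha> < x \<and> x < \<beta> \<longrightarrow> u x = e + primitive g \<alpha> x"
      by (intro exI[of _ e]) (auto elim!: eventually_mono simp: R_def E_def)
  qed
qed

section \<open>Restriction of weak derivatives to lines\<close>

abbreviation pairing :: "(real \<times> real \<Rightarrow> real) \<Rightarrow> (real \<Rightarrow> real) \<Rightarrow> (real \<Rightarrow> real) \<Rightarrow> real" where
  "pairing u p q \<equiv> (LINT z|lborel. u z * (p (fst z) * q (snd z)))"

lemma AE_eq_0_if_integral_bumps_0:
  assumes R: "integrable lborel R"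
    and zero: "\<And>k s t. \<gamma> < s \<Longrightarrow> s \<le> t \<Longrightarrow> t < \<delta> \<Longrightarrow> bump s t k \<Longrightarrow> (LINT y|lborel. R y * k y) = 0"
  shows "AE y in lborel. \<gamma> < y \<and> y < \<delta> \<longrightarrow> R y = 0"
proof (rule AE_eq_0_if_integral_intervals_0[OF R])
  fix s t assume st: "\<gamma> < s" "s < t" "t < \<delta>"
  have "(\<lambda>n. LINT y|lborel. R y * plateau s t n y) \<longlonglongrightarrow> (LINT y|lborel. R y * indicator {s<..<t} y)"
  proof (rule integral_dominated_convergence[where w="\<lambda>x. norm (R x)"])
    show "AE x in lborel. norm (R x * plateau s t n x) \<le> norm (R x)" for n
      using plateau_range[of s t n] by (auto simp: abs_mult intro!: mult_left_le)
    show "(\<lambda>x. R x * plateau s t n x) \<in> borel_measurable lborel" for n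
      using R smooth_measurable[OF smooth_plateau[of s t n]] by auto
  qed (use R in \<open>auto intro!: tendsto_intros plateau_tendsto\<close>)
  moreover have "(LINT y|lborel. R y * plateau s t n y) = 0" for n
    by (rule zero[OF _ _ _ bump_plateau]) (use st in auto)
  ultimately have "(LINT y|lborel. R y * indicator {s<..<t} y) = 0"
    using LIMSEQ_unique[OF tendsto_const] by fastforce
  then show "(LINT y:{s<..<t}|lborel. R y) = 0"
    by (simp add: set_lebesgue_integral_def mult.commute)
qed

lemma Fubini_lborel:
  fixes F :: "real \<times> real \<Rightarrow> real"
  assumes "integrable lborel F"
  shows "AE y in lborel. integrable lborel (\<lambda>x. F (x, y))"
    "integrable lborel (\<lambda>y. LINT x|lborel. F (x, y))"
    "(LINT y|lborel. LINT x|lborel. F (x, y)) = (LINT z|lborel. F z)"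
proof -
  have F: "integrable (lborel \<Otimes>\<^sub>M lborel) (case_prod (\<lambda>x y. F (x, y)))"
    using assms by (simp add: lborel_prod)
  show "AE y in lborel. integrable lborel (\<lambda>x. F (x, y))"
    by (rule lborel_pair.AE_integrable_snd[OF F])
  show "integrable lborel (\<lambda>y. LINT x|lborel. F (x, y))"
    by (rule lborel_pair.integrable_snd[OF F])
  show "(LINT y|lborel. LINT x|lborel. F (x, y)) = (LINT z|lborel. F z)"
    using lborel_pair.integral_snd[OF F] by (simp add: lborel_prod)
qed

lemma swap_lborel:
  fixes F :: "real \<times> real \<Rightarrow> real"
  shows "integrable lborel F \<Longrightarrow> integrable lborel (\<lambda>z. F (snd z, fst z))"
    "F \<in> borel_measurable borel \<Longrightarrow> (LINT z|lborel. F (snd z, fst z)) = (LINT z|lborel. F z)"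
proof -
  show "integrable lborel (\<lambda>z. F (snd z, fst z))" if "integrable lborel F"
    using lborel_pair.integrable_product_swap[of F] that
    by (simp add: lborel_prod case_prod_beta')
  show "(LINT z|lborel. F (snd z, fst z)) = (LINT z|lborel. F z)" if "F \<in> borel_measurable borel"
    using lborel_pair.integral_product_swap[of F] that
    by (simp add: lborel_prod case_prod_beta')
qed

lemma fst_measurable_lborel: "h \<in> borel_measurable borel \<Longrightarrow> (\<lambda>z::real \<times> real. h (fst z)) \<in> borel_measurable borel"
  and snd_measurable_lborel: "h \<in> borel_measurable borel \<Longrightarrow> (\<lambda>z::real \<times> real. h (snd z)) \<in> borel_measurable borel"
proof -
  have "fst \<in> borel \<rightarrow>\<^sub>M (borel :: real measure)" "snd \<in> borel \<rightarrow>\<^sub>M (borel :: real measure)"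
    by (auto intro!: borel_measurable_continuous_onI continuous_on_fst continuous_on_snd)
  note measurable_compose[OF this(1)] measurable_compose[OF this(2)]
  then show "h \<in> borel_measurable borel \<Longrightarrow> (\<lambda>z::real \<times> real. h (fst z)) \<in> borel_measurable borel"
    "h \<in> borel_measurable borel \<Longrightarrow> (\<lambda>z::real \<times> real. h (snd z)) \<in> borel_measurable borel" by blast+
qed

text \<open>Fixing the factor that depends on \<open>x\<close> and varying the other one isolates a single line, outside a null
set which depends on the fixed factor. As countably many such factors suffice, one null set serves for all.\<close>

lemma weak_derivative_on_lines:
  fixes u g :: "real \<times> real \<Rightarrow> real"
  assumes u: "integrable lborel u" and g: "integrable lborel g" and "\<alpha> < \<beta>"
    and weak: "\<And>f k s t s' t'. \<alpha> < s \<Longrightarrow> s \<le> t \<Longrightarrow> t < \<beta> \<Longrightarrow> \<gamma> < s' \<Longrightarrow> s' \<le> t' \<Longrightarrow> t' < \<delta> \<Longrightarrow>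
      bump s t f \<Longrightarrow> bump s' t' k \<Longrightarrow>
      pairing u (deriv f) k = - pairing g f k"
  shows "AE y in lborel. \<gamma> < y \<and> y < \<delta> \<longrightarrow>
    integrable lborel (\<lambda>x. u (x, y)) \<and> integrable lborel (\<lambda>x. g (x, y)) \<and>
    (\<exists>e. AE x in lborel. \<alpha> < x \<and> x < \<beta> \<longrightarrow> u (x, y) = e + primitive (\<lambda>x. g (x, y)) \<alpha> x)"
proof -
  obtain T where T: "countable T"
    "\<And>f. f \<in> T \<Longrightarrow> \<exists>s t. \<alpha> < s \<and> s \<le> t \<and> t < \<beta> \<and> bump s t f"
    "\<And>u g. integrable lborel u \<Longrightarrow> integrable lborel g \<Longrightarrow>
      (\<And>f. f \<in> T \<Longrightarrow> (LINT x|lborel. u x * deriv f x) = - (LINT x|lborel. g x * f x)) \<Longrightarrow>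
      \<exists>e. AE x in lborel. \<alpha> < x \<and> x < \<beta> \<longrightarrow> u x = e + primitive g \<alpha> x"
    using countable_test_functions[OF \<open>\<alpha> < \<beta>\<close>] by blast
  have "AE y in lborel. \<gamma> < y \<and> y < \<delta> \<longrightarrow>
      (LINT x|lborel. u (x, y) * deriv f x) + (LINT x|lborel. g (x, y) * f x) = 0" if fT: "f \<in> T" for f
  proof -
    obtain s t where st: "\<alpha> < s" "s \<le> t" "t < \<beta>" and f: "bump s t f" using T(2)[OF fT] by blast
    obtain B where B: "\<And>x. \<bar>f x\<bar> \<le> B" using bump_bounded[OF f] by metis
    obtain B' where B': "\<And>x. \<bar>deriv f x\<bar> \<le> B'" using bump_bounded[OF bump_deriv[OF f]] by metis
    have m: "f \<in> borel_measurable borel" "deriv f \<in> borel_measurable borel"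
      using f bump_deriv[OF f] by (auto simp: bump_def intro: smooth_measurable)
    have iu: "integrable lborel (\<lambda>z. u z * deriv f (fst z))"
      by (rule integrable_mult_bounded[OF u, where B=B']) (use fst_measurable_lborel[OF m(2)] B' in auto)
    have ig: "integrable lborel (\<lambda>z. g z * f (fst z))"
      by (rule integrable_mult_bounded[OF g, where B=B]) (use fst_measurable_lborel[OF m(1)] B in auto)
    let ?R = "\<lambda>y. (LINT x|lborel. u (x, y) * deriv f x) + (LINT x|lborel. g (x, y) * f x)"
    show ?thesis
    proof (rule AE_eq_0_if_integral_bumps_0)
      show "integrable lborel ?R"
        using Fubini_lborel(2)[OF iu] Fubini_lborel(2)[OF ig] by auto
      fix k s' t' assume k: "\<gamma> < s'" "s' \<le> t'" "t' < \<delta>" "bump s' t' k"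
      have mk: "k \<in> borel_measurable borel" using k by (auto simp: bump_def intro: smooth_measurable)
      obtain C where C: "\<And>x. \<bar>k x\<bar> \<le> C" using bump_bounded[OF k(4)] by metis
      have iuk: "integrable lborel (\<lambda>z. u z * deriv f (fst z) * k (snd z))"
        by (rule integrable_mult_bounded[OF iu, where B=C]) (use snd_measurable_lborel[OF mk] C in auto)
      have igk: "integrable lborel (\<lambda>z. g z * f (fst z) * k (snd z))"
        by (rule integrable_mult_bounded[OF ig, where B=C]) (use snd_measurable_lborel[OF mk] C in auto)
      have "(LINT y|lborel. ?R y * k y) =
          (LINT y|lborel. (LINT x|lborel. u (x, y) * deriv f x * k y) + (LINT x|lborel. g (x, y) * f x * k y))"
        by (simp add: distrib_right)
      also have "\<dots> = (LINT z|lborel. u z * deriv f (fst z) * k (snd z)) + (LINT z|lborel. g z * f (fst z) * k (snd z))"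
        using Fubini_lborel(2,3)[OF iuk] Fubini_lborel(2,3)[OF igk] by simp
      also have "\<dots> = 0"
        using weak[OF st k(1-3) f k(4)] by (simp add: mult.assoc)
      finally show "(LINT y|lborel. ?R y * k y) = 0" .
    qed
  qed
  then have "AE y in lborel. \<forall>f\<in>T. \<gamma> < y \<and> y < \<delta> \<longrightarrow>
      (LINT x|lborel. u (x, y) * deriv f x) + (LINT x|lborel. g (x, y) * f x) = 0"
    by (subst AE_ball_countable[OF T(1)]) blast
  with Fubini_lborel(1)[OF u] Fubini_lborel(1)[OF g] show ?thesis
  proof eventually_elim
    case (elim y)
    show ?case
    proof (intro impI conjI)
      assume y: "\<gamma> < y \<and> y < \<delta>"
      show "\<exists>e. AE x in lborel. \<alpha> < x \<and> x < \<beta> \<longrightarrow> u (x, y) = e + primitive (\<lambda>x. g (x, y)) \<alpha> x"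
        by (rule T(3)[OF elim(1,2)]) (use elim(3) y in \<open>auto simp: eq_neg_iff_add_eq_0\<close>)
    qed (use elim in auto)
  qed
qed

lemma weak_derivative_on_vertical_lines:
  fixes u g :: "real \<times> real \<Rightarrow> real"
  assumes u: "integrable lborel u" and g: "integrable lborel g" and "\<gamma> < \<delta>"
    and weak: "\<And>f k s t s' t'. \<alpha> < s \<Longrightarrow> s \<le> t \<Longrightarrow> t < \<beta> \<Longrightarrow> \<gamma> < s' \<Longrightarrow> s' \<le> t' \<Longrightarrow> t' < \<delta> \<Longrightarrow>
      bump s t f \<Longrightarrow> bump s' t' k \<Longrightarrow>
      pairing u f (deriv k) = - pairing g f k"
  shows "AE x in lborel. \<alpha> < x \<and> x < \<beta> \<longrightarrow>
    integrable lborel (\<lambda>y. u (x, y)) \<and> integrable lborel (\<lambda>y. g (x, y)) \<and>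
    (\<exists>e. AE y in lborel. \<gamma> < y \<and> y < \<delta> \<longrightarrow> u (x, y) = e + primitive (\<lambda>y. g (x, y)) \<gamma> y)"
proof -
  have [measurable]: "u \<in> borel_measurable borel" "g \<in> borel_measurable borel"
    using u g by auto
  have "AE y in lborel. \<alpha> < y \<and> y < \<beta> \<longrightarrow>
    integrable lborel (\<lambda>x. (\<lambda>z. u (snd z, fst z)) (x, y)) \<and> integrable lborel (\<lambda>x. (\<lambda>z. g (snd z, fst z)) (x, y)) \<and>
    (\<exists>e. AE x in lborel. \<gamma> < x \<and> x < \<delta> \<longrightarrow> (\<lambda>z. u (snd z, fst z)) (x, y) = e + primitive (\<lambda>x. (\<lambda>z. g (snd z, fst z)) (x, y)) \<gamma> x)"
  proof (rule weak_derivative_on_lines)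
    fix f k s t s' t'
    assume a: "\<gamma> < s" "s \<le> t" "t < \<delta>" "\<alpha> < s'" "s' \<le> t'" "t' < \<beta>" "bump s t f" "bump s' t' k"
    then have m: "f \<in> borel_measurable borel" "deriv f \<in> borel_measurable borel" "k \<in> borel_measurable borel"
      using bump_deriv[OF a(7)] by (auto simp: bump_def intro: smooth_measurable)
    have 1: "(\<lambda>z. u z * (k (fst z) * deriv f (snd z))) \<in> borel_measurable borel"
      "(\<lambda>z. g z * (k (fst z) * f (snd z))) \<in> borel_measurable borel"
      using fst_measurable_lborel[OF m(3)] snd_measurable_lborel[OF m(1)] snd_measurable_lborel[OF m(2)] by auto
    show "(LINT z|lborel. (\<lambda>z. u (snd z, fst z)) z * (deriv f (fst z) * k (snd z))) =
        - (LINT z|lborel. (\<lambda>z. g (snd z, fst z)) z * (f (fst z) * k (snd z)))"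
      using weak[OF a(4-6) a(1-3) a(8) a(7)] swap_lborel(2)[OF 1(1)] swap_lborel(2)[OF 1(2)]
      by (simp add: mult.commute)
  qed (use swap_lborel(1)[OF u] swap_lborel(1)[OF g] \<open>\<gamma> < \<delta>\<close> in auto)
  then show ?thesis by simp
qed

section \<open>Poincare inequalities on an interval\<close>

lemma primitive_self [simp]: "primitive g \<alpha> \<alpha> = 0"
proof -
  have "AE x in lborel. x \<noteq> \<alpha>" by (rule AE_lborel_singleton)
  then have "AE x in lborel. indicator {\<alpha>..\<alpha>} x *\<^sub>R g x = 0"
    by eventually_elim simp
  then show ?thesis unfolding primitive_def set_lebesgue_integral_def by (rule integral_eq_zero_AE)
qed

lemma set_integrable_continuous: "continuous_on {s..t} f \<Longrightarrow> set_integrable lborel {s..t::real} (f :: real \<Rightarrow> real)"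
  by (rule borel_integrable_atLeastAtMost')

lemma set_integral_FTC:
  fixes F f :: "real \<Rightarrow> real"
  assumes "s \<le> t" "\<And>x. (F has_real_derivative f x) (at x)" "continuous_on {s..t} f"
  shows "(LINT x:{s..t}|lborel. f x) = F t - F s"
  unfolding set_lebesgue_integral_def
  by (rule integral_FTC_atLeastAtMost)
    (use assms in \<open>auto intro: has_vector_derivative_at_within simp: has_real_derivative_iff_has_vector_derivative\<close>)

lemma set_integral_const: "s \<le> t \<Longrightarrow> (LINT x:{s..t::real}|lborel. (c::real)) = c * (t - s)"
  by (simp add: set_lebesgue_integral_def)

lemma set_integral_split:
  fixes f :: "real \<Rightarrow> real"
  assumes "set_integrable lborel {r..t} f" "r \<le> s" "s \<le> t"
  shows "(LINT x:{r..t}|lborel. f x) = (LINT x:{r..s}|lborel. f x) + (LINT x:{s..t}|lborel. f x)"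
proof -
  have "{r..t} = {r..s} \<union> {s..t}" using assms by auto
  moreover have "AE x in lborel. x \<noteq> s" by (rule AE_lborel_singleton)
  then have "AE x in lborel. \<not> (x \<in> {r..s} \<and> x \<in> {s..t})" by eventually_elim auto
  ultimately show ?thesis
    using set_integral_Un_AE[of "{r..s}" "{s..t}" lborel f]
      set_integrable_subset[OF assms(1), of "{r..s}"] set_integrable_subset[OF assms(1), of "{s..t}"] assms
    by simp
qed

lemma integrable_imp_set_integrable:
  "integrable lborel (f :: real \<Rightarrow> real) \<Longrightarrow> set_integrable lborel {s..t} f"
  unfolding set_integrable_def by (intro integrable_mult_indicator) auto

lemma set_integral_nonneg': "(\<And>x. 0 \<le> f x) \<Longrightarrow> 0 \<le> (LINT x:A|lborel. f x :: real)"
  unfolding set_lebesgue_integral_def by (rule Bochner_Integration.integral_nonneg) auto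

lemma integral_Cauchy_Schwarz:
  fixes f g :: "'a \<Rightarrow> real"
  assumes f: "f \<in> borel_measurable M" "integrable M (\<lambda>x. (f x)\<^sup>2)"
    and g: "g \<in> borel_measurable M" "integrable M (\<lambda>x. (g x)\<^sup>2)"
  shows "integrable M (\<lambda>x. f x * g x)"
    "(LINT x|M. f x * g x)\<^sup>2 \<le> (LINT x|M. (f x)\<^sup>2) * (LINT x|M. (g x)\<^sup>2)"
proof -
  show i: "integrable M (\<lambda>x. f x * g x)"
  proof (rule Bochner_Integration.integrable_bound)
    show "integrable M (\<lambda>x. (f x)\<^sup>2 + (g x)\<^sup>2)" by (intro Bochner_Integration.integrable_add assms)
    have "\<bar>f x\<bar> * \<bar>g x\<bar> \<le> (f x)\<^sup>2 + (g x)\<^sup>2" for x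
      using sum_squares_bound[of "\<bar>f x\<bar>" "\<bar>g x\<bar>"] mult_nonneg_nonneg[OF abs_ge_zero[of "f x"] abs_ge_zero[of "g x"]]
      unfolding power2_abs mult.assoc by linarith
    then show "AE x in M. norm (f x * g x) \<le> norm ((f x)\<^sup>2 + (g x)\<^sup>2)"
      by (intro AE_I2) (simp add: abs_mult)
  qed (use assms in auto)
  define F G I where "F = (LINT x|M. (f x)\<^sup>2)" and "G = (LINT x|M. (g x)\<^sup>2)" and "I = (LINT x|M. f x * g x)"
  have G0: "0 \<le> G" unfolding G_def by (rule Bochner_Integration.integral_nonneg) simp
  have "I\<^sup>2 \<le> F * G"
  proof (cases "G = 0")
    case True
    then have "AE x in M. (g x)\<^sup>2 = 0"
      using integral_nonneg_eq_0_iff_AE[OF g(2)] by (simp add: G_def)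
    then have "AE x in M. f x * g x = 0" by eventually_elim simp
    then have "I = 0" unfolding I_def by (rule integral_eq_zero_AE)
    then show ?thesis using True by simp
  next
    case False
    define m where "m = I / G"
    have "0 \<le> (LINT x|M. (f x - m * g x)\<^sup>2)" by (rule Bochner_Integration.integral_nonneg) simp
    also have "\<dots> = (LINT x|M. (f x)\<^sup>2 - 2 * m * (f x * g x) + m\<^sup>2 * (g x)\<^sup>2)"
      by (intro Bochner_Integration.integral_cong refl) (simp add: power2_eq_square algebra_simps)
    also have "\<dots> = F - 2 * m * I + m\<^sup>2 * G"
      using f g i by (simp add: F_def G_def I_def)
    finally have "0 \<le> G * (F - 2 * m * I + m\<^sup>2 * G)" using G0 by (rule mult_nonneg_nonneg[rotated])
    also have "\<dots> = F * G - I\<^sup>2" using False by (simp add: m_def power2_eq_square field_simps)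
    finally show ?thesis by simp
  qed
  then show "(LINT x|M. f x * g x)\<^sup>2 \<le> (LINT x|M. (f x)\<^sup>2) * (LINT x|M. (g x)\<^sup>2)"
    by (simp add: F_def G_def I_def)
qed

lemma set_integral_Cauchy_Schwarz:
  fixes g :: "real \<Rightarrow> real"
  assumes g: "integrable lborel g" "integrable lborel (\<lambda>x. (g x)\<^sup>2)" and "s \<le> t"
  shows "(LINT x:{s..t}|lborel. g x)\<^sup>2 \<le> (t - s) * (LINT x:{s..t}|lborel. (g x)\<^sup>2)"
proof -
  define I where "I = indicat_real {s..t}"
  have I2: "(I x)\<^sup>2 = I x" for x by (simp add: I_def indicator_def)
  have "(LINT x|lborel. I x * (I x * g x))\<^sup>2 \<le> (LINT x|lborel. (I x)\<^sup>2) * (LINT x|lborel. (I x * g x)\<^sup>2)"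
    by (rule integral_Cauchy_Schwarz(2))
      (use g integrable_imp_set_integrable[OF g(2), of s t] I2 in \<open>auto simp: power_mult_distrib set_integrable_def I_def[symmetric]\<close>, auto simp: I_def)
  then show ?thesis
    using \<open>s \<le> t\<close> I2 by (simp add: power_mult_distrib set_lebesgue_integral_def I_def[symmetric] mult.assoc[symmetric] power2_eq_square[symmetric])
      (simp add: I_def)
qed

context
  fixes g :: "real \<Rightarrow> real"
  assumes g: "integrable lborel g" "integrable lborel (\<lambda>x. (g x)\<^sup>2)"
begin

lemma primitive_continuous_on: "continuous_on S (primitive g \<alpha>)"
  using primitive_continuous[OF g(1)] continuous_on_subset by blast

lemma primitive_diff_square_le:
  assumes "\<alpha> \<le> s" "s \<le> x" "x \<le> y" "y \<le> t"
  shows "(primitive g \<alpha> y - primitive g \<alpha> x)\<^sup>2 \<le> (y - x) * (LINT x:{s..t}|lborel. (g x)\<^sup>2)"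
proof -
  have "(primitive g \<alpha> y - primitive g \<alpha> x)\<^sup>2 = (LINT z:{x..y}|lborel. g z)\<^sup>2"
    using assms by (subst primitive_diff[OF g(1)]) auto
  also have "\<dots> \<le> (y - x) * (LINT z:{x..y}|lborel. (g z)\<^sup>2)"
    using assms by (intro set_integral_Cauchy_Schwarz g)
  also have "\<dots> \<le> (y - x) * (LINT z:{s..t}|lborel. (g z)\<^sup>2)"
    using assms integrable_imp_set_integrable[OF g(2)] unfolding set_lebesgue_integral_def set_integrable_def
    by (intro mult_left_mono integral_mono) (auto split: split_indicator)
  finally show ?thesis .
qed

text \<open>The constant is not optimal (\<open>1 / 2\<close> instead of \<open>4 / pi\<^sup>2\<close>), which is harmless here and avoids any spectral
theory on the interval.\<close>

lemma poincare_left_end: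
  assumes "\<alpha> \<le> s" "s \<le> t"
  shows "(LINT x:{s..t}|lborel. (primitive g \<alpha> x - primitive g \<alpha> s)\<^sup>2) \<le> (t - s)\<^sup>2 / 2 * (LINT x:{s..t}|lborel. (g x)\<^sup>2)"
proof -
  let ?N = "LINT x:{s..t}|lborel. (g x)\<^sup>2"
  have "(LINT x:{s..t}|lborel. (primitive g \<alpha> x - primitive g \<alpha> s)\<^sup>2) \<le> (LINT x:{s..t}|lborel. (x - s) * ?N)"
    using assms
    by (intro set_integral_mono set_integrable_continuous continuous_intros primitive_continuous_on primitive_diff_square_le) auto
  also have "\<dots> = (t - s)\<^sup>2 / 2 * ?N"
    by (subst set_integral_FTC[where F="\<lambda>x. (x - s)\<^sup>2 / 2 * ?N"])
      (use assms in \<open>auto intro!: derivative_eq_intros continuous_intros\<close>)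
  finally show ?thesis .
qed

lemma poincare_right_end:
  assumes "\<alpha> \<le> s" "s \<le> t"
  shows "(LINT x:{s..t}|lborel. (primitive g \<alpha> x - primitive g \<alpha> t)\<^sup>2) \<le> (t - s)\<^sup>2 / 2 * (LINT x:{s..t}|lborel. (g x)\<^sup>2)"
proof -
  let ?N = "LINT x:{s..t}|lborel. (g x)\<^sup>2"
  have "(LINT x:{s..t}|lborel. (primitive g \<alpha> x - primitive g \<alpha> t)\<^sup>2) \<le> (LINT x:{s..t}|lborel. (t - x) * ?N)"
    using assms
    by (intro set_integral_mono set_integrable_continuous continuous_intros primitive_continuous_on, subst power2_commute)
      (auto intro!: primitive_diff_square_le)
  also have "\<dots> = (t - s)\<^sup>2 / 2 * ?N"
    by (subst set_integral_FTC[where F="\<lambda>x. - (t - x)\<^sup>2 / 2 * ?N"])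
      (use assms in \<open>auto intro!: derivative_eq_intros continuous_intros simp: field_simps\<close>)
  finally show ?thesis .
qed

lemma poincare_midpoint:
  assumes "\<alpha> \<le> s" "s \<le> t"
  shows "(LINT x:{s..t}|lborel. (primitive g \<alpha> x - primitive g \<alpha> ((s + t) / 2))\<^sup>2) \<le> (t - s)\<^sup>2 / 8 * (LINT x:{s..t}|lborel. (g x)\<^sup>2)"
proof -
  define m where "m = (s + t) / 2"
  have m: "s \<le> m" "m \<le> t" "m - s = (t - s) / 2" "t - m = (t - s) / 2" using assms by (auto simp: m_def field_simps)
  have "(LINT x:{s..t}|lborel. (primitive g \<alpha> x - primitive g \<alpha> m)\<^sup>2) =
      (LINT x:{s..m}|lborel. (primitive g \<alpha> x - primitive g \<alpha> m)\<^sup>2) + (LINT x:{m..t}|lborel. (primitive g \<alpha> x - primitive g \<alpha> m)\<^sup>2)"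
    by (intro set_integral_split set_integrable_continuous continuous_intros primitive_continuous_on m)
  moreover have "(LINT x:{s..t}|lborel. (g x)\<^sup>2) = (LINT x:{s..m}|lborel. (g x)\<^sup>2) + (LINT x:{m..t}|lborel. (g x)\<^sup>2)"
    by (intro set_integral_split integrable_imp_set_integrable m g)
  ultimately show ?thesis
    using poincare_right_end[of \<alpha> s m] poincare_left_end[of \<alpha> m t] m assms
    by (simp add: m_def[symmetric] power_divide algebra_simps)
qed

text \<open>The mean is the constant with the smallest mean square distance, so it may be replaced by the value at the
midpoint, and each half of the interval has length \<open>(t - s) / 2\<close>.\<close>

lemma poincare_mean_zero:
  assumes "s \<le> t" and mean: "(LINT x:{s..t}|lborel. e + primitive g s x) = 0"
  shows "(LINT x:{s..t}|lborel. (e + primitive g s x)\<^sup>2) \<le> (t - s)\<^sup>2 / 8 * (LINT x:{s..t}|lborel. (g x)\<^sup>2)"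
proof -
  define A where "A = (\<lambda>x. e + primitive g s x)"
  define c where "c = A ((s + t) / 2)"
  have cont: "continuous_on {s..t} A" unfolding A_def by (intro continuous_intros primitive_continuous_on)
  have "(LINT x:{s..t}|lborel. (A x)\<^sup>2) \<le> (LINT x:{s..t}|lborel. (A x)\<^sup>2) - 2 * c * (LINT x:{s..t}|lborel. A x) + c\<^sup>2 * (t - s)"
    using assms by (simp add: A_def)
  also have "\<dots> = (LINT x:{s..t}|lborel. (A x)\<^sup>2 - 2 * c * A x + c\<^sup>2)"
    using \<open>s \<le> t\<close> set_integrable_continuous[OF cont] set_integrable_continuous[OF continuous_on_power[OF cont, of 2]]
      set_integrable_continuous[of s t "\<lambda>x. c\<^sup>2"]
    by (simp add: set_integral_add set_integral_diff set_integrable_mult_right set_integral_const)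
  also have "\<dots> = (LINT x:{s..t}|lborel. (primitive g s x - primitive g s ((s + t) / 2))\<^sup>2)"
    by (intro set_lebesgue_integral_cong) (auto simp: A_def c_def power2_eq_square algebra_simps)
  also have "\<dots> \<le> (t - s)\<^sup>2 / 8 * (LINT x:{s..t}|lborel. (g x)\<^sup>2)"
    by (rule poincare_midpoint) (use assms in auto)
  finally show ?thesis by (simp add: A_def)
qed

text \<open>To the left of the crack tip nothing is known about vertical lines. The value at the point \<open>a\<close> is compared
with an average over \<open>{a..a+1}\<close>, and the values on \<open>{0..a}\<close> with that at \<open>a\<close>.\<close>

lemma strip_le_neighbour:
  assumes "0 \<le> a" "a \<le> 1"
  shows "(LINT x:{0..a}|lborel. (e + primitive g 0 x)\<^sup>2) \<le> 4 * a * (LINT x:{a..a+1}|lborel. (e + primitive g 0 x)\<^sup>2)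
      + (2 * a + a\<^sup>2) * (LINT x:{0..a+1}|lborel. (g x)\<^sup>2)"
proof -
  define A where "A = (\<lambda>x. e + primitive g 0 x)"
  have cont: "continuous_on S A" for S unfolding A_def by (intro continuous_intros primitive_continuous_on)
  have sq: "p\<^sup>2 \<le> 2 * q\<^sup>2 + 2 * (p - q)\<^sup>2" for p q :: real
    using zero_le_power2[of "p - 2 * q"] by (simp add: power2_eq_square algebra_simps)
  let ?N1 = "LINT x:{0..a}|lborel. (g x)\<^sup>2" and ?N2 = "LINT x:{a..a+1}|lborel. (g x)\<^sup>2"
  have N: "(LINT x:{0..a+1}|lborel. (g x)\<^sup>2) = ?N1 + ?N2" "0 \<le> ?N1" "0 \<le> ?N2"
    using assms by (auto intro!: set_integral_split integrable_imp_set_integrable g set_integral_nonneg')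
  have ci: "set_integrable lborel {r..t} (\<lambda>x. 2 * (A x)\<^sup>2 + 2 * (A x - A a)\<^sup>2)"
    "set_integrable lborel {r..t} (\<lambda>x. 2 * (A a)\<^sup>2 + 2 * (A x - A a)\<^sup>2)" "set_integrable lborel {r..t} (\<lambda>x. (A x)\<^sup>2)"
    "set_integrable lborel {r..t} (\<lambda>x. (A x - A a)\<^sup>2)" "set_integrable lborel {r..t} (\<lambda>x. (A a)\<^sup>2)" for r t
    by (intro set_integrable_continuous continuous_intros cont)+
  have "(A a)\<^sup>2 = (LINT x:{a..a+1}|lborel. (A a)\<^sup>2)" by (simp add: set_integral_const)
  also have "\<dots> \<le> (LINT x:{a..a+1}|lborel. 2 * (A x)\<^sup>2 + 2 * (A x - A a)\<^sup>2)"
    using sq[of "A a"] by (intro set_integral_mono ci) (auto simp: power2_commute)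
  also have "\<dots> = 2 * (LINT x:{a..a+1}|lborel. (A x)\<^sup>2) + 2 * (LINT x:{a..a+1}|lborel. (A x - A a)\<^sup>2)"
    using ci by (simp add: set_integral_add set_integrable_mult_right)
  also have "(LINT x:{a..a+1}|lborel. (A x - A a)\<^sup>2) \<le> ?N2 / 2"
    using poincare_left_end[of 0 a "a+1"] assms by (simp add: A_def)
  finally have Aa: "(A a)\<^sup>2 \<le> 2 * (LINT x:{a..a+1}|lborel. (A x)\<^sup>2) + ?N2" by simp
  have "(LINT x:{0..a}|lborel. (A x)\<^sup>2) \<le> (LINT x:{0..a}|lborel. 2 * (A a)\<^sup>2 + 2 * (A x - A a)\<^sup>2)"
    using sq by (intro set_integral_mono ci) auto
  also have "\<dots> = 2 * (A a)\<^sup>2 * a + 2 * (LINT x:{0..a}|lborel. (A x - A a)\<^sup>2)"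
    using ci assms by (simp add: set_integral_add set_integrable_mult_right set_integral_const)
  also have "(LINT x:{0..a}|lborel. (A x - A a)\<^sup>2) \<le> a\<^sup>2 / 2 * ?N1"
    using poincare_right_end[of 0 0 a] assms by (simp add: A_def)
  also have "2 * (A a)\<^sup>2 * a + 2 * (a\<^sup>2 / 2 * ?N1) \<le> 2 * (2 * (LINT x:{a..a+1}|lborel. (A x)\<^sup>2) + ?N2) * a + 2 * (a\<^sup>2 / 2 * ?N1)"
    using Aa assms by (intro add_right_mono mult_right_mono mult_left_mono) auto
  also have "\<dots> \<le> 4 * a * (LINT x:{a..a+1}|lborel. (A x)\<^sup>2) + (2 * a + a\<^sup>2) * (?N1 + ?N2)"
    using N assms by (simp add: algebra_simps)
  finally show ?thesis using N by (simp add: A_def)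
qed

end

text \<open>The first Dirichlet mode is \<open>sin (x / 2)\<close>. Subtracting the multiple of it that makes the
function vanish at the midpoint adds \<open>c\<^sup>2 * pi\<close> on the left and only \<open>pi\<^sup>2 / 8 * (c\<^sup>2 * pi / 4)\<close> on the right,
by orthogonality. The difference vanishes at 0, at \<open>pi\<close> and at \<open>2 * pi\<close>, so that \<open>poincare_left_end\<close> and
\<open>poincare_right_end\<close> apply on intervals of length \<open>pi / 2\<close>.\<close>

lemma poincare_second_dirichlet:
  fixes g :: "real \<Rightarrow> real"
  assumes g: "integrable lborel g" "integrable lborel (\<lambda>x. (g x)\<^sup>2)"
    and end0: "primitive g 0 (2 * pi) = 0"
    and sin0: "(LINT x:{0..2*pi}|lborel. primitive g 0 x * sin (x / 2)) = 0"
    and cos0: "(LINT x:{0..2*pi}|lborel. g x * cos (x / 2)) = 0"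
  shows "(LINT x:{0..2*pi}|lborel. (primitive g 0 x)\<^sup>2) \<le> pi\<^sup>2 / 8 * (LINT x:{0..2*pi}|lborel. (g x)\<^sup>2)"
proof -
  define c where "c = primitive g 0 pi"
  define k where "k = (\<lambda>x. indicator {0..2*pi} x * (c / 2 * cos (x / 2)))"
  define h where "h = (\<lambda>x. g x - k x)"
  have cint: "set_integrable lborel {s..t} (\<lambda>x. c / 2 * cos (x / 2))" for s t
    by (intro set_integrable_continuous continuous_intros) auto
  have k: "integrable lborel k" using cint[of 0 "2*pi"] by (simp add: k_def set_integrable_def)
  have kb: "\<bar>k x\<bar> \<le> \<bar>c\<bar>" for x
  proof -
    have "\<bar>c\<bar> * \<bar>cos (x / 2)\<bar> \<le> \<bar>c\<bar> * 1" by (intro mult_left_mono) auto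
    then show ?thesis by (auto simp: k_def abs_mult split: split_indicator)
  qed
  have km: "k \<in> borel_measurable lborel" using k by auto
  have h: "integrable lborel h" unfolding h_def by (intro Bochner_Integration.integrable_diff g k)
  have "integrable lborel (\<lambda>x. (g x)\<^sup>2 - 2 * (g x * k x) + k x * k x)"
    by (intro Bochner_Integration.integrable_add Bochner_Integration.integrable_diff g integrable_mult_right
        integrable_mult_bounded(1)[OF g(1) km kb] integrable_mult_bounded(1)[OF k km kb])
  then have h2: "integrable lborel (\<lambda>x. (h x)\<^sup>2)"
    by (simp add: h_def power2_eq_square algebra_simps)
  note si = integrable_imp_set_integrable
  have B: "primitive h 0 t = primitive g 0 t - c * sin (t / 2)" if "0 \<le> t" "t \<le> 2 * pi" for t
  proof -
    have "primitive k 0 t = (LINT x:{0..t}|lborel. c / 2 * cos (x / 2))"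
      unfolding primitive_def using that by (intro set_lebesgue_integral_cong) (auto simp: k_def)
    also have "\<dots> = c * sin (t / 2) - c * sin (0 / 2)"
      using that by (intro set_integral_FTC) (auto intro!: derivative_eq_intros continuous_intros)
    finally show ?thesis
      using si[OF g(1), of 0 t] si[OF k, of 0 t] by (simp add: primitive_def h_def set_integral_diff)
  qed
  have B0: "primitive h 0 pi = 0" "primitive h 0 (2*pi) = 0" "primitive h 0 0 = 0"
    using B[of pi] B[of "2*pi"] end0 by (auto simp: c_def)
  have cB: "continuous_on S (primitive h 0)" for S by (rule primitive_continuous_on[OF h h2])
  have sB: "set_integrable lborel {s..t} (\<lambda>x. (primitive h 0 x)\<^sup>2)" for s t
    by (intro set_integrable_continuous continuous_intros cB)
  have split4: "(LINT x:{0..2*pi}|lborel. f x) = (LINT x:{0..pi/2}|lborel. f x) + (LINT x:{pi/2..pi}|lborel. f x)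
      + (LINT x:{pi..3*pi/2}|lborel. f x) + (LINT x:{3*pi/2..2*pi}|lborel. f x)"
    if "\<And>s t. set_integrable lborel {s..t} f" for f :: "real \<Rightarrow> real"
    using set_integral_split[OF that[of 0 "2*pi"], of pi] set_integral_split[OF that[of 0 pi], of "pi/2"]
      set_integral_split[OF that[of pi "2*pi"], of "3*pi/2"] by simp
  have "(LINT x:{0..2*pi}|lborel. (primitive h 0 x)\<^sup>2) \<le> pi\<^sup>2 / 8 * (LINT x:{0..2*pi}|lborel. (h x)\<^sup>2)"
  proof -
    have len: "(pi / 2)\<^sup>2 / 2 = pi\<^sup>2 / 8" "(pi - pi / 2)\<^sup>2 / 2 = pi\<^sup>2 / 8"
      "(3 * pi / 2 - pi)\<^sup>2 / 2 = pi\<^sup>2 / 8" "(2 * pi - 3 * pi / 2)\<^sup>2 / 2 = pi\<^sup>2 / 8"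
      by (auto simp: power2_eq_square field_simps)
    note q = poincare_left_end[OF h h2, of 0 0 "pi/2"] poincare_right_end[OF h h2, of 0 "pi/2" pi]
      poincare_left_end[OF h h2, of 0 pi "3*pi/2"] poincare_right_end[OF h h2, of 0 "3*pi/2" "2*pi"]
    note q' = q[unfolded len B0 diff_zero]
    show ?thesis
      unfolding split4[OF sB] split4[OF si[OF h2]] distrib_left
      by (intro add_mono q') auto
  qed
  moreover have "(LINT x:{0..2*pi}|lborel. (primitive h 0 x)\<^sup>2) = (LINT x:{0..2*pi}|lborel. (primitive g 0 x)\<^sup>2) + c\<^sup>2 * pi"
  proof -
    have cg: "continuous_on S (primitive g 0)" for S by (rule primitive_continuous_on[OF g])
    have "(LINT x:{0..2*pi}|lborel. (primitive h 0 x)\<^sup>2) = (LINT x:{0..2*pi}|lborel.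
        (primitive g 0 x)\<^sup>2 - 2 * c * (primitive g 0 x * sin (x / 2)) + c\<^sup>2 * (sin (x / 2))\<^sup>2)"
      by (intro set_lebesgue_integral_cong) (auto simp: B power2_eq_square algebra_simps)
    also have "\<dots> = (LINT x:{0..2*pi}|lborel. (primitive g 0 x)\<^sup>2)
        - (LINT x:{0..2*pi}|lborel. 2 * c * (primitive g 0 x * sin (x / 2))) + (LINT x:{0..2*pi}|lborel. c\<^sup>2 * (sin (x / 2))\<^sup>2)"
      by (subst set_integral_add set_integral_diff, (intro set_integral_diff set_integrable_continuous continuous_intros cg | simp)+)+
    also have "(LINT x:{0..2*pi}|lborel. c\<^sup>2 * (sin (x / 2))\<^sup>2) = c\<^sup>2 * (2*pi / 2 - sin (2*pi) / 2) - c\<^sup>2 * (0 / 2 - sin 0 / 2)"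
    proof (rule set_integral_FTC)
      show "((\<lambda>x. c\<^sup>2 * (x / 2 - sin x / 2)) has_real_derivative c\<^sup>2 * (sin (x / 2))\<^sup>2) (at x)" for x
      proof -
        have "(sin (x / 2))\<^sup>2 = 1 / 2 - cos x / 2" using cos_double_sin[of "x / 2"] by (simp add: field_simps)
        then show ?thesis by (auto intro!: derivative_eq_intros)
      qed
    qed (auto intro!: continuous_intros)
    finally show ?thesis using sin0 by simp
  qed
  moreover have "(LINT x:{0..2*pi}|lborel. (h x)\<^sup>2) = (LINT x:{0..2*pi}|lborel. (g x)\<^sup>2) + c\<^sup>2 * pi / 4"
  proof -
    have gc: "integrable lborel (\<lambda>x. g x * cos (x / 2))"
      by (rule integrable_mult_bounded(1)[OF g(1), where B=1]) (auto intro!: borel_measurable_continuous_onI continuous_intros)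
    have "(LINT x:{0..2*pi}|lborel. (h x)\<^sup>2) = (LINT x:{0..2*pi}|lborel.
        (g x)\<^sup>2 - c * (g x * cos (x / 2)) + c\<^sup>2 / 4 * (cos (x / 2))\<^sup>2)"
      by (intro set_lebesgue_integral_cong) (auto simp: h_def k_def power2_eq_square field_simps)
    also have "\<dots> = (LINT x:{0..2*pi}|lborel. (g x)\<^sup>2)
        - (LINT x:{0..2*pi}|lborel. c * (g x * cos (x / 2))) + (LINT x:{0..2*pi}|lborel. c\<^sup>2 / 4 * (cos (x / 2))\<^sup>2)"
    proof -
      have i: "set_integrable lborel {0..2*pi} (\<lambda>x. (g x)\<^sup>2)" "set_integrable lborel {0..2*pi} (\<lambda>x. c * (g x * cos (x / 2)))"
        "set_integrable lborel {0..2*pi} (\<lambda>x. c\<^sup>2 / 4 * (cos (x / 2))\<^sup>2)"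
        by (intro si g set_integrable_mult_right gc set_integrable_continuous continuous_intros; simp)+
      show ?thesis
        using set_integral_add(2)[OF set_integral_diff(1)[OF i(1,2)] i(3)] set_integral_diff(2)[OF i(1,2)] by (simp only:)
    qed
    also have "(LINT x:{0..2*pi}|lborel. c\<^sup>2 / 4 * (cos (x / 2))\<^sup>2) = c\<^sup>2 / 4 * (2*pi / 2 + sin (2*pi) / 2) - c\<^sup>2 / 4 * (0 / 2 + sin 0 / 2)"
    proof (rule set_integral_FTC)
      show "((\<lambda>x. c\<^sup>2 / 4 * (x / 2 + sin x / 2)) has_real_derivative c\<^sup>2 / 4 * (cos (x / 2))\<^sup>2) (at x)" for x
      proof -
        have "(cos (x / 2))\<^sup>2 = 1 / 2 + cos x / 2" using cos_double_cos[of "x / 2"] by (simp add: field_simps)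
        then show ?thesis by (auto intro!: derivative_eq_intros)
      qed
    qed (auto intro!: continuous_intros)
    finally show ?thesis using cos0 by simp
  qed
  moreover have "pi\<^sup>2 / 8 * (c\<^sup>2 * pi / 4) \<le> c\<^sup>2 * pi"
  proof -
    have "pi\<^sup>2 \<le> 4\<^sup>2" using pi_less_4 pi_ge_zero by (intro power_mono) auto
    then have "pi\<^sup>2 / 32 * (c\<^sup>2 * pi) \<le> 1 * (c\<^sup>2 * pi)" by (intro mult_right_mono) auto
    then show ?thesis by simp
  qed
  ultimately show ?thesis by (simp add: distrib_left)
qed

section \<open>Sobolev functions on the cracked rectangle\<close>

lemma crack_open: "open (cracked a)"
proof -
  have "cracked a = rect - {0..a} \<times> {pi}"
    by (auto simp: cracked_def crack_def rect_def)
  moreover have "open rect" unfolding rect_def by (intro open_Times) auto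
  moreover have "closed ({0..a} \<times> {pi})" by (intro closed_Times) auto
  ultimately show ?thesis by (simp add: open_Diff)
qed

lemma cracked_borel [measurable]: "cracked a \<in> sets borel"
  by (intro borel_open crack_open)

lemma cracked_iff: "(x, y) \<in> cracked a \<longleftrightarrow> 0 < x \<and> x < 4*pi \<and> 0 < y \<and> y < 2*pi \<and> (x \<le> a \<longrightarrow> y \<noteq> pi)"
  by (auto simp: cracked_def rect_def crack_def)

lemma integrable_indicator_cracked: "integrable lborel (indicat_real (cracked a))"
proof (rule integrable_real_indicator)
  have "bounded (cracked a)"
    by (rule bounded_subset[of "cbox (0, 0) (4*pi, 2*pi)"]) (auto simp: cracked_iff)
  then show "emeasure lborel (cracked a) < \<infinity>" by (rule emeasure_bounded_finite)
qed simp

lemma integrable_if_square_integrable: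
  fixes u :: "real \<times> real \<Rightarrow> real"
  assumes "u \<in> borel_measurable borel" "integrable lborel (\<lambda>z. (u z)\<^sup>2)" "\<And>z. z \<notin> cracked a \<Longrightarrow> u z = 0"
  shows "integrable lborel u"
proof (rule Bochner_Integration.integrable_bound)
  show "integrable lborel (\<lambda>z. (u z)\<^sup>2 + indicator (cracked a) z)"
    by (intro Bochner_Integration.integrable_add assms integrable_indicator_cracked)
  have "\<bar>u z\<bar> \<le> (u z)\<^sup>2 + indicator (cracked a) z" for z
  proof (cases "z \<in> cracked a")
    case True
    have "\<bar>u z\<bar> \<le> (u z)\<^sup>2 + 1" using zero_le_power2[of "\<bar>u z\<bar> - 1"]
      by (simp add: power2_eq_square algebra_simps)
    then show ?thesis using True by simp
  qed (simp add: assms(3))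
  then show "AE z in lborel. norm (u z) \<le> norm ((u z)\<^sup>2 + indicator (cracked a) z)"
    by (intro AE_I2) (simp add: abs_of_nonneg)
qed (use assms in auto)

lemma integrable_lincomb_square:
  fixes f g :: "'a \<Rightarrow> real"
  assumes f: "f \<in> borel_measurable M" "integrable M (\<lambda>z. (f z)\<^sup>2)" and g: "g \<in> borel_measurable M" "integrable M (\<lambda>z. (g z)\<^sup>2)"
  shows "integrable M (\<lambda>z. (f z - c * g z)\<^sup>2)"
proof -
  have "integrable M (\<lambda>z. (f z)\<^sup>2 - 2 * c * (f z * g z) + c\<^sup>2 * (g z)\<^sup>2)"
    by (intro Bochner_Integration.integrable_add Bochner_Integration.integrable_diff integrable_mult_right
        integral_Cauchy_Schwarz(1) assms)
  then show ?thesis by (simp add: power2_eq_square algebra_simps)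
qed

definition L2_cracked :: "real \<Rightarrow> (real \<times> real \<Rightarrow> real) \<Rightarrow> bool" where
  "L2_cracked a u \<longleftrightarrow>
     u \<in> borel_measurable borel \<and> integrable lborel (\<lambda>z. (u z)\<^sup>2) \<and> (\<forall>z. z \<notin> cracked a \<longrightarrow> u z = 0)"

lemma L2_integrable: "L2_cracked a u \<Longrightarrow> integrable lborel u"
  unfolding L2_cracked_def by (rule integrable_if_square_integrable[where a=a]) auto

lemma L2_mult_integrable:
  "L2_cracked a u \<Longrightarrow> L2_cracked a v \<Longrightarrow> integrable lborel (\<lambda>z. u z * v z)"
  unfolding L2_cracked_def by (rule integral_Cauchy_Schwarz(1)) auto

lemma L2_diff:
  "L2_cracked a u \<Longrightarrow> L2_cracked a v \<Longrightarrow>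
    L2_cracked a (\<lambda>z. u z - c * v z)"
  unfolding L2_cracked_def using integrable_lincomb_square[of u lborel v c] by auto

text \<open>Borel functions, extended by 0, in place of the Lebesgue measurable ones of \<^const>\<open>H1\<close>: Fubini's theorem
then applies on the product measure, and all integrals extend over the whole plane. Testing with products is
all that the restriction to lines requires.\<close>

definition sobolev :: "real \<Rightarrow> (real \<times> real \<Rightarrow> real) \<Rightarrow> (real \<times> real \<Rightarrow> real) \<Rightarrow> (real \<times> real \<Rightarrow> real) \<Rightarrow> bool" where
  "sobolev a u g1 g2 \<longleftrightarrow>
     L2_cracked a u \<and> L2_cracked a g1 \<and> L2_cracked a g2 \<and>
     (\<forall>f k s t s' t'. s \<le> t \<and> s' \<le> t' \<and> {s..t} \<times> {s'..t'} \<subseteq> cracked a \<and> bump s t f \<and> bump s' t' k \<longrightarrow>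
       pairing u (deriv f) k = - pairing g1 f k \<and>
       pairing u f (deriv k) = - pairing g2 f k)"

lemma sobolev_test:
  assumes "sobolev a u g1 g2" "s \<le> t" "s' \<le> t'" "{s..t} \<times> {s'..t'} \<subseteq> cracked a" "bump s t f" "bump s' t' k"
  shows "pairing u (deriv f) k = - pairing g1 f k"
    "pairing u f (deriv k) = - pairing g2 f k"
proof -
  note * = assms(1)[unfolded sobolev_def, THEN conjunct2, THEN conjunct2, THEN conjunct2,
    THEN spec, of f, THEN spec, of k, THEN spec, of s, THEN spec, of t, THEN spec, of s', THEN spec, of t']
  note ** = mp[OF * conjI[OF assms(2) conjI[OF assms(3) conjI[OF assms(4) conjI[OF assms(5,6)]]]]]
  show "pairing u (deriv f) k = - pairing g1 f k"
    "pairing u f (deriv k) = - pairing g2 f k"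
    using ** by (rule conjunct1, rule conjunct2)
qed

lemma sobolev_L2:
  assumes "sobolev a u g1 g2"
  shows "L2_cracked a u" "L2_cracked a g1" "L2_cracked a g2"
  using assms by (simp_all only: sobolev_def)

lemma integrable_mult_product:
  fixes u :: "real \<times> real \<Rightarrow> real"
  assumes u: "integrable lborel u" and f: "f \<in> borel_measurable borel" "\<And>x. \<bar>f x\<bar> \<le> B"
    and k: "k \<in> borel_measurable borel" "\<And>x. \<bar>k x\<bar> \<le> C"
  shows "integrable lborel (\<lambda>z. u z * (f (fst z) * k (snd z)))"
proof (rule integrable_mult_bounded(1)[OF u, of _ "B * C"])
  have "\<bar>f x * k y\<bar> \<le> B * C" for x y
    unfolding abs_mult using f(2)[of x] k(2)[of y] by (intro mult_mono) auto
  then show "\<bar>f (fst z) * k (snd z)\<bar> \<le> B * C" for z by simp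
qed (use fst_measurable_lborel[OF f(1)] snd_measurable_lborel[OF k(1)] in auto)

lemma bump_measurable_bounded:
  assumes "bump s t f"
  obtains B where "f \<in> borel_measurable borel" "\<And>x. \<bar>f x\<bar> \<le> B"
  using bump_bounded[OF assms] assms by (metis bump_def smooth_measurable)

lemma sobolev_diff:
  assumes u: "sobolev a u g1 g2" and v: "sobolev a v h1 h2"
  shows "sobolev a (\<lambda>z. u z - c * v z) (\<lambda>z. g1 z - c * h1 z) (\<lambda>z. g2 z - c * h2 z)"
proof -
  have I: "integrable lborel (\<lambda>z. w z * (f (fst z) * k (snd z)))"
    if w: "L2_cracked a w" and f: "bump s t f" and k: "bump s' t' k" for w f k s t s' t'
  proof -
    obtain B where B: "f \<in> borel_measurable borel" "\<And>x. \<bar>f x\<bar> \<le> B" using bump_measurable_bounded[OF f] by blast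
    obtain C where C: "k \<in> borel_measurable borel" "\<And>x. \<bar>k x\<bar> \<le> C" using bump_measurable_bounded[OF k] by blast
    show ?thesis by (rule integrable_mult_product[OF L2_integrable[OF w] B C])
  qed
  have J: "(LINT z|lborel. (w z - c * w' z) * (f (fst z) * k (snd z))) =
      pairing w f k - c * pairing w' f k"
    if "L2_cracked a w" "L2_cracked a w'" "bump s t f" "bump s' t' k" for w w' f k s t s' t'
    using I[OF that(1,3,4)] I[OF that(2,3,4)] by (simp add: left_diff_distrib mult.assoc)
  note u2 = sobolev_L2[OF u] and v2 = sobolev_L2[OF v]
  have "(LINT z|lborel. (u z - c * v z) * (deriv f (fst z) * k (snd z))) = - (LINT z|lborel. (g1 z - c * h1 z) * (f (fst z) * k (snd z))) \<and>
      (LINT z|lborel. (u z - c * v z) * (f (fst z) * deriv k (snd z))) = - (LINT z|lborel. (g2 z - c * h2 z) * (f (fst z) * k (snd z)))"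
    if "s \<le> t \<and> s' \<le> t' \<and> {s..t} \<times> {s'..t'} \<subseteq> cracked a \<and> bump s t f \<and> bump s' t' k" for f k s t s' t'
  proof -
    have a: "s \<le> t" "s' \<le> t'" "{s..t} \<times> {s'..t'} \<subseteq> cracked a" "bump s t f" "bump s' t' k" using that by auto
    show ?thesis
      unfolding J[OF u2(1) v2(1) bump_deriv[OF a(4)] a(5)] J[OF u2(2) v2(2) a(4,5)]
        J[OF u2(1) v2(1) a(4) bump_deriv[OF a(5)]] J[OF u2(3) v2(3) a(4,5)] sobolev_test[OF u a] sobolev_test[OF v a]
      by simp
  qed
  then show ?thesis
    unfolding sobolev_def using L2_diff[OF u2(1) v2(1)] L2_diff[OF u2(2) v2(2)] L2_diff[OF u2(3) v2(3)] by blast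
qed

text \<open>On \<open>(\<alpha>, \<beta>)\<close>, \<open>u\<close> has an absolutely continuous representative with derivative \<open>g\<close> and limit \<open>e\<close> at \<open>\<alpha>\<close>.\<close>

definition ac_on :: "real \<Rightarrow> real \<Rightarrow> (real \<Rightarrow> real) \<Rightarrow> (real \<Rightarrow> real) \<Rightarrow> real \<Rightarrow> bool" where
  "ac_on \<alpha> \<beta> u g e \<longleftrightarrow> integrable lborel u \<and> integrable lborel g \<and> integrable lborel (\<lambda>x. (g x)\<^sup>2) \<and>
     (AE x in lborel. \<alpha> < x \<and> x < \<beta> \<longrightarrow> u x = e + primitive g \<alpha> x)"

lemma sobolev_D:
  assumes "sobolev a u g1 g2"
  shows "L2_cracked a u" "L2_cracked a g1" "L2_cracked a g2"
    "integrable lborel u" "integrable lborel g1" "integrable lborel g2"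
    "integrable lborel (\<lambda>z. (u z)\<^sup>2)" "integrable lborel (\<lambda>z. (g1 z)\<^sup>2)" "integrable lborel (\<lambda>z. (g2 z)\<^sup>2)"
  using sobolev_L2[OF assms] sobolev_L2[OF assms, THEN L2_integrable]
  by (simp_all add: L2_cracked_def)

lemma Fubini_lborel':
  fixes F :: "real \<times> real \<Rightarrow> real"
  assumes "integrable lborel F"
  shows "AE x in lborel. integrable lborel (\<lambda>y. F (x, y))"
    "integrable lborel (\<lambda>x. LINT y|lborel. F (x, y))"
    "(LINT x|lborel. LINT y|lborel. F (x, y)) = (LINT z|lborel. F z)"
proof -
  have F: "integrable (lborel \<Otimes>\<^sub>M lborel) (case_prod (\<lambda>x y. F (x, y)))"
    using assms by (simp add: lborel_prod)
  show "AE x in lborel. integrable lborel (\<lambda>y. F (x, y))"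
    by (rule lborel_pair.AE_integrable_fst[OF F])
  show "integrable lborel (\<lambda>x. LINT y|lborel. F (x, y))"
    by (rule lborel_pair.integrable_fst[OF F])
  show "(LINT x|lborel. LINT y|lborel. F (x, y)) = (LINT z|lborel. F z)"
    using lborel_pair.integral_fst[OF F] by (simp add: lborel_prod)
qed

lemma sobolev_horizontal:
  assumes S: "sobolev a u g1 g2"
  shows "AE y in lborel. 0 < y \<and> y < 2*pi \<longrightarrow> (\<exists>e. ac_on 0 (4*pi) (\<lambda>x. u (x, y)) (\<lambda>x. g1 (x, y)) e)"
proof -
  note D = sobolev_D[OF S]
  have half: "AE y in lborel. \<gamma> < y \<and> y < \<delta> \<longrightarrow>
    integrable lborel (\<lambda>x. u (x, y)) \<and> integrable lborel (\<lambda>x. g1 (x, y)) \<and>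
    (\<exists>e. AE x in lborel. 0 < x \<and> x < 4*pi \<longrightarrow> u (x, y) = e + primitive (\<lambda>x. g1 (x, y)) 0 x)"
    if *: "0 \<le> \<gamma>" "\<delta> \<le> 2*pi" "\<And>y. \<gamma> < y \<Longrightarrow> y < \<delta> \<Longrightarrow> y \<noteq> pi" for \<gamma> \<delta>
  proof (rule weak_derivative_on_lines[OF D(4,5)])
    fix f k s t s' t'
    assume a: "0 < s" "s \<le> t" "t < 4*pi" "\<gamma> < s'" "s' \<le> t'" "t' < \<delta>" "bump s t f" "bump s' t' k"
    have "{s..t} \<times> {s'..t'} \<subseteq> cracked a"
    proof clarify
      fix x y assume "x \<in> {s..t}" "y \<in> {s'..t'}"
      then show "(x, y) \<in> cracked a" using a *(1,2) *(3)[of y] by (auto simp: cracked_iff)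
    qed
    then show "pairing u (deriv f) k = - pairing g1 f k"
      by (rule sobolev_test(1)[OF S a(2,5) _ a(7,8)])
  qed simp
  have "AE y in lborel. y \<noteq> pi" by (rule AE_lborel_singleton)
  moreover have "AE y in lborel. 0 < y \<and> y < pi \<longrightarrow>
    integrable lborel (\<lambda>x. u (x, y)) \<and> integrable lborel (\<lambda>x. g1 (x, y)) \<and>
    (\<exists>e. AE x in lborel. 0 < x \<and> x < 4*pi \<longrightarrow> u (x, y) = e + primitive (\<lambda>x. g1 (x, y)) 0 x)"
    by (rule half) auto
  moreover have "AE y in lborel. pi < y \<and> y < 2*pi \<longrightarrow>
    integrable lborel (\<lambda>x. u (x, y)) \<and> integrable lborel (\<lambda>x. g1 (x, y)) \<and>
    (\<exists>e. AE x in lborel. 0 < x \<and> x < 4*pi \<longrightarrow> u (x, y) = e + primitive (\<lambda>x. g1 (x, y)) 0 x)"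
    by (rule half) auto
  ultimately show ?thesis
    using Fubini_lborel(1)[OF D(8)]
    by eventually_elim (auto simp: ac_on_def)
qed

text \<open>The hypothesis on the crack admits whole vertical lines to the right of its tip, and otherwise the two
parts of a line below and above it.\<close>

lemma sobolev_vertical:
  assumes S: "sobolev a u g1 g2" and "0 \<le> \<alpha>" "\<beta> \<le> 4*pi" "0 \<le> \<gamma>" "\<gamma> < \<delta>" "\<delta> \<le> 2*pi"
    and crack: "\<And>x y. \<alpha> < x \<Longrightarrow> x < \<beta> \<Longrightarrow> \<gamma> < y \<Longrightarrow> y < \<delta> \<Longrightarrow> x \<le> a \<Longrightarrow> y \<noteq> pi"
  shows "AE x in lborel. \<alpha> < x \<and> x < \<beta> \<longrightarrow> (\<exists>e. ac_on \<gamma> \<delta> (\<lambda>y. u (x, y)) (\<lambda>y. g2 (x, y)) e)"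
proof -
  note D = sobolev_D[OF S]
  have "AE x in lborel. \<alpha> < x \<and> x < \<beta> \<longrightarrow>
    integrable lborel (\<lambda>y. u (x, y)) \<and> integrable lborel (\<lambda>y. g2 (x, y)) \<and>
    (\<exists>e. AE y in lborel. \<gamma> < y \<and> y < \<delta> \<longrightarrow> u (x, y) = e + primitive (\<lambda>y. g2 (x, y)) \<gamma> y)"
  proof (rule weak_derivative_on_vertical_lines[OF D(4,6)])
    fix f k s t s' t'
    assume a: "\<alpha> < s" "s \<le> t" "t < \<beta>" "\<gamma> < s'" "s' \<le> t'" "t' < \<delta>" "bump s t f" "bump s' t' k"
    have "{s..t} \<times> {s'..t'} \<subseteq> cracked a"
    proof clarify
      fix x y assume "x \<in> {s..t}" "y \<in> {s'..t'}"
      then show "(x, y) \<in> cracked a" using a assms(2-6) crack[of x y] by (auto simp: cracked_iff)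
    qed
    then show "pairing u f (deriv k) = - pairing g2 f k"
      by (rule sobolev_test(2)[OF S a(2,5) _ a(7,8)])
  qed (use assms in auto)
  with Fubini_lborel'(1)[OF D(9)] show ?thesis
    by eventually_elim (auto simp: ac_on_def)
qed

lemma ac_on_by_parts:
  assumes ac: "ac_on \<alpha> \<beta> u g e" and p: "smooth p" and "\<alpha> \<le> \<beta>"
  shows "(LINT x:{\<alpha>..\<beta>}|lborel. u x * deriv p x + g x * p x) = (e + primitive g \<alpha> \<beta>) * p \<beta> - e * p \<alpha>"
proof -
  have g: "integrable lborel g" and u: "integrable lborel u" using ac by (auto simp: ac_on_def)
  note dp = smooth_real_deriv[OF p]
  obtain B where B: "0 \<le> B" "\<And>x. x \<in> {\<alpha>..\<beta>} \<Longrightarrow> \<bar>p x\<bar> \<le> B" using smooth_bounded_on_interval[OF p] by blast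
  have gp: "set_integrable lborel {\<alpha>..\<beta>} (\<lambda>x. g x * p x)"
  proof -
    have "integrable lborel (\<lambda>x. g x * (indicator {\<alpha>..\<beta>} x * p x))"
      by (rule integrable_mult_bounded(1)[OF g, of _ B])
        (use B smooth_measurable[OF p] in \<open>auto split: split_indicator\<close>)
    then show ?thesis by (simp add: set_integrable_def mult_ac)
  qed
  have AEe: "AE x in lborel. x \<in> {\<alpha>..\<beta>} \<longrightarrow> u x * deriv p x + g x * p x =
      e * deriv p x + primitive g \<alpha> x * deriv p x + g x * p x"
  proof -
    have "AE x in lborel. x \<noteq> \<alpha>" "AE x in lborel. x \<noteq> \<beta>" by (rule AE_lborel_singleton)+
    moreover have "AE x in lborel. \<alpha> < x \<and> x < \<beta> \<longrightarrow> u x = e + primitive g \<alpha> x"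
      using ac by (simp add: ac_on_def)
    ultimately show ?thesis by eventually_elim (auto simp: distrib_right)
  qed
  have pm: "primitive g \<alpha> \<in> borel_measurable borel"
    by (rule borel_measurable_continuous_onI[OF primitive_continuous[OF g]])
  have "(LINT x:{\<alpha>..\<beta>}|lborel. u x * deriv p x + g x * p x) =
      (LINT x:{\<alpha>..\<beta>}|lborel. e * deriv p x + primitive g \<alpha> x * deriv p x + g x * p x)"
    using AEe g u pm smooth_measurable[OF p] smooth_measurable[OF dp(2)]
    unfolding set_lebesgue_integral_def
    by (intro integral_cong_AE) (auto elim!: eventually_mono split: split_indicator)
  also have "\<dots> = (LINT x:{\<alpha>..\<beta>}|lborel. e * deriv p x) + (LINT x:{\<alpha>..\<beta>}|lborel. primitive g \<alpha> x * deriv p x)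
      + (LINT x:{\<alpha>..\<beta>}|lborel. g x * p x)"
  proof -
    have 1: "set_integrable lborel {\<alpha>..\<beta>} (\<lambda>x. e * deriv p x)"
      by (intro set_integrable_continuous continuous_on_mult_left smooth_continuous[OF dp(2)])
    note 2 = integral_by_parts_primitive(1)[OF g p \<open>\<alpha> \<le> \<beta>\<close>]
    show ?thesis using set_integral_add(2)[OF set_integral_add(1)[OF 1 2] gp] set_integral_add(2)[OF 1 2] by simp
  qed
  also have "(LINT x:{\<alpha>..\<beta>}|lborel. e * deriv p x) = e * p \<beta> - e * p \<alpha>"
    using \<open>\<alpha> \<le> \<beta>\<close> by (rule set_integral_FTC) (intro DERIV_cmult dp(1) continuous_on_mult_left smooth_continuous[OF dp(2)])+
  also have "(LINT x:{\<alpha>..\<beta>}|lborel. primitive g \<alpha> x * deriv p x) =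
      primitive g \<alpha> \<beta> * p \<beta> - (LINT x:{\<alpha>..\<beta>}|lborel. g x * p x)"
    by (rule integral_by_parts_primitive(2)[OF g p \<open>\<alpha> \<le> \<beta>\<close>])
  finally show ?thesis by (simp add: algebra_simps)
qed

section \<open>Borel representatives\<close>

lemma lebesgue_on_lborel:
  fixes F :: "'a::euclidean_space \<Rightarrow> real"
  assumes S[measurable]: "S \<in> sets borel" and F': "F' \<in> borel_measurable borel" "\<And>z. z \<notin> S \<Longrightarrow> F' z = 0"
    and F: "F \<in> borel_measurable (lebesgue_on S)" and eq: "AE z in lebesgue_on S. F z = F' z"
  shows "(LINT z|lebesgue_on S. F z) = (LINT z|lborel. F' z)"
    "integrable (lebesgue_on S) F \<longleftrightarrow> integrable lborel F'"
proof -
  have SL: "S \<inter> space lebesgue \<in> sets lebesgue" using S by auto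
  have F'L: "F' \<in> borel_measurable lebesgue" using F'(1) by (simp add: measurable_completion)
  then have F'S: "F' \<in> borel_measurable (lebesgue_on S)" by (rule measurable_restrict_space1)
  have ind: "(\<lambda>z. indicator S z *\<^sub>R F' z) = F'" using F'(2) by (auto simp: fun_eq_iff split: split_indicator)
  have "(LINT z|lebesgue_on S. F z) = (LINT z|lebesgue_on S. F' z)"
    by (rule integral_cong_AE[OF F F'S eq])
  also have "\<dots> = (LINT z|lebesgue. F' z)"
    by (simp only: integral_restrict_space[OF SL] ind)
  also have "\<dots> = (LINT z|lborel. F' z)" using F'(1) by (intro integral_completion) simp
  finally show "(LINT z|lebesgue_on S. F z) = (LINT z|lborel. F' z)" .
  have "integrable (lebesgue_on S) F \<longleftrightarrow> integrable (lebesgue_on S) F'"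
    by (rule integrable_cong_AE[OF F F'S eq])
  also have "\<dots> \<longleftrightarrow> integrable lebesgue F'"
    by (simp only: integrable_restrict_space[OF SL] ind)
  also have "\<dots> \<longleftrightarrow> integrable lborel F'" using F'(1) by (intro integrable_completion) simp
  finally show "integrable (lebesgue_on S) F \<longleftrightarrow> integrable lborel F'" .
qed

lemma borel_representative:
  fixes F :: "'a::euclidean_space \<Rightarrow> real"
  assumes S[measurable]: "S \<in> sets borel" and F: "F \<in> borel_measurable (lebesgue_on S)"
  obtains F' where "F' \<in> borel_measurable borel" "\<And>z. z \<notin> S \<Longrightarrow> F' z = 0" "AE z in lebesgue_on S. F z = F' z"
proof -
  have SL: "S \<inter> space lebesgue \<in> sets lebesgue" using S by auto
  have "(\<lambda>z. indicator S z *\<^sub>R F z) \<in> borel_measurable lebesgue"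
    using F borel_measurable_restrict_space_iff[OF SL, of F] by simp
  then obtain F0 where F0: "F0 \<in> borel_measurable lborel" "AE z in lborel. indicator S z *\<^sub>R F z = F0 z"
    using completion_ex_borel_measurable_real by blast
  show ?thesis
  proof (rule that[of "\<lambda>z. indicator S z * F0 z"])
    show "(\<lambda>z. indicator S z * F0 z) \<in> borel_measurable borel" using F0(1) by auto
    have "AE z in lebesgue. indicator S z *\<^sub>R F z = F0 z"
      using F0(2) by (rule AE_completion)
    then show "AE z in lebesgue_on S. F z = indicator S z * F0 z"
      by (subst AE_restrict_space_iff[OF SL]) (auto elim!: eventually_mono)
  qed auto
qed

lemma borel_measurable_continuous_on_cracked:
  fixes u :: "real \<times> real \<Rightarrow> real"
  assumes "continuous_on (cracked a) u" "\<And>z. z \<notin> cracked a \<Longrightarrow> u z = 0"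
  shows "u \<in> borel_measurable borel"
proof -
  have "(\<lambda>z. indicator (cracked a) z *\<^sub>R u z) \<in> borel_measurable borel"
    using assms(1) by (intro borel_measurable_continuous_on_indicator) auto
  moreover have "(\<lambda>z. indicator (cracked a) z *\<^sub>R u z) = u" using assms(2) by (auto simp: fun_eq_iff split: split_indicator)
  ultimately show ?thesis by simp
qed

lemma has_derivative_product:
  assumes f: "smooth f" and k: "smooth k"
  shows "((\<lambda>z::real \<times> real. f (fst z) * k (snd z)) has_derivative
    (\<lambda>h. f (fst z) * (deriv k (snd z) * snd h) + deriv f (fst z) * fst h * k (snd z))) (at z)"
proof (rule has_derivative_mult)
  have df: "(f has_derivative (\<lambda>h. deriv f (fst z) * h)) (at (fst z))"
    and dk: "(k has_derivative (\<lambda>h. deriv k (snd z) * h)) (at (snd z))"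
    using smooth_real_deriv(1)[OF f] smooth_real_deriv(1)[OF k] by (simp_all add: has_field_derivative_def)
  show "((\<lambda>z. f (fst z)) has_derivative (\<lambda>h. deriv f (fst z) * fst h)) (at z)"
    using diff_chain_at[OF bounded_linear_imp_has_derivative[OF bounded_linear_fst] df] by (simp add: o_def)
  show "((\<lambda>z. k (snd z)) has_derivative (\<lambda>h. deriv k (snd z) * snd h)) (at z)"
    using diff_chain_at[OF bounded_linear_imp_has_derivative[OF bounded_linear_snd] dk] by (simp add: o_def)
qed

lemma test_function_product:
  assumes "bump s t f" "bump s' t' k" "{s..t} \<times> {s'..t'} \<subseteq> S"
  shows "test_function S (\<lambda>z. f (fst z) * k (snd z))"
    "frechet_derivative (\<lambda>z. f (fst z) * k (snd z)) (at z) (1, 0) = deriv f (fst z) * k (snd z)"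
    "frechet_derivative (\<lambda>z. f (fst z) * k (snd z)) (at z) (0, 1) = f (fst z) * deriv k (snd z)"
proof -
  let ?\<phi> = "\<lambda>z. f (fst z) * k (snd z)"
  have sm: "smooth f" "smooth k" using assms by (auto simp: bump_def)
  have sub: "closure {z. ?\<phi> z \<noteq> 0} \<subseteq> {s..t} \<times> {s'..t'}"
    using assms(1,2) by (intro closure_minimal closed_Times) (auto simp: bump_def)
  moreover have "compact ({s..t} \<times> {s'..t'})" by (rule compact_Times) auto
  ultimately have "compact (closure {z. ?\<phi> z \<noteq> 0})"
    using compact_Int_closed[OF _ closed_closure, of "{s..t} \<times> {s'..t'}" "{z. ?\<phi> z \<noteq> 0}"]
    by (simp only: Int_absorb1)
  moreover have "smooth ?\<phi>" by (rule smooth_mult[OF smooth_fst[OF sm(1)] smooth_snd[OF sm(2)]])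
  ultimately show "test_function S ?\<phi>"
    using order_trans[OF sub assms(3)] unfolding test_function_def smooth_def by blast
  from frechet_derivative_at[OF has_derivative_product[OF sm]]
  have *: "frechet_derivative ?\<phi> (at z) = (\<lambda>h. f (fst z) * (deriv k (snd z) * snd h) + deriv f (fst z) * fst h * k (snd z))"
    by simp
  show "frechet_derivative ?\<phi> (at z) (1, 0) = deriv f (fst z) * k (snd z)"
    "frechet_derivative ?\<phi> (at z) (0, 1) = f (fst z) * deriv k (snd z)"
    unfolding * by simp_all
qed

lemma square_integrable_representative:
  assumes u: "square_integrable (lebesgue_on (cracked a)) u"
    and u': "u' \<in> borel_measurable borel" "\<And>z. z \<notin> cracked a \<Longrightarrow> u' z = 0" "AE z in lebesgue_on (cracked a). u z = u' z"
  shows "L2_cracked a u'"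
proof -
  have "integrable (lebesgue_on (cracked a)) (\<lambda>z. (u z)\<^sup>2) \<longleftrightarrow> integrable lborel (\<lambda>z. (u' z)\<^sup>2)"
  proof (rule lebesgue_on_lborel(2))
    show "AE z in lebesgue_on (cracked a). (u z)\<^sup>2 = (u' z)\<^sup>2" using u'(3) by eventually_elim simp
  qed (use u u' in \<open>auto simp: square_integrable_def\<close>)
  then show ?thesis using u u' by (auto simp: square_integrable_def L2_cracked_def)
qed

lemma gradient_components_measurable:
  assumes "has_L2_gradient S u (G :: real \<times> real \<Rightarrow> real \<times> real)"
  shows "(\<lambda>z. fst (G z)) \<in> borel_measurable (lebesgue_on S)" "(\<lambda>z. snd (G z)) \<in> borel_measurable (lebesgue_on S)"
proof -
  have Gm: "G \<in> borel_measurable (lebesgue_on S)"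
    using assms by (simp add: has_L2_gradient_def square_integrable_def)
  have "fst \<in> borel \<rightarrow>\<^sub>M (borel :: real measure)" "snd \<in> borel \<rightarrow>\<^sub>M (borel :: real measure)"
    by (auto intro!: borel_measurable_continuous_onI continuous_on_fst continuous_on_snd)
  then show "(\<lambda>z. fst (G z)) \<in> borel_measurable (lebesgue_on S)" "(\<lambda>z. snd (G z)) \<in> borel_measurable (lebesgue_on S)"
    using measurable_compose[OF Gm] by blast+
qed

lemma sobolev_of_weak_gradient:
  assumes u: "square_integrable (lebesgue_on (cracked a)) u" and G: "has_L2_gradient (cracked a) u G"
    and u': "u' \<in> borel_measurable borel" "\<And>z. z \<notin> cracked a \<Longrightarrow> u' z = 0" "AE z in lebesgue_on (cracked a). u z = u' z"
    and g1: "g1 \<in> borel_measurable borel" "\<And>z. z \<notin> cracked a \<Longrightarrow> g1 z = 0" "AE z in lebesgue_on (cracked a). fst (G z) = g1 z"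
    and g2: "g2 \<in> borel_measurable borel" "\<And>z. z \<notin> cracked a \<Longrightarrow> g2 z = 0" "AE z in lebesgue_on (cracked a). snd (G z) = g2 z"
  shows "sobolev a u' g1 g2"
proof -
  let ?L = "lebesgue_on (cracked a)"
  have G2: "square_integrable ?L G" using G by (simp add: has_L2_gradient_def)
  then have Gm: "G \<in> borel_measurable ?L" by (simp add: square_integrable_def)
  note m = gradient_components_measurable[OF G]
  have sq: "integrable ?L (\<lambda>z. (norm (G z))\<^sup>2)" using G2 by (simp add: square_integrable_def)
  have "integrable ?L (\<lambda>z. (fst (G z))\<^sup>2)" "integrable ?L (\<lambda>z. (snd (G z))\<^sup>2)"
    by (rule Bochner_Integration.integrable_bound[OF sq]; use m in \<open>auto simp: norm_prod_def\<close>)+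
  then have "square_integrable ?L (\<lambda>z. fst (G z))" "square_integrable ?L (\<lambda>z. snd (G z))"
    using m by (auto simp: square_integrable_def)
  then have L2: "L2_cracked a u'" "L2_cracked a g1" "L2_cracked a g2"
    using square_integrable_representative[OF u u'] square_integrable_representative[OF _ g1] square_integrable_representative[OF _ g2]
    by blast+
  have um: "u \<in> borel_measurable ?L" using u by (simp add: square_integrable_def)
  have tr: "(LINT z|?L. w z * \<psi> z) = (LINT z|lborel. w' z * \<psi> z)"
    if "w \<in> borel_measurable ?L" "w' \<in> borel_measurable borel" "\<And>z. z \<notin> cracked a \<Longrightarrow> w' z = 0"
      "AE z in ?L. w z = w' z" "\<psi> \<in> borel_measurable borel" for w w' \<psi> :: "real \<times> real \<Rightarrow> real"
  proof (rule lebesgue_on_lborel(1))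
    have "\<psi> \<in> borel_measurable ?L" using that(5) by (intro measurable_restrict_space1) (simp add: measurable_completion)
    then show "(\<lambda>z. w z * \<psi> z) \<in> borel_measurable ?L" using that(1) by auto
    show "AE z in ?L. w z * \<psi> z = w' z * \<psi> z" using that(4) by eventually_elim simp
  qed (use that in auto)
  have "pairing u' (deriv f) k = - pairing g1 f k \<and>
      pairing u' f (deriv k) = - pairing g2 f k"
    if "s \<le> t \<and> s' \<le> t' \<and> {s..t} \<times> {s'..t'} \<subseteq> cracked a \<and> bump s t f \<and> bump s' t' k" for f k s t s' t'
  proof -
    have a: "{s..t} \<times> {s'..t'} \<subseteq> cracked a" "bump s t f" "bump s' t' k" using that by auto
    let ?\<phi> = "\<lambda>z. f (fst z) * k (snd z)"
    have "\<forall>b\<in>Basis. (LINT x|?L. u x * frechet_derivative ?\<phi> (at x) b) = - (LINT x|?L. (G x \<bullet> b) * ?\<phi> x)"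
      using G test_function_product(1)[OF a(2,3,1)] unfolding has_L2_gradient_def by blast
    moreover have "(1, 0) \<in> (Basis :: (real \<times> real) set)" "(0, 1) \<in> (Basis :: (real \<times> real) set)"
      by (auto simp: Basis_prod_def)
    ultimately have "(LINT x|?L. u x * frechet_derivative ?\<phi> (at x) (1, 0)) = - (LINT x|?L. (G x \<bullet> (1, 0)) * ?\<phi> x)"
      "(LINT x|?L. u x * frechet_derivative ?\<phi> (at x) (0, 1)) = - (LINT x|?L. (G x \<bullet> (0, 1)) * ?\<phi> x)" by blast+
    then have *: "(LINT x|?L. u x * (deriv f (fst x) * k (snd x))) = - (LINT x|?L. fst (G x) * ?\<phi> x)"
      "(LINT x|?L. u x * (f (fst x) * deriv k (snd x))) = - (LINT x|?L. snd (G x) * ?\<phi> x)"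
      unfolding test_function_product(2,3)[OF a(2,3,1)] by (simp_all add: inner_prod_def)
    have "f \<in> borel_measurable borel" "deriv f \<in> borel_measurable borel" "k \<in> borel_measurable borel" "deriv k \<in> borel_measurable borel"
      using a(2,3) bump_deriv[OF a(2)] bump_deriv[OF a(3)] by (auto simp: bump_def intro: smooth_measurable)
    then have \<psi>: "?\<phi> \<in> borel_measurable borel" "(\<lambda>z. deriv f (fst z) * k (snd z)) \<in> borel_measurable borel"
      "(\<lambda>z. f (fst z) * deriv k (snd z)) \<in> borel_measurable borel"
      by (auto intro!: borel_measurable_times fst_measurable_lborel snd_measurable_lborel)
    show ?thesis
      using * tr[OF um u' \<psi>(2)] tr[OF um u' \<psi>(3)] tr[OF m(1) g1 \<psi>(1)] tr[OF m(2) g2 \<psi>(1)] by simp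
  qed
  then show "sobolev a u' g1 g2" unfolding sobolev_def using L2 by blast
qed

lemma sobolev_representative:
  assumes u: "square_integrable (lebesgue_on (cracked a)) u" and G: "has_L2_gradient (cracked a) u G"
    and u': "u' \<in> borel_measurable borel" "\<And>z. z \<notin> cracked a \<Longrightarrow> u' z = 0" "AE z in lebesgue_on (cracked a). u z = u' z"
  obtains g1 g2 where "sobolev a u' g1 g2" "AE z in lebesgue_on (cracked a). G z = (g1 z, g2 z)"
proof -
  let ?L = "lebesgue_on (cracked a)"
  note m = gradient_components_measurable[OF G]
  obtain g1 where g1: "g1 \<in> borel_measurable borel" "\<And>z. z \<notin> cracked a \<Longrightarrow> g1 z = 0" "AE z in ?L. fst (G z) = g1 z"
    using borel_representative[OF cracked_borel m(1)] by blast
  obtain g2 where g2: "g2 \<in> borel_measurable borel" "\<And>z. z \<notin> cracked a \<Longrightarrow> g2 z = 0" "AE z in ?L. snd (G z) = g2 z"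
    using borel_representative[OF cracked_borel m(2)] by blast
  have "AE z in ?L. G z = (g1 z, g2 z)" using g1(3) g2(3) by eventually_elim (auto simp: prod_eq_iff)
  with sobolev_of_weak_gradient[OF u G u' g1 g2] show ?thesis by (rule that)
qed

section \<open>Uniqueness of the weak gradient\<close>

text \<open>Open null sets are empty.\<close>

lemma continuous_AE_imp_all:
  fixes f :: "'a::euclidean_space \<Rightarrow> real"
  assumes "open S" "continuous_on S f" "AE x in lborel. x \<in> S \<longrightarrow> f x = 0" "x \<in> S"
  shows "f x = 0"
proof (rule ccontr)
  assume "f x \<noteq> 0"
  let ?N = "S \<inter> f -` (- {0})"
  have op: "open ?N" using assms(1,2) by (intro continuous_open_preimage) auto
  then have "?N \<in> null_sets lborel"
    using assms(3) by (subst AE_iff_null_sets) (auto elim!: eventually_mono)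
  then have "negligible ?N"
    by (simp add: negligible_iff_null_sets null_sets_completionI)
  then show False using open_not_negligible[OF op] assms(4) \<open>f x \<noteq> 0\<close> by auto
qed

text \<open>The primitive of \<open>g\<close> is almost everywhere, hence everywhere, constant.\<close>

lemma ac_on_zero:
  assumes "ac_on \<alpha> \<beta> u g e" and "AE x in lborel. \<alpha> < x \<and> x < \<beta> \<longrightarrow> u x = 0"
  shows "AE x in lborel. \<alpha> < x \<and> x < \<beta> \<longrightarrow> g x = 0"
proof -
  have g: "integrable lborel g" using assms by (simp add: ac_on_def)
  have ae: "AE x in lborel. x \<in> {\<alpha><..<\<beta>} \<longrightarrow> e + primitive g \<alpha> x = 0"
  proof -
    have "AE x in lborel. \<alpha> < x \<and> x < \<beta> \<longrightarrow> u x = e + primitive g \<alpha> x"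
      using assms(1) by (simp add: ac_on_def)
    with assms(2) show ?thesis by eventually_elim auto
  qed
  have const: "e + primitive g \<alpha> x = 0" if "x \<in> {\<alpha><..<\<beta>}" for x
    by (rule continuous_AE_imp_all[OF _ _ ae that])
      (auto intro!: continuous_intros continuous_on_subset[OF primitive_continuous[OF g]])
  show ?thesis
  proof (rule AE_eq_0_if_integral_intervals_0[OF g])
    fix s t assume st: "\<alpha> < s" "s < t" "t < \<beta>"
    have "(LINT x:{s..t}|lborel. g x) = 0"
      using primitive_diff[OF g, of \<alpha> s t] const[of s] const[of t] st by simp
    moreover have "AE x in lborel. x \<noteq> s" "AE x in lborel. x \<noteq> t" by (rule AE_lborel_singleton)+
    then have "AE x in lborel. indicator {s<..<t} x *\<^sub>R g x = indicator {s..t} x *\<^sub>R g x"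
      by eventually_elim (auto split: split_indicator)
    then have "(LINT x:{s<..<t}|lborel. g x) = (LINT x:{s..t}|lborel. g x)"
      using g unfolding set_lebesgue_integral_def by (intro integral_cong_AE) auto
    ultimately show "(LINT x:{s<..<t}|lborel. g x) = 0" by simp
  qed
qed

lemma AE_zero_if_AE_lines:
  fixes d :: "real \<times> real \<Rightarrow> real"
  assumes d: "integrable lborel d" and "AE y in lborel. AE x in lborel. d (x, y) = 0"
  shows "AE z in lborel. d z = 0"
proof -
  have i: "integrable lborel (\<lambda>z. \<bar>d z\<bar>)" using d by auto
  have "AE y in lborel. (LINT x|lborel. \<bar>d (x, y)\<bar>) = 0"
    using assms(2)
  proof eventually_elim
    case (elim y)
    then show ?case by (intro integral_eq_zero_AE) auto
  qed
  then have "(LINT y|lborel. LINT x|lborel. \<bar>d (x, y)\<bar>) = 0" by (rule integral_eq_zero_AE)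
  then have "(LINT z|lborel. \<bar>d z\<bar>) = 0" using Fubini_lborel(3)[OF i] by simp
  then show ?thesis using integral_nonneg_eq_0_iff_AE[OF i] by simp
qed

lemma AE_zero_if_AE_vertical_lines:
  fixes d :: "real \<times> real \<Rightarrow> real"
  assumes d: "integrable lborel d" and "AE x in lborel. AE y in lborel. d (x, y) = 0"
  shows "AE z in lborel. d z = 0"
proof -
  have i: "integrable lborel (\<lambda>z. \<bar>d z\<bar>)" using d by auto
  have "AE x in lborel. (LINT y|lborel. \<bar>d (x, y)\<bar>) = 0"
    using assms(2)
  proof eventually_elim
    case (elim y)
    then show ?case by (intro integral_eq_zero_AE) auto
  qed
  then have "(LINT x|lborel. LINT y|lborel. \<bar>d (x, y)\<bar>) = 0" by (rule integral_eq_zero_AE)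
  then have "(LINT z|lborel. \<bar>d z\<bar>) = 0" using Fubini_lborel'(3)[OF i] by simp
  then show ?thesis using integral_nonneg_eq_0_iff_AE[OF i] by simp
qed

lemma weak_gradient_zero:
  assumes S: "sobolev a (\<lambda>z. 0) d1 d2" and "0 < a"
  shows "AE z in lborel. d1 z = 0" "AE z in lborel. d2 z = 0"
proof -
  note D = sobolev_D[OF S]
  have off: "d1 (x, y) = 0 \<and> d2 (x, y) = 0" if "\<not> (0 < x \<and> x < 4*pi \<and> 0 < y \<and> y < 2*pi)" for x y
  proof -
    have "(x, y) \<notin> cracked a" using that unfolding cracked_iff by blast
    then show ?thesis using D(2,3) unfolding L2_cracked_def by blast
  qed
  have "AE y in lborel. AE x in lborel. d1 (x, y) = 0"
    using sobolev_horizontal[OF S]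
  proof eventually_elim
    case (elim y)
    show ?case
    proof (cases "0 < y \<and> y < 2*pi")
      case True
      with elim obtain e where "ac_on 0 (4*pi) (\<lambda>x. 0) (\<lambda>x. d1 (x, y)) e" by blast
      then have "AE x in lborel. 0 < x \<and> x < 4*pi \<longrightarrow> d1 (x, y) = 0" by (rule ac_on_zero) simp
      then show ?thesis
      proof eventually_elim
        case (elim x)
        then show ?case using off[of x y] by blast
      qed
    next
      case False
      then have "d1 (x, y) = 0" for x using off[of x y] by blast
      then show ?thesis by simp
    qed
  qed
  then show "AE z in lborel. d1 z = 0" by (rule AE_zero_if_AE_lines[OF D(5)])
  have v: "AE x in lborel. 0 < x \<and> x < 4*pi \<longrightarrow> (\<exists>e. ac_on \<gamma> \<delta> (\<lambda>y. 0) (\<lambda>y. d2 (x, y)) e)"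
    if "(\<gamma> = 0 \<and> \<delta> = pi) \<or> (\<gamma> = pi \<and> \<delta> = 2*pi)" for \<gamma> \<delta>
    by (rule sobolev_vertical[OF S]) (use that in auto)
  have v1: "AE x in lborel. 0 < x \<and> x < 4*pi \<longrightarrow> (\<exists>e. ac_on 0 pi (\<lambda>y. 0) (\<lambda>y. d2 (x, y)) e)"
    and v2: "AE x in lborel. 0 < x \<and> x < 4*pi \<longrightarrow> (\<exists>e. ac_on pi (2*pi) (\<lambda>y. 0) (\<lambda>y. d2 (x, y)) e)"
    by (rule v, simp)+
  have "AE x in lborel. AE y in lborel. d2 (x, y) = 0"
    using v1 v2
  proof eventually_elim
    case (elim x)
    show ?case
    proof (cases "0 < x \<and> x < 4*pi")
      case True
      with elim obtain e e' where "ac_on 0 pi (\<lambda>y. 0) (\<lambda>y. d2 (x, y)) e" "ac_on pi (2*pi) (\<lambda>y. 0) (\<lambda>y. d2 (x, y)) e'" by blast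
      note ac_on_zero[OF this(1)] ac_on_zero[OF this(2)]
      then have "AE y in lborel. 0 < y \<and> y < pi \<longrightarrow> d2 (x, y) = 0" "AE y in lborel. pi < y \<and> y < 2*pi \<longrightarrow> d2 (x, y) = 0"
        by simp_all
      moreover have "AE y in lborel. y \<noteq> pi" by (rule AE_lborel_singleton)
      ultimately show ?thesis
      proof eventually_elim
        case (elim y)
        then show ?case using off[of x y] by force
      qed
    next
      case False
      then have "d2 (x, y) = 0" for y using off[of x y] by blast
      then show ?thesis by simp
    qed
  qed
  then show "AE z in lborel. d2 z = 0" by (rule AE_zero_if_AE_vertical_lines[OF D(6)])
qed

lemma weak_gradient_unique:
  assumes "sobolev a u g1 g2" "sobolev a u h1 h2" "0 < a"
  shows "AE z in lborel. g1 z = h1 z" "AE z in lborel. g2 z = h2 z"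
proof -
  have "sobolev a (\<lambda>z. 0) (\<lambda>z. g1 z - h1 z) (\<lambda>z. g2 z - h2 z)"
    using sobolev_diff[OF assms(1,2), of 1] by simp
  from weak_gradient_zero[OF this \<open>0 < a\<close>]
  show "AE z in lborel. g1 z = h1 z" "AE z in lborel. g2 z = h2 z" by auto
qed

section \<open>Products as elements of the form domain\<close>

lemma integral_smooth_derivative_zero:
  fixes F :: "real \<times> real \<Rightarrow> real"
  assumes F: "smooth F" and M: "\<And>x y. F (x, y) \<noteq> 0 \<Longrightarrow> \<bar>x\<bar> < M \<and> \<bar>y\<bar> < M" and b: "b \<in> Basis"
  shows "(LINT z|lborel. frechet_derivative F (at z) b) = 0"
proof -
  define D where "D = (\<lambda>z. frechet_derivative F (at z) b)"
  have cD: "continuous_on S D" for S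
    unfolding D_def by (rule smooth_continuous[OF smooth_frechet_derivative[OF F b]])
  have D0: "D z = 0" if "z \<notin> cbox (-M, -M) (M, M)" for z
  proof -
    have "(F has_derivative (\<lambda>h. 0)) (at z)"
    proof (rule has_derivative_transform_within_open[of "\<lambda>z. 0" _ _ _ "- cbox (-M, -M) (M, M)"])
      show "0 = F w" if "w \<in> - cbox (-M, -M) (M, M)" for w
        using M[of "fst w" "snd w"] that by (cases w) force
    qed (use that in auto)
    then show ?thesis unfolding D_def using frechet_derivative_at by metis
  qed
  have iD: "integrable lborel D"
  proof -
    have "integrable lborel (\<lambda>z. indicator (cbox (-M, -M) (M, M)) z *\<^sub>R D z)"
      by (intro borel_integrable_compact cD) auto
    moreover have "(\<lambda>z. indicator (cbox (-M, -M) (M, M)) z *\<^sub>R D z) = D"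
    proof
      show "indicator (cbox (-M, -M) (M, M)) z *\<^sub>R D z = D z" for z
        using D0[of z] by (cases "z \<in> cbox (-M, -M) (M, M)") simp_all
    qed
    ultimately show ?thesis by simp
  qed
  have dF: "(F has_derivative frechet_derivative F (at z)) (at z)" for z by (rule smooth_has_derivative[OF F])
  have line0: "(LINT t|lborel. h' t) = 0"
    if h: "\<And>t. (h has_real_derivative h' t) (at t)" and ch: "continuous_on UNIV h'"
      and h0: "\<And>t. h t \<noteq> 0 \<Longrightarrow> \<bar>t\<bar> < M" and h'0: "\<And>t. t \<notin> {-M..M} \<Longrightarrow> h' t = 0" for h h' :: "real \<Rightarrow> real"
  proof (cases "M \<ge> 0")
    case True
    have "(LINT t:{-M..M}|lborel. h' t) = h M - h (-M)"
      using True by (intro set_integral_FTC h continuous_on_subset[OF ch]) auto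
    moreover have "h M = 0" "h (-M) = 0" using h0[of M] h0[of "-M"] by force+
    moreover have "(\<lambda>t. indicator {-M..M} t *\<^sub>R h' t) = h'" using h'0 by (auto simp: fun_eq_iff indicator_def)
    ultimately show ?thesis by (simp add: set_lebesgue_integral_def)
  next
    case False
    then have "h' = (\<lambda>t. 0)" using h'0 by (auto simp: fun_eq_iff)
    then show ?thesis by simp
  qed
  have "b = (1, 0) \<or> b = (0, 1)" using b by (auto simp: Basis_prod_def)
  then show ?thesis
  proof
    assume b1: "b = (1, 0)"
    have "(LINT x|lborel. D (x, y)) = 0" for y
    proof (rule line0)
      show "((\<lambda>x. F (x, y)) has_real_derivative D (x, y)) (at x)" for x
      proof -
        have "((\<lambda>x. (x, y)) has_derivative (\<lambda>h. (h, 0))) (at x)"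
          by (rule has_derivative_Pair[OF has_derivative_ident has_derivative_const])
        from diff_chain_at[OF this dF]
        have "((\<lambda>x. F (x, y)) has_derivative (\<lambda>h. frechet_derivative F (at (x, y)) (h, 0))) (at x)"
          by (simp add: o_def)
        moreover have "frechet_derivative F (at (x, y)) (h, 0) = D (x, y) * h" for h
          using linear_scale[OF has_derivative_linear[OF dF[of "(x, y)"]], of h "(1, 0)"] by (simp add: D_def b1)
        ultimately show ?thesis by (simp add: has_field_derivative_def)
      qed
      show "continuous_on UNIV (\<lambda>x. D (x, y))"
        by (rule continuous_on_compose2[OF cD[of UNIV]]) (auto intro!: continuous_intros)
      show "\<bar>x\<bar> < M" if "F (x, y) \<noteq> 0" for x using M[OF that] by simp
      show "D (x, y) = 0" if "x \<notin> {-M..M}" for x using that by (intro D0) auto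
    qed
    then show ?thesis using Fubini_lborel(3)[OF iD] by (simp add: D_def)
  next
    assume b2: "b = (0, 1)"
    have "(LINT y|lborel. D (x, y)) = 0" for x
    proof (rule line0)
      show "((\<lambda>y. F (x, y)) has_real_derivative D (x, y)) (at y)" for y
      proof -
        have "((\<lambda>y. (x, y)) has_derivative (\<lambda>h. (0, h))) (at y)"
          by (rule has_derivative_Pair[OF has_derivative_const has_derivative_ident])
        from diff_chain_at[OF this dF]
        have "((\<lambda>y. F (x, y)) has_derivative (\<lambda>h. frechet_derivative F (at (x, y)) (0, h))) (at y)"
          by (simp add: o_def)
        moreover have "frechet_derivative F (at (x, y)) (0, h) = D (x, y) * h" for h
          using linear_scale[OF has_derivative_linear[OF dF[of "(x, y)"]], of h "(0, 1)"] by (simp add: D_def b2)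
        ultimately show ?thesis by (simp add: has_field_derivative_def)
      qed
      show "continuous_on UNIV (\<lambda>y. D (x, y))"
        by (rule continuous_on_compose2[OF cD[of UNIV]]) (auto intro!: continuous_intros)
      show "\<bar>y\<bar> < M" if "F (x, y) \<noteq> 0" for y using M[OF that] by simp
      show "D (x, y) = 0" if "y \<notin> {-M..M}" for y using that by (intro D0) auto
    qed
    then show ?thesis using Fubini_lborel'(3)[OF iD] by (simp add: D_def)
  qed
qed

lemma AE_lborel_imp_lebesgue_on:
  assumes "AE z in lborel. P z" "S \<in> sets borel"
  shows "AE z in lebesgue_on S. P z"
proof -
  have "S \<inter> space lebesgue \<in> sets lebesgue" using assms(2) by auto
  then show ?thesis
    using AE_completion[OF assms(1)] by (subst AE_restrict_space_iff) (auto elim!: eventually_mono)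
qed

definition on_cracked :: "real \<Rightarrow> (real \<Rightarrow> real) \<Rightarrow> (real \<Rightarrow> real) \<Rightarrow> real \<times> real \<Rightarrow> real" where
  "on_cracked a p q z = (if z \<in> cracked a then p (fst z) * q (snd z) else 0)"

lemma on_cracked_eq: "on_cracked a p q z = indicator (cracked a) z * (p (fst z) * q (snd z))"
  by (simp add: on_cracked_def)

lemma L2_on_cracked:
  assumes p: "continuous_on UNIV p" and q: "continuous_on UNIV q"
  shows "L2_cracked a (on_cracked a p q)"
proof -
  have c: "continuous_on UNIV (\<lambda>z::real \<times> real. p (fst z) * q (snd z))"
    by (intro continuous_on_mult continuous_on_compose2[OF p] continuous_on_compose2[OF q] continuous_intros) auto
  have m: "on_cracked a p q \<in> borel_measurable borel"
    unfolding on_cracked_eq[abs_def] using borel_measurable_continuous_onI[OF c] by auto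
  have "integrable lborel (\<lambda>z. indicator (cbox (0, 0) (4*pi, 2*pi)) z *\<^sub>R (p (fst z) * q (snd z))\<^sup>2)"
    by (intro borel_integrable_compact continuous_on_power continuous_on_subset[OF c]) auto
  then have "integrable lborel (\<lambda>z. (on_cracked a p q z)\<^sup>2)"
  proof (rule Bochner_Integration.integrable_bound)
    have sub: "cracked a \<subseteq> cbox (0, 0) (4*pi, 2*pi)" by (auto simp: cracked_iff)
    then show "AE z in lborel. norm ((on_cracked a p q z)\<^sup>2) \<le> norm (indicator (cbox (0, 0) (4*pi, 2*pi)) z *\<^sub>R (p (fst z) * q (snd z))\<^sup>2)"
      by (intro AE_I2) (auto simp: on_cracked_def)
  qed (use m in auto)
  then show ?thesis using m by (auto simp: L2_cracked_def on_cracked_def)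
qed

lemma L2_lebesgue_on:
  assumes "L2_cracked a u"
  shows "u \<in> borel_measurable (lebesgue_on (cracked a))" "square_integrable (lebesgue_on (cracked a)) u"
proof -
  have m: "u \<in> borel_measurable borel" using assms by (simp add: L2_cracked_def)
  then show um: "u \<in> borel_measurable (lebesgue_on (cracked a))"
    by (intro measurable_restrict_space1) (simp add: measurable_completion)
  have "integrable (lebesgue_on (cracked a)) (\<lambda>z. (u z)\<^sup>2) \<longleftrightarrow> integrable lborel (\<lambda>z. (u z)\<^sup>2)"
    by (rule lebesgue_on_lborel(2)) (use assms m um in \<open>auto simp: L2_cracked_def\<close>)
  then show "square_integrable (lebesgue_on (cracked a)) u"
    using assms um by (auto simp: square_integrable_def L2_cracked_def)
qed

text \<open>Here the test function is arbitrary. Its product with the smooth function on the plane is smooth with compact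
support, so that its partial derivatives integrate to zero; outside the cracked rectangle the integrands
vanish.\<close>

lemma on_cracked_gradient:
  assumes p: "smooth p" and q: "smooth q"
  shows "has_L2_gradient (cracked a) (on_cracked a p q)
    (\<lambda>z. (on_cracked a (deriv p) q z, on_cracked a p (deriv q) z))"
proof -
  let ?L = "lebesgue_on (cracked a)"
  let ?v = "on_cracked a p q" and ?v1 = "on_cracked a (deriv p) q" and ?v2 = "on_cracked a p (deriv q)"
  let ?V = "\<lambda>z::real \<times> real. p (fst z) * q (snd z)"
  note c = smooth_continuous[OF p, of UNIV] smooth_continuous[OF q, of UNIV]
    smooth_continuous[OF smooth_real_deriv(2)[OF p], of UNIV] smooth_continuous[OF smooth_real_deriv(2)[OF q], of UNIV]
  note L2 = L2_on_cracked[OF c(1,2), of a] L2_on_cracked[OF c(3,2), of a] L2_on_cracked[OF c(1,4), of a]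
  have G2: "square_integrable ?L (\<lambda>z. (?v1 z, ?v2 z))"
  proof -
    have "integrable ?L (\<lambda>z. (?v1 z)\<^sup>2 + (?v2 z)\<^sup>2)"
      using L2_lebesgue_on(2)[OF L2(2)] L2_lebesgue_on(2)[OF L2(3)] by (auto simp: square_integrable_def)
    then show ?thesis
      using L2_lebesgue_on(1)[OF L2(2)] L2_lebesgue_on(1)[OF L2(3)]
      by (auto simp: square_integrable_def norm_prod_def intro!: borel_measurable_Pair)
  qed
  have sV: "smooth ?V" by (rule smooth_mult[OF smooth_fst[OF p] smooth_snd[OF q]])
  have parts: "(LINT z|?L. ?v z * frechet_derivative \<phi> (at z) b) = - (LINT z|?L. w z * \<phi> z)"
    if \<phi>: "test_function (cracked a) \<phi>" and b: "b \<in> Basis" and w: "L2_cracked a w"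
      "\<And>z. z \<in> cracked a \<Longrightarrow> w z = frechet_derivative ?V (at z) b" for \<phi> b w
  proof -
    have s\<phi>: "smooth \<phi>" using \<phi> by (simp add: test_function_def smooth_def)
    define D where "D = (\<lambda>z. frechet_derivative \<phi> (at z) b)"
    have sD: "smooth D" unfolding D_def by (rule smooth_frechet_derivative[OF s\<phi> b])
    have cp: "compact (closure {z. \<phi> z \<noteq> 0})" and sub: "closure {z. \<phi> z \<noteq> 0} \<subseteq> cracked a"
      using \<phi> by (auto simp: test_function_def)
    have \<phi>0: "\<phi> z = 0" if "z \<notin> cracked a" for z using sub closure_subset[of "{z. \<phi> z \<noteq> 0}"] that by blast
    have D0: "D z = 0" if "z \<notin> cracked a" for z
    proof -
      have "(\<phi> has_derivative (\<lambda>h. 0)) (at z)"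
      proof (rule has_derivative_transform_within_open[of "\<lambda>z. 0" _ _ _ "- closure {z. \<phi> z \<noteq> 0}"])
        show "0 = \<phi> w" if "w \<in> - closure {z. \<phi> z \<noteq> 0}" for w
          using closure_subset[of "{z. \<phi> z \<noteq> 0}"] that by auto
      qed (use that sub in auto)
      then show ?thesis unfolding D_def using frechet_derivative_at by metis
    qed
    have bd: "\<exists>B. \<forall>z. \<bar>h z\<bar> \<le> B" if "smooth h" "\<And>z. z \<notin> cracked a \<Longrightarrow> h z = 0" for h :: "real \<times> real \<Rightarrow> real"
    proof -
      have "bounded (h ` cbox (0, 0) (4*pi, 2*pi))"
        by (intro compact_imp_bounded compact_continuous_image smooth_continuous that) simp
      then obtain B where B: "\<And>z. z \<in> cbox (0, 0) (4*pi, 2*pi) \<Longrightarrow> \<bar>h z\<bar> \<le> B" unfolding bounded_iff by fastforce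
      have "\<bar>h z\<bar> \<le> max B 0" for z
      proof (cases "z \<in> cbox (0, 0) (4*pi, 2*pi)")
        case False
        then have "z \<notin> cracked a" by (cases z) (auto simp: cracked_iff)
        then show ?thesis using that(2) by simp
      qed (use B[of z] in auto)
      then show ?thesis by blast
    qed
    obtain B1 where B1: "\<And>z. \<bar>\<phi> z\<bar> \<le> B1" using bd[OF s\<phi> \<phi>0] by blast
    obtain B2 where B2: "\<And>z. \<bar>D z\<bar> \<le> B2" using bd[OF sD D0] by blast
    have m: "\<phi> \<in> borel_measurable borel" "D \<in> borel_measurable borel"
      by (intro borel_measurable_continuous_onI smooth_continuous s\<phi> sD)+
    have i1: "integrable lborel (\<lambda>z. ?v z * D z)"
      by (rule integrable_mult_bounded(1)[OF L2_integrable[OF L2(1)] _ B2]) (use m in auto)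
    have i2: "integrable lborel (\<lambda>z. w z * \<phi> z)"
      by (rule integrable_mult_bounded(1)[OF L2_integrable[OF w(1)] _ B1]) (use m in auto)
    have tr: "(LINT z|?L. f z * g z) = (LINT z|lborel. f z * g z)"
      if f: "L2_cracked a f" and g: "g \<in> borel_measurable borel" for f g
    proof (rule lebesgue_on_lborel(1))
      have "g \<in> borel_measurable ?L" using g by (intro measurable_restrict_space1) (simp add: measurable_completion)
      then show "(\<lambda>z. f z * g z) \<in> borel_measurable ?L" using L2_lebesgue_on(1)[OF f] by auto
    qed (use f g in \<open>auto simp: L2_cracked_def\<close>)
    have "(LINT z|lborel. frechet_derivative (\<lambda>z. ?V z * \<phi> z) (at z) b) = 0"
    proof -
      from cp obtain M where M: "\<And>z. z \<in> closure {z. \<phi> z \<noteq> 0} \<Longrightarrow> norm z \<le> M"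
        using compact_imp_bounded bounded_iff by metis
      show ?thesis
      proof (rule integral_smooth_derivative_zero[OF smooth_mult[OF sV s\<phi>] _ b, where M="M + 1"])
        fix x y assume "?V (x, y) * \<phi> (x, y) \<noteq> 0"
        then have "norm (x, y) \<le> M" using M closure_subset[of "{z. \<phi> z \<noteq> 0}"] by auto
        then show "\<bar>x\<bar> < M + 1 \<and> \<bar>y\<bar> < M + 1"
          using norm_fst_le[of x y] norm_snd_le[of y x] by auto
      qed
    qed
    moreover have "frechet_derivative (\<lambda>z. ?V z * \<phi> z) (at z) b = ?v z * D z + w z * \<phi> z" for z
    proof -
      have "((\<lambda>z. ?V z * \<phi> z) has_derivative (\<lambda>h. ?V z * frechet_derivative \<phi> (at z) h + frechet_derivative ?V (at z) h * \<phi> z)) (at z)"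
        by (rule has_derivative_mult[OF smooth_has_derivative[OF sV] smooth_has_derivative[OF s\<phi>]])
      from fun_cong[OF frechet_derivative_at[OF this], of b]
      have "frechet_derivative (\<lambda>z. ?V z * \<phi> z) (at z) b = ?V z * D z + frechet_derivative ?V (at z) b * \<phi> z"
        by (simp add: D_def)
      moreover have "?V z * D z = ?v z * D z" using D0[of z] by (simp add: on_cracked_def)
      moreover have "frechet_derivative ?V (at z) b * \<phi> z = w z * \<phi> z" using \<phi>0[of z] w(2)[of z] by (cases "z \<in> cracked a") auto
      ultimately show ?thesis by simp
    qed
    ultimately have "(LINT z|lborel. ?v z * D z) = - (LINT z|lborel. w z * \<phi> z)"
      using i1 i2 by simp
    then show ?thesis using tr[OF L2(1) m(2)] tr[OF w(1) m(1)] by (simp add: D_def)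
  qed
  have dV: "(?V has_derivative (\<lambda>h. p (fst z) * (deriv q (snd z) * snd h) + deriv p (fst z) * fst h * q (snd z))) (at z)" for z
    by (rule has_derivative_product[OF p q])
  have fV: "frechet_derivative ?V (at z) (1, 0) = deriv p (fst z) * q (snd z)"
    "frechet_derivative ?V (at z) (0, 1) = p (fst z) * deriv q (snd z)" for z
  proof -
    have "frechet_derivative ?V (at z) = (\<lambda>h. p (fst z) * (deriv q (snd z) * snd h) + deriv p (fst z) * fst h * q (snd z))"
      using frechet_derivative_at[OF dV[of z]] by simp
    then show "frechet_derivative ?V (at z) (1, 0) = deriv p (fst z) * q (snd z)"
      "frechet_derivative ?V (at z) (0, 1) = p (fst z) * deriv q (snd z)" by simp_all
  qed
  show ?thesis
    unfolding has_L2_gradient_def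
  proof (intro conjI allI impI ballI G2)
    fix \<phi> and b :: "real \<times> real" assume \<phi>: "test_function (cracked a) \<phi>" and b: "b \<in> Basis"
    from b have "b = (1, 0) \<or> b = (0, 1)" by (auto simp: Basis_prod_def)
    then show "(LINT x|?L. ?v x * frechet_derivative \<phi> (at x) b) = - (LINT x|?L. (?v1 x, ?v2 x) \<bullet> b * \<phi> x)"
    proof
      assume "b = (1, 0)"
      then show ?thesis using parts[OF \<phi> b L2(2)] fV by (simp add: on_cracked_def inner_prod_def)
    next
      assume "b = (0, 1)"
      then show ?thesis using parts[OF \<phi> b L2(3)] fV by (simp add: on_cracked_def inner_prod_def)
    qed
  qed
qed

lemma weak_grad_has_L2_gradient: "u \<in> H1 S \<Longrightarrow> has_L2_gradient S u (weak_grad S u)"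
proof -
  assume "u \<in> H1 S"
  then have "\<exists>G. has_L2_gradient S u G" by (simp add: H1_def)
  then show ?thesis unfolding weak_grad_def by (rule someI_ex)
qed

lemma H1_representative:
  assumes "u \<in> H1 (cracked a)"
    and u': "u' \<in> borel_measurable borel" "\<And>z. z \<notin> cracked a \<Longrightarrow> u' z = 0" "AE z in lebesgue_on (cracked a). u z = u' z"
  obtains g1 g2 where "sobolev a u' g1 g2" "AE z in lebesgue_on (cracked a). weak_grad (cracked a) u z = (g1 z, g2 z)"
  using sobolev_representative[OF _ weak_grad_has_L2_gradient[OF assms(1)] u'] assms(1) unfolding H1_def by blast

lemma on_cracked_H1:
  assumes p: "smooth p" and q: "smooth q" and "0 < a"
  shows "on_cracked a p q \<in> H1 (cracked a)"
    "sobolev a (on_cracked a p q) (on_cracked a (deriv p) q) (on_cracked a p (deriv q))"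
    "AE z in lebesgue_on (cracked a). weak_grad (cracked a) (on_cracked a p q) z =
      (on_cracked a (deriv p) q z, on_cracked a p (deriv q) z)"
proof -
  note c = smooth_continuous[OF p, of UNIV] smooth_continuous[OF q, of UNIV]
    smooth_continuous[OF smooth_real_deriv(2)[OF p], of UNIV] smooth_continuous[OF smooth_real_deriv(2)[OF q], of UNIV]
  note L2 = L2_on_cracked[OF c(1,2), of a] L2_on_cracked[OF c(3,2), of a] L2_on_cracked[OF c(1,4), of a]
  have b: "on_cracked a f k \<in> borel_measurable borel" "\<And>z. z \<notin> cracked a \<Longrightarrow> on_cracked a f k z = 0"
    if "L2_cracked a (on_cracked a f k)" for f k
    using that by (auto simp: L2_cracked_def)
  show H: "on_cracked a p q \<in> H1 (cracked a)"
    using on_cracked_gradient[OF p q] L2_lebesgue_on(2)[OF L2(1)] by (auto simp: H1_def)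
  show S: "sobolev a (on_cracked a p q) (on_cracked a (deriv p) q) (on_cracked a p (deriv q))"
    by (rule sobolev_of_weak_gradient[OF L2_lebesgue_on(2)[OF L2(1)] on_cracked_gradient[OF p q]])
      (use b[OF L2(1)] b[OF L2(2)] b[OF L2(3)] in auto)
  obtain g1 g2 where g: "sobolev a (on_cracked a p q) g1 g2"
    "AE z in lebesgue_on (cracked a). weak_grad (cracked a) (on_cracked a p q) z = (g1 z, g2 z)"
    using H1_representative[OF H b[OF L2(1)]] by auto
  have "AE z in lebesgue_on (cracked a). g1 z = on_cracked a (deriv p) q z" "AE z in lebesgue_on (cracked a). g2 z = on_cracked a p (deriv q) z"
    using weak_gradient_unique[OF g(1) S \<open>0 < a\<close>] by (simp_all add: AE_lborel_imp_lebesgue_on)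
  with g(2) show "AE z in lebesgue_on (cracked a). weak_grad (cracked a) (on_cracked a p q) z =
      (on_cracked a (deriv p) q z, on_cracked a p (deriv q) z)"
    by eventually_elim simp
qed

section \<open>Integration by parts up to the boundary\<close>

lemma L2_mult_bounded:
  assumes u: "L2_cracked a u" and h: "h \<in> borel_measurable borel" "\<And>z. z \<in> cracked a \<Longrightarrow> \<bar>h z\<bar> \<le> C"
  shows "integrable lborel (\<lambda>z. u z * h z)"
    "(LINT z|lborel. u z * h z)\<^sup>2 \<le> (C\<^sup>2 * (LINT z|lborel. indicator (cracked a) z)) * (LINT z|lborel. (u z)\<^sup>2)"
proof -
  define k where "k = (\<lambda>z. indicator (cracked a) z * h z)"
  have k: "k \<in> borel_measurable borel" unfolding k_def using h(1) by auto
  have kb: "(k z)\<^sup>2 \<le> C\<^sup>2 * indicator (cracked a) z" for z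
    using h(2)[of z] power_mono[of "\<bar>h z\<bar>" C 2] by (auto simp: k_def split: split_indicator)
  have ik: "integrable lborel (\<lambda>z. (k z)\<^sup>2)"
  proof (rule Bochner_Integration.integrable_bound)
    show "integrable lborel (\<lambda>z. C\<^sup>2 * indicator (cracked a) z :: real)"
      by (rule integrable_mult_right[OF integrable_indicator_cracked])
    show "AE z in lborel. norm ((k z)\<^sup>2) \<le> norm (C\<^sup>2 * indicator (cracked a) z :: real)"
      using order_trans[OF kb abs_ge_self] by (intro AE_I2) simp
  qed (use k in auto)
  have u': "u \<in> borel_measurable borel" "integrable lborel (\<lambda>z. (u z)\<^sup>2)" "\<And>z. z \<notin> cracked a \<Longrightarrow> u z = 0"
    using u by (auto simp: L2_cracked_def)
  have eq: "(\<lambda>z. u z * k z) = (\<lambda>z. u z * h z)" using u'(3) by (auto simp: k_def fun_eq_iff split: split_indicator)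
  note CS = integral_Cauchy_Schwarz[OF _ u'(2) _ ik]
  show "integrable lborel (\<lambda>z. u z * h z)" using CS(1) u'(1) k by (simp add: eq)
  have "(LINT z|lborel. u z * h z)\<^sup>2 \<le> (LINT z|lborel. (u z)\<^sup>2) * (LINT z|lborel. (k z)\<^sup>2)"
    using CS(2) u'(1) k by (simp add: eq)
  also have "\<dots> \<le> (LINT z|lborel. (u z)\<^sup>2) * (LINT z|lborel. C\<^sup>2 * indicator (cracked a) z)"
    by (intro mult_left_mono integral_mono ik integrable_mult_right integrable_indicator_cracked kb Bochner_Integration.integral_nonneg) auto
  finally show "(LINT z|lborel. u z * h z)\<^sup>2 \<le> (C\<^sup>2 * (LINT z|lborel. indicator (cracked a) z)) * (LINT z|lborel. (u z)\<^sup>2)"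
    by (simp add: mult.commute)
qed

definition locally_bounded_borel :: "(real \<Rightarrow> real) \<Rightarrow> bool" where
  "locally_bounded_borel q \<longleftrightarrow> q \<in> borel_measurable borel \<and> (\<forall>s t. \<exists>B. \<forall>x\<in>{s..t}. \<bar>q x\<bar> \<le> B)"

lemma smooth_locally_bounded:
  assumes "smooth q"
  shows "locally_bounded_borel q"
  unfolding locally_bounded_borel_def
proof (intro conjI allI smooth_measurable assms)
  fix s t
  obtain B where "\<And>x. x \<in> {s..t} \<Longrightarrow> \<bar>q x\<bar> \<le> B" using smooth_bounded_on_interval[OF assms] by blast
  then show "\<exists>B. \<forall>x\<in>{s..t}. \<bar>q x\<bar> \<le> B" by blast
qed

lemma product_bounded_on_cracked:
  assumes "locally_bounded_borel p" "locally_bounded_borel q"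
  obtains C where "(\<lambda>z. p (fst z) * q (snd z)) \<in> borel_measurable borel"
    "\<And>z. z \<in> cracked a \<Longrightarrow> \<bar>p (fst z) * q (snd z)\<bar> \<le> C"
proof -
  obtain A where A: "\<And>x. x \<in> {0..4*pi} \<Longrightarrow> \<bar>p x\<bar> \<le> A" using assms(1) unfolding locally_bounded_borel_def by blast
  obtain B where B: "\<And>x. x \<in> {0..2*pi} \<Longrightarrow> \<bar>q x\<bar> \<le> B" using assms(2) unfolding locally_bounded_borel_def by blast
  show ?thesis
  proof (rule that)
    show "(\<lambda>z. p (fst z) * q (snd z)) \<in> borel_measurable borel"
      using assms unfolding locally_bounded_borel_def by (intro borel_measurable_times fst_measurable_lborel snd_measurable_lborel) auto
    fix z assume "z \<in> cracked a"
    then have z: "fst z \<in> {0..4*pi}" "snd z \<in> {0..2*pi}" by (cases z; simp add: cracked_iff)+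
    show "\<bar>p (fst z) * q (snd z)\<bar> \<le> A * B"
      unfolding abs_mult using A[OF z(1)] B[OF z(2)] by (intro mult_mono) auto
  qed
qed

lemma L2_mult_product:
  assumes "L2_cracked a u" "locally_bounded_borel p" "locally_bounded_borel q"
  shows "integrable lborel (\<lambda>z. u z * (p (fst z) * q (snd z)))"
proof -
  obtain C where "(\<lambda>z. p (fst z) * q (snd z)) \<in> borel_measurable borel"
    "\<And>z. z \<in> cracked a \<Longrightarrow> \<bar>p (fst z) * q (snd z)\<bar> \<le> C"
    using product_bounded_on_cracked[OF assms(2,3), of a] by blast
  then show ?thesis by (rule L2_mult_bounded(1)[OF assms(1)])
qed

text \<open>The trace on the outer boundary vanishes in the weak sense. In the second formula the test
  function vanishes at height \<open>pi\<close>, so that the crack does not contribute.\<close>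

definition zero_boundary :: "real \<Rightarrow> (real \<times> real \<Rightarrow> real) \<Rightarrow> (real \<times> real \<Rightarrow> real) \<Rightarrow> (real \<times> real \<Rightarrow> real) \<Rightarrow> bool" where
  "zero_boundary a u g1 g2 \<longleftrightarrow>
     (\<forall>p q. smooth p \<and> locally_bounded_borel q \<longrightarrow>
       pairing u (deriv p) q + pairing g1 p q = 0) \<and>
     (\<forall>p q. locally_bounded_borel p \<and> smooth q \<and> q pi = 0 \<longrightarrow>
       pairing u p (deriv q) + pairing g2 p q = 0)"

lemma zero_boundary_diff:
  assumes "sobolev a u g1 g2" "sobolev a v h1 h2" and u: "zero_boundary a u g1 g2" and v: "zero_boundary a v h1 h2"
  shows "zero_boundary a (\<lambda>z. u z - c * v z) (\<lambda>z. g1 z - c * h1 z) (\<lambda>z. g2 z - c * h2 z)"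
proof -
  note L = sobolev_L2[OF assms(1)] sobolev_L2[OF assms(2)]
  have J: "(LINT z|lborel. (w z - c * w' z) * (f (fst z) * k (snd z))) =
      pairing w f k - c * pairing w' f k"
    if "L2_cracked a w" "L2_cracked a w'" "locally_bounded_borel f" "locally_bounded_borel k" for w w' f k
    using L2_mult_product[OF that(1,3,4)] L2_mult_product[OF that(2,3,4)] by (simp add: left_diff_distrib mult.assoc)
  show ?thesis
    unfolding zero_boundary_def
  proof (rule conjI; intro allI impI; elim conjE)
    fix p q :: "real \<Rightarrow> real" assume pq: "smooth p" "locally_bounded_borel q"
    note b = smooth_locally_bounded[OF pq(1)] smooth_locally_bounded[OF smooth_real_deriv(2)[OF pq(1)]]
    have "pairing u (deriv p) q + pairing g1 p q = 0"
      "pairing v (deriv p) q + pairing h1 p q = 0"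
      using u v pq unfolding zero_boundary_def by blast+
    then show "(LINT z|lborel. (u z - c * v z) * (deriv p (fst z) * q (snd z))) + (LINT z|lborel. (g1 z - c * h1 z) * (p (fst z) * q (snd z))) = 0"
      unfolding J[OF L(1,4) b(2) pq(2)] J[OF L(2,5) b(1) pq(2)]
      by (simp add: eq_neg_iff_add_eq_0[symmetric])
  next
    fix p q :: "real \<Rightarrow> real" assume pq: "locally_bounded_borel p" "smooth q" "q pi = 0"
    note b = smooth_locally_bounded[OF pq(2)] smooth_locally_bounded[OF smooth_real_deriv(2)[OF pq(2)]]
    have "pairing u p (deriv q) + pairing g2 p q = 0"
      "pairing v p (deriv q) + pairing h2 p q = 0"
      using u v pq unfolding zero_boundary_def by blast+
    then show "(LINT z|lborel. (u z - c * v z) * (p (fst z) * deriv q (snd z))) + (LINT z|lborel. (g2 z - c * h2 z) * (p (fst z) * q (snd z))) = 0"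
      unfolding J[OF L(1,4) pq(1) b(2)] J[OF L(3,6) pq(1) b(1)]
      by (simp add: eq_neg_iff_add_eq_0[symmetric])
  qed
qed

text \<open>Identifies the boundary terms of \<open>ac_on_by_parts\<close> with boundary values: two continuous functions that agree
almost everywhere on \<open>(\<alpha>, \<beta>)\<close> agree at \<open>\<alpha>\<close>. The other end may lie on the crack.\<close>

lemma ac_on_left_end:
  assumes ac: "ac_on \<alpha> \<beta> u g e" and "\<alpha> < \<beta>" and U: "continuous_on {\<alpha>..<\<beta>} U" "\<And>x. \<alpha> < x \<Longrightarrow> x < \<beta> \<Longrightarrow> u x = U x"
  shows "e = U \<alpha>"
proof -
  have g: "integrable lborel g" using ac by (simp add: ac_on_def)
  have cp: "continuous_on S (primitive g \<alpha>)" for S by (rule continuous_on_subset[OF primitive_continuous[OF g]]) simp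
  define m where "m = (\<alpha> + \<beta>) / 2"
  have m: "\<alpha> < m" "m < \<beta>" using \<open>\<alpha> < \<beta>\<close> by (auto simp: m_def)
  have ae: "AE x in lborel. x \<in> {\<alpha><..<m} \<longrightarrow> U x - (e + primitive g \<alpha> x) = 0"
  proof -
    have "AE x in lborel. \<alpha> < x \<and> x < \<beta> \<longrightarrow> u x = e + primitive g \<alpha> x" using ac by (simp add: ac_on_def)
    then show ?thesis by eventually_elim (use U(2) m in auto)
  qed
  have cU: "continuous_on {\<alpha>..m} (\<lambda>x. U x - (e + primitive g \<alpha> x))"
    using m by (intro continuous_intros cp continuous_on_subset[OF U(1)]) auto
  have eq: "U x - (e + primitive g \<alpha> x) = 0" if "x \<in> {\<alpha><..<m}" for x
    by (rule continuous_AE_imp_all[OF _ _ ae that]) (auto intro: continuous_on_subset[OF cU])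
  have "U \<alpha> - (e + primitive g \<alpha> \<alpha>) = 0"
    by (rule continuous_constant_on_closure[where S="{\<alpha><..<m}"]) (use cU m eq in auto)
  then show ?thesis by simp
qed

lemma ac_on_right_end:
  assumes ac: "ac_on \<alpha> \<beta> u g e" and "\<alpha> < \<beta>" and U: "continuous_on {\<alpha><..\<beta>} U" "\<And>x. \<alpha> < x \<Longrightarrow> x < \<beta> \<Longrightarrow> u x = U x"
  shows "e + primitive g \<alpha> \<beta> = U \<beta>"
proof -
  have g: "integrable lborel g" using ac by (simp add: ac_on_def)
  have cp: "continuous_on S (primitive g \<alpha>)" for S by (rule continuous_on_subset[OF primitive_continuous[OF g]]) simp
  define m where "m = (\<alpha> + \<beta>) / 2"
  have m: "\<alpha> < m" "m < \<beta>" using \<open>\<alpha> < \<beta>\<close> by (auto simp: m_def)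
  have ae: "AE x in lborel. x \<in> {m<..<\<beta>} \<longrightarrow> U x - (e + primitive g \<alpha> x) = 0"
  proof -
    have "AE x in lborel. \<alpha> < x \<and> x < \<beta> \<longrightarrow> u x = e + primitive g \<alpha> x" using ac by (simp add: ac_on_def)
    then show ?thesis by eventually_elim (use U(2) m in auto)
  qed
  have cU: "continuous_on {m..\<beta>} (\<lambda>x. U x - (e + primitive g \<alpha> x))"
    using m by (intro continuous_intros cp continuous_on_subset[OF U(1)]) auto
  have eq: "U x - (e + primitive g \<alpha> x) = 0" if "x \<in> {m<..<\<beta>}" for x
    by (rule continuous_AE_imp_all[OF _ _ ae that]) (auto intro: continuous_on_subset[OF cU])
  have "U \<beta> - (e + primitive g \<alpha> \<beta>) = 0"
    by (rule continuous_constant_on_closure[where S="{m<..<\<beta>}"]) (use cU m eq in auto)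
  then show ?thesis by simp
qed

lemma set_integrable_mult_smooth:
  fixes u p :: "real \<Rightarrow> real"
  assumes u: "integrable lborel u" and p: "smooth p"
  shows "set_integrable lborel {s..t} (\<lambda>x. u x * p x)"
proof -
  obtain B where B: "0 \<le> B" "\<And>x. x \<in> {s..t} \<Longrightarrow> \<bar>p x\<bar> \<le> B" using smooth_bounded_on_interval[OF p] by blast
  have "integrable lborel (\<lambda>x. u x * (indicator {s..t} x * p x))"
    by (rule integrable_mult_bounded(1)[OF u, of _ B])
      (use B smooth_measurable[OF p] in \<open>auto split: split_indicator\<close>)
  then show ?thesis by (simp add: set_integrable_def mult_ac)
qed

lemma frontier_rect: "frontier rect = {0..4*pi} \<times> {0..2*pi} - rect"
proof -
  have "open rect" unfolding rect_def by (intro open_Times) auto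
  moreover have "closure rect = {0..4*pi} \<times> {0..2*pi}"
    unfolding rect_def closure_Times by (simp add: pi_gt_zero)
  ultimately show ?thesis by (simp add: frontier_def interior_open)
qed

lemma horizontal_in_closure: "0 \<le> x \<Longrightarrow> x \<le> 4*pi \<Longrightarrow> 0 \<le> y \<Longrightarrow> y \<le> 2*pi \<Longrightarrow> y \<noteq> pi \<or> x = 0 \<or> x = 4*pi \<Longrightarrow> (x, y) \<in> cracked a \<union> frontier rect"
  unfolding frontier_rect by (auto simp: cracked_iff rect_def)

lemma product_Fubini_y:
  fixes w1 w2 :: "real \<times> real \<Rightarrow> real"
  assumes i1: "integrable lborel (\<lambda>z. w1 z * (f1 (fst z) * q (snd z)))" and i2: "integrable lborel (\<lambda>z. w2 z * (f2 (fst z) * q (snd z)))"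
  shows "pairing w1 f1 q + pairing w2 f2 q =
    (LINT y|lborel. q y * (LINT x|lborel. w1 (x, y) * f1 x + w2 (x, y) * f2 x))"
    "integrable lborel (\<lambda>y. q y * (LINT x|lborel. w1 (x, y) * f1 x + w2 (x, y) * f2 x))"
proof -
  have i: "integrable lborel (\<lambda>z. w1 z * (f1 (fst z) * q (snd z)) + w2 z * (f2 (fst z) * q (snd z)))"
    using i1 i2 by simp
  have eq: "(LINT x|lborel. w1 (x, y) * (f1 (fst (x, y)) * q (snd (x, y))) + w2 (x, y) * (f2 (fst (x, y)) * q (snd (x, y)))) =
     q y * (LINT x|lborel. w1 (x, y) * f1 x + w2 (x, y) * f2 x)" for y
    by (subst integral_mult_right_zero[symmetric]) (simp add: algebra_simps)
  show "pairing w1 f1 q + pairing w2 f2 q =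
    (LINT y|lborel. q y * (LINT x|lborel. w1 (x, y) * f1 x + w2 (x, y) * f2 x))"
    using Fubini_lborel(3)[OF i] i1 i2 unfolding eq by simp
  show "integrable lborel (\<lambda>y. q y * (LINT x|lborel. w1 (x, y) * f1 x + w2 (x, y) * f2 x))"
    using Fubini_lborel(2)[OF i] unfolding eq .
qed

lemma product_Fubini_x:
  fixes w1 w2 :: "real \<times> real \<Rightarrow> real"
  assumes i1: "integrable lborel (\<lambda>z. w1 z * (p (fst z) * f1 (snd z)))" and i2: "integrable lborel (\<lambda>z. w2 z * (p (fst z) * f2 (snd z)))"
  shows "pairing w1 p f1 + pairing w2 p f2 =
    (LINT x|lborel. p x * (LINT y|lborel. w1 (x, y) * f1 y + w2 (x, y) * f2 y))"
    "integrable lborel (\<lambda>x. p x * (LINT y|lborel. w1 (x, y) * f1 y + w2 (x, y) * f2 y))"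
proof -
  have i: "integrable lborel (\<lambda>z. w1 z * (p (fst z) * f1 (snd z)) + w2 z * (p (fst z) * f2 (snd z)))"
    using i1 i2 by simp
  have eq: "(LINT y|lborel. w1 (x, y) * (p (fst (x, y)) * f1 (snd (x, y))) + w2 (x, y) * (p (fst (x, y)) * f2 (snd (x, y)))) =
     p x * (LINT y|lborel. w1 (x, y) * f1 y + w2 (x, y) * f2 y)" for x
    by (subst integral_mult_right_zero[symmetric]) (simp add: algebra_simps)
  show "pairing w1 p f1 + pairing w2 p f2 =
    (LINT x|lborel. p x * (LINT y|lborel. w1 (x, y) * f1 y + w2 (x, y) * f2 y))"
    using Fubini_lborel'(3)[OF i] i1 i2 unfolding eq by simp
  show "integrable lborel (\<lambda>x. p x * (LINT y|lborel. w1 (x, y) * f1 y + w2 (x, y) * f2 y))"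
    using Fubini_lborel'(2)[OF i] unfolding eq .
qed

lemma L2_off: "L2_cracked a u \<Longrightarrow> \<not> (0 < x \<and> x < 4*pi \<and> 0 < y \<and> y < 2*pi) \<Longrightarrow> u (x, y) = 0"
  unfolding L2_cracked_def using cracked_iff by blast

lemma integral_eq_set_integral:
  fixes f :: "real \<Rightarrow> real"
  assumes "\<And>x. x \<notin> {s..t} \<Longrightarrow> f x = 0"
  shows "(LINT x|lborel. f x) = (LINT x:{s..t}|lborel. f x)"
  unfolding set_lebesgue_integral_def
  by (intro Bochner_Integration.integral_cong refl) (use assms in \<open>auto split: split_indicator\<close>)

text \<open>By the Cauchy-Schwarz inequality the boundary terms tend to zero along a sequence as in \<^const>\<open>zero_trace\<close>.\<close>

lemma boundary_term_le:
  assumes q: "locally_bounded_borel q" and "0 \<le> L" and h1: "continuous_on {0..L} h1" and h2: "continuous_on {0..L} h2"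
    and B: "\<And>y. y \<in> {0..L} \<Longrightarrow> \<bar>q y\<bar> \<le> B" and R: "\<And>y. y \<in> {0..L} \<Longrightarrow> R y = c1 * h1 y + c2 * h2 y"
  shows "(LINT y:{0..L}|lborel. q y * R y)\<^sup>2 \<le> (B\<^sup>2 * L * (2 * (c1\<^sup>2 + c2\<^sup>2))) * integral {0..L} (\<lambda>y. (h1 y)\<^sup>2 + (h2 y)\<^sup>2)"
proof -
  define I where "I = indicat_real {0..L}"
  define k where "k = (\<lambda>y. I y * q y)"
  define r where "r = (\<lambda>y. I y * R y)"
  have qm: "q \<in> borel_measurable borel" using q by (simp add: locally_bounded_borel_def)
  have km: "k \<in> borel_measurable lborel" unfolding k_def I_def using qm by auto
  have kb: "(k y)\<^sup>2 \<le> B\<^sup>2 * I y" for y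
    using B[of y] power_mono[of "\<bar>q y\<bar>" B 2] by (auto simp: k_def I_def split: split_indicator)
  have iI: "integrable lborel (\<lambda>y. B\<^sup>2 * I y)" by (simp add: I_def)
  have ik: "integrable lborel (\<lambda>y. (k y)\<^sup>2)"
  proof (rule Bochner_Integration.integrable_bound[OF iI])
    show "AE y in lborel. norm ((k y)\<^sup>2) \<le> norm (B\<^sup>2 * I y)"
      using order_trans[OF kb abs_ge_self] by (intro AE_I2) simp
  qed (use km in auto)
  have sR: "set_integrable lborel {0..L} R" "set_integrable lborel {0..L} (\<lambda>y. (R y)\<^sup>2)"
    by (intro set_integrable_continuous, subst continuous_on_cong[OF refl R], simp,
        intro continuous_intros h1 h2,
        intro set_integrable_continuous, subst continuous_on_cong[OF refl, where g="\<lambda>y. (c1 * h1 y + c2 * h2 y)\<^sup>2"], simp add: R,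
        intro continuous_intros h1 h2)
  have ir: "r \<in> borel_measurable lborel" "integrable lborel (\<lambda>y. (r y)\<^sup>2)"
  proof -
    show "r \<in> borel_measurable lborel"
      using borel_measurable_integrable[OF sR(1)[unfolded set_integrable_def]] by (simp add: r_def I_def)
    have "(\<lambda>y. (r y)\<^sup>2) = (\<lambda>y. indicator {0..L} y *\<^sub>R (R y)\<^sup>2)"
      by (auto simp: r_def I_def fun_eq_iff split: split_indicator)
    then show "integrable lborel (\<lambda>y. (r y)\<^sup>2)" using sR(2) by (simp add: set_integrable_def)
  qed
  have "(LINT y:{0..L}|lborel. q y * R y) = (LINT y|lborel. k y * r y)"
    unfolding set_lebesgue_integral_def
    by (intro Bochner_Integration.integral_cong) (auto simp: k_def r_def I_def split: split_indicator)
  also have "\<dots>\<^sup>2 \<le> (LINT y|lborel. (k y)\<^sup>2) * (LINT y|lborel. (r y)\<^sup>2)"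
    by (rule integral_Cauchy_Schwarz(2)[OF km ik ir])
  also have "\<dots> \<le> (B\<^sup>2 * L) * ((2 * (c1\<^sup>2 + c2\<^sup>2)) * integral {0..L} (\<lambda>y. (h1 y)\<^sup>2 + (h2 y)\<^sup>2))"
  proof (rule mult_mono)
    have "(LINT y|lborel. (k y)\<^sup>2) \<le> (LINT y|lborel. B\<^sup>2 * I y)" by (intro integral_mono ik iI kb)
    then show "(LINT y|lborel. (k y)\<^sup>2) \<le> B\<^sup>2 * L" using \<open>0 \<le> L\<close> by (simp add: I_def)
    have sh: "set_integrable lborel {0..L} (\<lambda>y. (2 * (c1\<^sup>2 + c2\<^sup>2)) * ((h1 y)\<^sup>2 + (h2 y)\<^sup>2))"
      "set_integrable lborel {0..L} (\<lambda>y. (h1 y)\<^sup>2 + (h2 y)\<^sup>2)"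
      by (intro set_integrable_continuous continuous_intros h1 h2)+
    have "(LINT y|lborel. (r y)\<^sup>2) = (LINT y:{0..L}|lborel. (R y)\<^sup>2)"
      unfolding set_lebesgue_integral_def
      by (intro Bochner_Integration.integral_cong) (auto simp: r_def I_def split: split_indicator)
    also have "\<dots> \<le> (LINT y:{0..L}|lborel. (2 * (c1\<^sup>2 + c2\<^sup>2)) * ((h1 y)\<^sup>2 + (h2 y)\<^sup>2))"
    proof (rule set_integral_mono[OF sR(2) sh(1)])
      fix y assume "y \<in> {0..L}"
      have "(c1 * h1 y + c2 * h2 y)\<^sup>2 \<le> (c1\<^sup>2 + c2\<^sup>2) * ((h1 y)\<^sup>2 + (h2 y)\<^sup>2)"
        using zero_le_power2[of "c1 * h2 y - c2 * h1 y"] by (simp add: power2_eq_square algebra_simps)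
      also have "\<dots> \<le> (2 * (c1\<^sup>2 + c2\<^sup>2)) * ((h1 y)\<^sup>2 + (h2 y)\<^sup>2)"
        by (intro mult_right_mono) auto
      finally show "(R y)\<^sup>2 \<le> (2 * (c1\<^sup>2 + c2\<^sup>2)) * ((h1 y)\<^sup>2 + (h2 y)\<^sup>2)"
        using R[OF \<open>y \<in> {0..L}\<close>] by simp
    qed
    also have "\<dots> = (2 * (c1\<^sup>2 + c2\<^sup>2)) * integral {0..L} (\<lambda>y. (h1 y)\<^sup>2 + (h2 y)\<^sup>2)"
      using set_borel_integral_eq_integral(2)[OF sh(2)] by simp
    finally show "(LINT y|lborel. (r y)\<^sup>2) \<le> (2 * (c1\<^sup>2 + c2\<^sup>2)) * integral {0..L} (\<lambda>y. (h1 y)\<^sup>2 + (h2 y)\<^sup>2)" .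
  qed (use \<open>0 \<le> L\<close> in \<open>auto intro!: Bochner_Integration.integral_nonneg\<close>)
  finally show ?thesis by (simp add: mult.assoc)
qed

lemma continuous_on_horizontal:
  assumes "continuous_on T W" "\<And>x. x \<in> A \<Longrightarrow> (x, y) \<in> T"
  shows "continuous_on A (\<lambda>x. W (x, y))"
  by (rule continuous_on_compose2[OF assms(1)]) (use assms(2) in \<open>auto intro!: continuous_intros\<close>)

lemma continuous_on_vertical:
  assumes "continuous_on T W" "\<And>y. y \<in> A \<Longrightarrow> (x, y) \<in> T"
  shows "continuous_on A (\<lambda>y. W (x, y))"
  by (rule continuous_on_compose2[OF assms(1)]) (use assms(2) in \<open>auto intro!: continuous_intros\<close>)

lemma boundary_norm2_ge:
  assumes W: "continuous_on (cracked a \<union> frontier rect) W"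
  shows "integral {0..4*pi} (\<lambda>x. (W (x, 0))\<^sup>2 + (W (x, 2*pi))\<^sup>2) \<le> boundary_norm2 W"
    "integral {0..2*pi} (\<lambda>y. (W (0, y))\<^sup>2 + (W (4*pi, y))\<^sup>2) \<le> boundary_norm2 W"
proof -
  have "0 \<le> integral {0..4*pi} (\<lambda>x. (W (x, 0))\<^sup>2 + (W (x, 2*pi))\<^sup>2)"
    by (intro integral_nonneg integrable_continuous_interval continuous_intros continuous_on_horizontal[OF W] horizontal_in_closure) auto
  moreover have "0 \<le> integral {0..2*pi} (\<lambda>y. (W (0, y))\<^sup>2 + (W (4*pi, y))\<^sup>2)"
    by (intro integral_nonneg integrable_continuous_interval continuous_intros continuous_on_vertical[OF W] horizontal_in_closure) auto
  ultimately show "integral {0..4*pi} (\<lambda>x. (W (x, 0))\<^sup>2 + (W (x, 2*pi))\<^sup>2) \<le> boundary_norm2 W"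
    "integral {0..2*pi} (\<lambda>y. (W (0, y))\<^sup>2 + (W (4*pi, y))\<^sup>2) \<le> boundary_norm2 W"
    by (simp_all add: boundary_norm2_def)
qed

lemma by_parts_x_boundary:
  assumes S: "sobolev a u g1 g2" and W: "continuous_on (cracked a \<union> frontier rect) W"
    and uW: "\<And>z. z \<in> cracked a \<Longrightarrow> u z = W z"
    and p: "smooth p" and q: "locally_bounded_borel q" and B: "\<And>y. y \<in> {0..2*pi} \<Longrightarrow> \<bar>q y\<bar> \<le> B"
  shows "(pairing u (deriv p) q + pairing g1 p q)\<^sup>2
    \<le> (B\<^sup>2 * (2*pi) * (2 * ((- p 0)\<^sup>2 + (p (4*pi))\<^sup>2))) * boundary_norm2 W"
proof -
  note L2 = sobolev_L2[OF S]
  define R where "R = (\<lambda>y. - p 0 * W (0, y) + p (4*pi) * W (4*pi, y))"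
  have cW: "continuous_on {0..2*pi} (\<lambda>y. W (0, y))" "continuous_on {0..2*pi} (\<lambda>y. W (4*pi, y))"
    by (intro continuous_on_vertical[OF W] horizontal_in_closure; simp)+
  have sR: "set_integrable lborel {0..2*pi} R"
    unfolding R_def by (intro set_integrable_continuous continuous_intros cW)
  note b = smooth_locally_bounded[OF p] smooth_locally_bounded[OF smooth_real_deriv(2)[OF p]]
  note Fu = product_Fubini_y[OF L2_mult_product[OF L2(1) b(2) q] L2_mult_product[OF L2(2) b(1) q]]
  have qm: "q \<in> borel_measurable borel" using q by (simp add: locally_bounded_borel_def)
  have ae: "AE y in lborel. q y * (LINT x|lborel. u (x, y) * deriv p x + g1 (x, y) * p x) = q y * (indicator {0..2*pi} y *\<^sub>R R y)"
  proof -
    have "AE y in lborel. y \<noteq> 0" "AE y in lborel. y \<noteq> 2*pi" "AE y in lborel. y \<noteq> pi" by (rule AE_lborel_singleton)+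
    then show ?thesis using sobolev_horizontal[OF S]
    proof eventually_elim
      case (elim y)
      show ?case
      proof (cases "0 < y \<and> y < 2*pi")
        case True
        then obtain e where e: "ac_on 0 (4*pi) (\<lambda>x. u (x, y)) (\<lambda>x. g1 (x, y)) e" using elim(4) by blast
        have c: "continuous_on {0..4*pi} (\<lambda>x. W (x, y))"
          using True elim(3) by (intro continuous_on_horizontal[OF W] horizontal_in_closure) auto
        have uW': "u (x, y) = W (x, y)" if "0 < x" "x < 4*pi" for x
          using True elim(3) that by (intro uW) (auto simp: cracked_iff)
        have l: "e = W (0, y)"
          by (rule ac_on_left_end[OF e]) (use uW' in \<open>auto intro: continuous_on_subset[OF c]\<close>)
        have r: "e + primitive (\<lambda>x. g1 (x, y)) 0 (4*pi) = W (4*pi, y)"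
          by (rule ac_on_right_end[OF e]) (use uW' in \<open>auto intro: continuous_on_subset[OF c]\<close>)
        have "(LINT x|lborel. u (x, y) * deriv p x + g1 (x, y) * p x) = (LINT x:{0..4*pi}|lborel. u (x, y) * deriv p x + g1 (x, y) * p x)"
          by (rule integral_eq_set_integral) (use L2_off[OF L2(1)] L2_off[OF L2(2)] in auto)
        also have "\<dots> = W (4*pi, y) * p (4*pi) - W (0, y) * p 0"
          using ac_on_by_parts[OF e p] l r by simp
        finally show ?thesis using True by (simp add: R_def)
      next
        case False
        then have "u (x, y) = 0" "g1 (x, y) = 0" for x
          using L2_off[OF L2(1), of x y] L2_off[OF L2(2), of x y] by blast+
        then have "(LINT x|lborel. u (x, y) * deriv p x + g1 (x, y) * p x) = 0" by simp
        moreover have "y \<notin> {0..2*pi}" using False elim(1,2) by auto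
        ultimately show ?thesis by simp
      qed
    qed
  qed
  have "(LINT y|lborel. q y * (LINT x|lborel. u (x, y) * deriv p x + g1 (x, y) * p x)) = (LINT y|lborel. q y * (indicator {0..2*pi} y *\<^sub>R R y))"
    by (rule integral_cong_AE[OF borel_measurable_integrable[OF Fu(2)] _ ae])
      (use qm borel_measurable_integrable[OF sR[unfolded set_integrable_def]] in auto)
  also have "\<dots> = (LINT y:{0..2*pi}|lborel. q y * R y)"
    by (simp add: set_lebesgue_integral_def mult.left_commute)
  finally have "(pairing u (deriv p) q + pairing g1 p q)\<^sup>2
      = (LINT y:{0..2*pi}|lborel. q y * R y)\<^sup>2" using Fu(1) by simp
  also have "\<dots> \<le> (B\<^sup>2 * (2*pi) * (2 * ((- p 0)\<^sup>2 + (p (4*pi))\<^sup>2))) * integral {0..2*pi} (\<lambda>y. (W (0, y))\<^sup>2 + (W (4*pi, y))\<^sup>2)"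
    by (rule boundary_term_le[OF q _ cW B]) (auto simp: R_def)
  also have "\<dots> \<le> (B\<^sup>2 * (2*pi) * (2 * ((- p 0)\<^sup>2 + (p (4*pi))\<^sup>2))) * boundary_norm2 W"
    by (intro mult_left_mono boundary_norm2_ge[OF W]) auto
  finally show ?thesis .
qed

text \<open>A vertical line to the left of the crack tip is split at height \<open>pi\<close>. The functions may jump there, but the
corresponding boundary terms contain the factor \<open>q pi = 0\<close>.\<close>

lemma by_parts_y_boundary:
  assumes S: "sobolev a u g1 g2" and W: "continuous_on (cracked a \<union> frontier rect) W"
    and uW: "\<And>z. z \<in> cracked a \<Longrightarrow> u z = W z"
    and q: "smooth q" "q pi = 0" and p: "locally_bounded_borel p" and B: "\<And>x. x \<in> {0..4*pi} \<Longrightarrow> \<bar>p x\<bar> \<le> B"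
  shows "(pairing u p (deriv q) + pairing g2 p q)\<^sup>2
    \<le> (B\<^sup>2 * (4*pi) * (2 * ((- q 0)\<^sup>2 + (q (2*pi))\<^sup>2))) * boundary_norm2 W"
proof -
  note L2 = sobolev_L2[OF S]
  define R where "R = (\<lambda>x. - q 0 * W (x, 0) + q (2*pi) * W (x, 2*pi))"
  have cW: "continuous_on {0..4*pi} (\<lambda>x. W (x, 0))" "continuous_on {0..4*pi} (\<lambda>x. W (x, 2*pi))"
    by (intro continuous_on_horizontal[OF W] horizontal_in_closure; simp)+
  have sR: "set_integrable lborel {0..4*pi} R"
    unfolding R_def by (intro set_integrable_continuous continuous_intros cW)
  note b = smooth_locally_bounded[OF q(1)] smooth_locally_bounded[OF smooth_real_deriv(2)[OF q(1)]]
  note Fu = product_Fubini_x[OF L2_mult_product[OF L2(1) p b(2)] L2_mult_product[OF L2(3) p b(1)]]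
  have pm: "p \<in> borel_measurable borel" using p by (simp add: locally_bounded_borel_def)
  have ae: "AE x in lborel. p x * (LINT y|lborel. u (x, y) * deriv q y + g2 (x, y) * q y) = p x * (indicator {0..4*pi} x *\<^sub>R R x)"
  proof -
    have "AE x in lborel. x \<noteq> 0" "AE x in lborel. x \<noteq> 4*pi" by (rule AE_lborel_singleton)+
    moreover have "AE x in lborel. 0 < x \<and> x < 4*pi \<longrightarrow> (\<exists>e. ac_on 0 pi (\<lambda>y. u (x, y)) (\<lambda>y. g2 (x, y)) e)"
      "AE x in lborel. 0 < x \<and> x < 4*pi \<longrightarrow> (\<exists>e. ac_on pi (2*pi) (\<lambda>y. u (x, y)) (\<lambda>y. g2 (x, y)) e)"
      by (rule sobolev_vertical[OF S]; simp)+
    ultimately show ?thesis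
    proof eventually_elim
      case (elim x)
      show ?case
      proof (cases "0 < x \<and> x < 4*pi")
        case True
        then obtain e e' where e: "ac_on 0 pi (\<lambda>y. u (x, y)) (\<lambda>y. g2 (x, y)) e" and e': "ac_on pi (2*pi) (\<lambda>y. u (x, y)) (\<lambda>y. g2 (x, y)) e'"
          using elim(3,4) by blast
        have in_cl: "(x, y) \<in> cracked a \<union> frontier rect" if "0 \<le> y" "y \<le> 2*pi" "y \<noteq> pi" for y
          using that True by (intro horizontal_in_closure) auto
        have uW': "u (x, y) = W (x, y)" if "0 < y" "y < 2*pi" "y \<noteq> pi" for y
          using True that by (intro uW) (auto simp: cracked_iff)
        have l: "e = W (x, 0)"
        proof (rule ac_on_left_end[OF e])
          show "continuous_on {0..<pi} (\<lambda>y. W (x, y))" by (intro continuous_on_vertical[OF W] in_cl) auto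
        qed (use uW' in auto)
        have r: "e' + primitive (\<lambda>y. g2 (x, y)) pi (2*pi) = W (x, 2*pi)"
        proof (rule ac_on_right_end[OF e'])
          show "continuous_on {pi<..2*pi} (\<lambda>y. W (x, y))" by (intro continuous_on_vertical[OF W] in_cl) auto
        qed (use uW' in auto)
        have iu: "integrable lborel (\<lambda>y. u (x, y))" and ig: "integrable lborel (\<lambda>y. g2 (x, y))" using e by (auto simp: ac_on_def)
        have si: "set_integrable lborel {0..2*pi} (\<lambda>y. u (x, y) * deriv q y + g2 (x, y) * q y)"
          by (intro set_integral_add(1) set_integrable_mult_smooth iu ig q smooth_real_deriv)
        have "(LINT y|lborel. u (x, y) * deriv q y + g2 (x, y) * q y) = (LINT y:{0..2*pi}|lborel. u (x, y) * deriv q y + g2 (x, y) * q y)"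
          by (rule integral_eq_set_integral) (use L2_off[OF L2(1)] L2_off[OF L2(3)] in auto)
        also have "\<dots> = (LINT y:{0..pi}|lborel. u (x, y) * deriv q y + g2 (x, y) * q y) + (LINT y:{pi..2*pi}|lborel. u (x, y) * deriv q y + g2 (x, y) * q y)"
          by (rule set_integral_split[OF si]) auto
        also have "\<dots> = W (x, 2*pi) * q (2*pi) - W (x, 0) * q 0"
          using ac_on_by_parts[OF e q(1)] ac_on_by_parts[OF e' q(1)] l r q(2) by simp
        finally show ?thesis using True by (simp add: R_def)
      next
        case False
        then have "u (x, y) = 0" "g2 (x, y) = 0" for y
          using L2_off[OF L2(1), of x y] L2_off[OF L2(3), of x y] by blast+
        then have "(LINT y|lborel. u (x, y) * deriv q y + g2 (x, y) * q y) = 0" by simp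
        moreover have "x \<notin> {0..4*pi}" using False elim(1,2) by auto
        ultimately show ?thesis by simp
      qed
    qed
  qed
  have "(LINT x|lborel. p x * (LINT y|lborel. u (x, y) * deriv q y + g2 (x, y) * q y)) = (LINT x|lborel. p x * (indicator {0..4*pi} x *\<^sub>R R x))"
    by (rule integral_cong_AE[OF borel_measurable_integrable[OF Fu(2)] _ ae])
      (use pm borel_measurable_integrable[OF sR[unfolded set_integrable_def]] in auto)
  also have "\<dots> = (LINT x:{0..4*pi}|lborel. p x * R x)"
    by (simp add: set_lebesgue_integral_def mult.left_commute)
  finally have "(pairing u p (deriv q) + pairing g2 p q)\<^sup>2
      = (LINT x:{0..4*pi}|lborel. p x * R x)\<^sup>2" using Fu(1) by simp
  also have "\<dots> \<le> (B\<^sup>2 * (4*pi) * (2 * ((- q 0)\<^sup>2 + (q (2*pi))\<^sup>2))) * integral {0..4*pi} (\<lambda>x. (W (x, 0))\<^sup>2 + (W (x, 2*pi))\<^sup>2)"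
    by (rule boundary_term_le[OF p _ cW B]) (auto simp: R_def)
  also have "\<dots> \<le> (B\<^sup>2 * (4*pi) * (2 * ((- q 0)\<^sup>2 + (q (2*pi))\<^sup>2))) * boundary_norm2 W"
    by (intro mult_left_mono boundary_norm2_ge[OF W]) auto
  finally show ?thesis .
qed

lemma tendsto_0_if_square_le:
  fixes x y :: "nat \<Rightarrow> real"
  assumes "\<And>n. (x n)\<^sup>2 \<le> K * y n" "y \<longlonglongrightarrow> 0"
  shows "x \<longlonglongrightarrow> 0"
proof -
  have "(\<lambda>n. (x n)\<^sup>2) \<longlonglongrightarrow> 0"
    by (rule tendsto_sandwich[of "\<lambda>n. 0" _ _ "\<lambda>n. K * y n"]) (use assms tendsto_mult_right_zero in auto)
  then have "(\<lambda>n. sqrt ((x n)\<^sup>2)) \<longlonglongrightarrow> sqrt 0" by (rule tendsto_real_sqrt)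
  then show ?thesis by (simp add: tendsto_rabs_zero_iff)
qed

text \<open>Both sides of the formulas are continuous with respect to \<^const>\<open>H1_dist2\<close>, so they pass to the limit of the
approximating functions, whose boundary terms tend to zero.\<close>

lemma zero_boundary_if_zero_trace:
  assumes H: "u \<in> H1 (cracked a)" and zt: "zero_trace a u"
    and u': "u' \<in> borel_measurable borel" "\<And>z. z \<notin> cracked a \<Longrightarrow> u' z = 0" "AE z in lebesgue_on (cracked a). u z = u' z"
    and S: "sobolev a u' g1 g2" and g: "AE z in lebesgue_on (cracked a). weak_grad (cracked a) u z = (g1 z, g2 z)"
  shows "zero_boundary a u' g1 g2"
proof -
  let ?L = "lebesgue_on (cracked a)"
  obtain w where w: "\<And>n. w n \<in> H1 (cracked a)" "\<And>n. continuous_on (cracked a \<union> frontier rect) (w n)"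
    and dist: "(\<lambda>n. H1_dist2 (cracked a) u (w n)) \<longlonglongrightarrow> 0" and bd: "(\<lambda>n. boundary_norm2 (w n)) \<longlonglongrightarrow> 0"
    using zt unfolding zero_trace_def by blast
  define v where "v = (\<lambda>n z. if z \<in> cracked a then w n z else 0)"
  have vm: "v n \<in> borel_measurable borel" for n
  proof (rule borel_measurable_continuous_on_cracked)
    show "continuous_on (cracked a) (v n)"
      by (rule continuous_on_eq[OF continuous_on_subset[OF w(2)[of n]]]) (auto simp: v_def)
  qed (auto simp: v_def)
  have vAE: "AE z in ?L. w n z = v n z" for n by (rule AE_I2) (simp add: v_def space_restrict_space)
  have "\<exists>h. sobolev a (v n) (fst h) (snd h) \<and> (AE z in ?L. weak_grad (cracked a) (w n) z = (fst h z, snd h z))" for n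
  proof -
    obtain h1 h2 where "sobolev a (v n) h1 h2" "AE z in ?L. weak_grad (cracked a) (w n) z = (h1 z, h2 z)"
      by (rule H1_representative[OF w(1) vm _ vAE]) (auto simp: v_def)
    then show ?thesis by (intro exI[of _ "(h1, h2)"]) simp
  qed
  then have "\<forall>n. \<exists>h. sobolev a (v n) (fst h) (snd h) \<and> (AE z in ?L. weak_grad (cracked a) (w n) z = (fst h z, snd h z))" by blast
  from choice[OF this] obtain h where h: "\<And>n. sobolev a (v n) (fst (h n)) (snd (h n))"
    "\<And>n. AE z in ?L. weak_grad (cracked a) (w n) z = (fst (h n) z, snd (h n) z)" by blast
  note L2 = sobolev_L2[OF S] and L2h = sobolev_L2[OF h(1)]
  have d: "L2_cracked a (\<lambda>z. u' z - v n z)" "L2_cracked a (\<lambda>z. g1 z - fst (h n) z)"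
    "L2_cracked a (\<lambda>z. g2 z - snd (h n) z)" for n
    using L2_diff[OF L2(1) L2h(1), of 1 n] L2_diff[OF L2(2) L2h(2), of 1 n] L2_diff[OF L2(3) L2h(3), of 1 n] by simp_all
  have dd: "H1_dist2 (cracked a) u (w n) = (LINT z|lborel. (u' z - v n z)\<^sup>2) +
      ((LINT z|lborel. (g1 z - fst (h n) z)\<^sup>2) + (LINT z|lborel. (g2 z - snd (h n) z)\<^sup>2))" for n
  proof -
    have um: "u \<in> borel_measurable ?L" "w n \<in> borel_measurable ?L"
      using H w(1)[of n] by (auto simp: H1_def square_integrable_def)
    have gm: "weak_grad (cracked a) u \<in> borel_measurable ?L" "weak_grad (cracked a) (w n) \<in> borel_measurable ?L"
      using weak_grad_has_L2_gradient[OF H] weak_grad_has_L2_gradient[OF w(1)[of n]]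
      by (auto simp: has_L2_gradient_def square_integrable_def)
    have "(LINT z|?L. (u z - w n z)\<^sup>2) = (LINT z|lborel. (u' z - v n z)\<^sup>2)"
    proof (rule lebesgue_on_lborel(1))
      show "AE z in ?L. (u z - w n z)\<^sup>2 = (u' z - v n z)\<^sup>2" using u'(3) vAE[of n] by eventually_elim simp
    qed (use d(1)[of n] um in \<open>auto simp: L2_cracked_def\<close>)
    moreover have "(LINT z|?L. (norm (weak_grad (cracked a) u z - weak_grad (cracked a) (w n) z))\<^sup>2)
        = (LINT z|lborel. (g1 z - fst (h n) z)\<^sup>2 + (g2 z - snd (h n) z)\<^sup>2)"
    proof (rule lebesgue_on_lborel(1))
      show "AE z in ?L. (norm (weak_grad (cracked a) u z - weak_grad (cracked a) (w n) z))\<^sup>2 = (g1 z - fst (h n) z)\<^sup>2 + (g2 z - snd (h n) z)\<^sup>2"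
        using g h(2)[of n] by eventually_elim (simp add: norm_prod_def)
      show "(\<lambda>z. (norm (weak_grad (cracked a) u z - weak_grad (cracked a) (w n) z))\<^sup>2) \<in> borel_measurable ?L"
        using measurable_compose[OF borel_measurable_diff[OF gm] borel_measurable_norm]
        by (intro borel_measurable_power) simp
    qed (use d(2,3)[of n] in \<open>auto simp: L2_cracked_def\<close>)
    moreover have "(LINT z|lborel. (g1 z - fst (h n) z)\<^sup>2 + (g2 z - snd (h n) z)\<^sup>2) =
        (LINT z|lborel. (g1 z - fst (h n) z)\<^sup>2) + (LINT z|lborel. (g2 z - snd (h n) z)\<^sup>2)"
      using d(2,3)[of n] by (intro Bochner_Integration.integral_add) (auto simp: L2_cracked_def)
    ultimately show ?thesis by (simp add: H1_dist2_def)
  qed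
  have nn: "0 \<le> (LINT z|lborel. (f z)\<^sup>2)" for f :: "real \<times> real \<Rightarrow> real"
    by (rule Bochner_Integration.integral_nonneg) simp
  have le: "(LINT z|lborel. (u' z - v n z)\<^sup>2) \<le> H1_dist2 (cracked a) u (w n)"
    "(LINT z|lborel. (g1 z - fst (h n) z)\<^sup>2) \<le> H1_dist2 (cracked a) u (w n)"
    "(LINT z|lborel. (g2 z - snd (h n) z)\<^sup>2) \<le> H1_dist2 (cracked a) u (w n)" for n
    using nn[of "\<lambda>z. u' z - v n z"] nn[of "\<lambda>z. g1 z - fst (h n) z"] nn[of "\<lambda>z. g2 z - snd (h n) z"]
    unfolding dd by linarith+
  have lim: "(\<lambda>n. LINT z|lborel. (u' z - v n z) * k z) \<longlonglongrightarrow> 0" "(\<lambda>n. LINT z|lborel. (g1 z - fst (h n) z) * k z) \<longlonglongrightarrow> 0"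
    "(\<lambda>n. LINT z|lborel. (g2 z - snd (h n) z) * k z) \<longlonglongrightarrow> 0"
    if k: "k \<in> borel_measurable borel" "\<And>z. z \<in> cracked a \<Longrightarrow> \<bar>k z\<bar> \<le> C" for k C
  proof -
    let ?K = "C\<^sup>2 * (LINT z|lborel. indicator (cracked a) z)"
    have K: "0 \<le> ?K" by (intro mult_nonneg_nonneg Bochner_Integration.integral_nonneg) auto
    show "(\<lambda>n. LINT z|lborel. (u' z - v n z) * k z) \<longlonglongrightarrow> 0"
      by (rule tendsto_0_if_square_le[OF order_trans[OF L2_mult_bounded(2)[OF d(1) k] mult_left_mono[OF le(1) K]] dist])
    show "(\<lambda>n. LINT z|lborel. (g1 z - fst (h n) z) * k z) \<longlonglongrightarrow> 0"
      by (rule tendsto_0_if_square_le[OF order_trans[OF L2_mult_bounded(2)[OF d(2) k] mult_left_mono[OF le(2) K]] dist])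
    show "(\<lambda>n. LINT z|lborel. (g2 z - snd (h n) z) * k z) \<longlonglongrightarrow> 0"
      by (rule tendsto_0_if_square_le[OF order_trans[OF L2_mult_bounded(2)[OF d(3) k] mult_left_mono[OF le(3) K]] dist])
  qed
  have vw: "z \<in> cracked a \<Longrightarrow> v n z = w n z" for n z by (simp add: v_def)
  show ?thesis
    unfolding zero_boundary_def
  proof (rule conjI; intro allI impI; elim conjE)
    fix p q :: "real \<Rightarrow> real" assume pq: "smooth p" "locally_bounded_borel q"
    note b = smooth_locally_bounded[OF pq(1)] smooth_locally_bounded[OF smooth_real_deriv(2)[OF pq(1)]]
    obtain B where B: "\<And>y. y \<in> {0..2*pi} \<Longrightarrow> \<bar>q y\<bar> \<le> B" using pq(2) unfolding locally_bounded_borel_def by blast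
    obtain C1 where C1: "(\<lambda>z. deriv p (fst z) * q (snd z)) \<in> borel_measurable borel" "\<And>z. z \<in> cracked a \<Longrightarrow> \<bar>deriv p (fst z) * q (snd z)\<bar> \<le> C1"
      using product_bounded_on_cracked[OF b(2) pq(2), of a] by blast
    obtain C2 where C2: "(\<lambda>z. p (fst z) * q (snd z)) \<in> borel_measurable borel" "\<And>z. z \<in> cracked a \<Longrightarrow> \<bar>p (fst z) * q (snd z)\<bar> \<le> C2"
      using product_bounded_on_cracked[OF b(1) pq(2), of a] by blast
    define I where "I = (\<lambda>n. pairing (v n) (deriv p) q + pairing (fst (h n)) p q)"
    let ?I = "pairing u' (deriv p) q + pairing g1 p q"
    have "I \<longlonglongrightarrow> 0"
      unfolding I_def by (rule tendsto_0_if_square_le[OF by_parts_x_boundary[OF h(1) w(2) vw pq B] bd])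
    moreover have "(LINT z|lborel. (u' z - v n z) * (deriv p (fst z) * q (snd z))) + (LINT z|lborel. (g1 z - fst (h n) z) * (p (fst z) * q (snd z))) = ?I - I n" for n
      using L2_mult_product[OF L2(1) b(2) pq(2)] L2_mult_product[OF L2(2) b(1) pq(2)]
        L2_mult_product[OF L2h(1)[of n] b(2) pq(2)] L2_mult_product[OF L2h(2)[of n] b(1) pq(2)]
      by (simp add: I_def left_diff_distrib)
    then have "(\<lambda>n. ?I - I n) \<longlonglongrightarrow> 0 + 0" using tendsto_add[OF lim(1)[OF C1] lim(2)[OF C2]] by simp
    ultimately have "(\<lambda>n. (?I - I n) + I n) \<longlonglongrightarrow> 0 + 0 + 0" by (rule tendsto_add[rotated])
    then show "?I = 0" by (simp add: LIMSEQ_const_iff)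
  next
    fix p q :: "real \<Rightarrow> real" assume pq: "locally_bounded_borel p" "smooth q" "q pi = 0"
    note b = smooth_locally_bounded[OF pq(2)] smooth_locally_bounded[OF smooth_real_deriv(2)[OF pq(2)]]
    obtain B where B: "\<And>x. x \<in> {0..4*pi} \<Longrightarrow> \<bar>p x\<bar> \<le> B" using pq(1) unfolding locally_bounded_borel_def by blast
    obtain C1 where C1: "(\<lambda>z. p (fst z) * deriv q (snd z)) \<in> borel_measurable borel" "\<And>z. z \<in> cracked a \<Longrightarrow> \<bar>p (fst z) * deriv q (snd z)\<bar> \<le> C1"
      using product_bounded_on_cracked[OF pq(1) b(2), of a] by blast
    obtain C2 where C2: "(\<lambda>z. p (fst z) * q (snd z)) \<in> borel_measurable borel" "\<And>z. z \<in> cracked a \<Longrightarrow> \<bar>p (fst z) * q (snd z)\<bar> \<le> C2"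
      using product_bounded_on_cracked[OF pq(1) b(1), of a] by blast
    define I where "I = (\<lambda>n. pairing (v n) p (deriv q) + pairing (snd (h n)) p q)"
    let ?I = "pairing u' p (deriv q) + pairing g2 p q"
    have "I \<longlonglongrightarrow> 0"
      unfolding I_def by (rule tendsto_0_if_square_le[OF by_parts_y_boundary[OF h(1) w(2) vw pq(2,3,1) B] bd])
    moreover have "(LINT z|lborel. (u' z - v n z) * (p (fst z) * deriv q (snd z))) + (LINT z|lborel. (g2 z - snd (h n) z) * (p (fst z) * q (snd z))) = ?I - I n" for n
      using L2_mult_product[OF L2(1) pq(1) b(2)] L2_mult_product[OF L2(3) pq(1) b(1)]
        L2_mult_product[OF L2h(1)[of n] pq(1) b(2)] L2_mult_product[OF L2h(3)[of n] pq(1) b(1)]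
      by (simp add: I_def left_diff_distrib)
    then have "(\<lambda>n. ?I - I n) \<longlonglongrightarrow> 0 + 0" using tendsto_add[OF lim(1)[OF C1] lim(3)[OF C2]] by simp
    ultimately have "(\<lambda>n. (?I - I n) + I n) \<longlonglongrightarrow> 0 + 0 + 0" by (rule tendsto_add[rotated])
    then show "?I = 0" by (simp add: LIMSEQ_const_iff)
  qed
qed

section \<open>Explicit modes\<close>

lemma smooth_power: "smooth f \<Longrightarrow> smooth (\<lambda>x. f x ^ n)"
  by (induction n) (auto intro: smooth_mult)

definition cos_mode :: "nat \<Rightarrow> real \<Rightarrow> real" where
  "cos_mode k x = cos (x / 4) ^ k"

definition sin_mode :: "nat \<Rightarrow> real \<Rightarrow> real" where
  "sin_mode k x = sin (x / 4) * cos (x / 4) ^ k"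

lemma smooth_cos_sin:
  "smooth (\<lambda>x::real. cos (x / c))" "smooth (\<lambda>x::real. sin (x / c))"
  using smooth_trig[of 1 "1 / c" 0] smooth_trig[of 0 "1 / c" 1] by simp_all

lemma smooth_modes: "smooth (cos_mode k)" "smooth (sin_mode k)"
  unfolding cos_mode_def[abs_def] sin_mode_def[abs_def]
  by (rule smooth_power[OF smooth_cos_sin(1)], rule smooth_mult[OF smooth_cos_sin(2) smooth_power[OF smooth_cos_sin(1)]])

lemma cos_mode_derivative:
  "(cos_mode k has_real_derivative - (real k / 4) * sin_mode (k - 1) x) (at x)"
  unfolding cos_mode_def[abs_def] sin_mode_def
  by (rule derivative_eq_intros refl | simp)+

lemma sin_mode_derivative:
  "(sin_mode k has_real_derivative (real k + 1) / 4 * cos_mode (k + 1) x - real k / 4 * cos_mode (k - 1) x) (at x)"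
proof -
  have s2: "sin (x / 4) * sin (x / 4) = 1 - cos (x / 4) * cos (x / 4)"
    using sin_cos_squared_add[of "x / 4"] by (simp add: power2_eq_square)
  have d: "(sin_mode k has_real_derivative sin (x / 4) * (real k * cos (x / 4) ^ (k - 1) * (- (sin (x / 4) / 4))) + cos (x / 4) / 4 * cos (x / 4) ^ k) (at x)"
    unfolding sin_mode_def[abs_def]
    by (rule derivative_eq_intros refl | simp)+
  have "sin (x / 4) * (real k * cos (x / 4) ^ (k - 1) * (- (sin (x / 4) / 4))) + cos (x / 4) / 4 * cos (x / 4) ^ k
      = - (real k / 4) * cos (x / 4) ^ (k - 1) * (sin (x / 4) * sin (x / 4)) + cos (x / 4) ^ (k + 1) / 4"
    by (simp add: algebra_simps)
  also have "\<dots> = (real k + 1) / 4 * cos_mode (k + 1) x - real k / 4 * cos_mode (k - 1) x"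
    unfolding s2 cos_mode_def by (cases k) (auto simp: field_simps)
  finally show ?thesis using d by simp
qed

text \<open>The modes are \<open>cos (x / 4) ^ k\<close>, respectively \<open>sin (x / 4) * cos (x / 4) ^ k * sin (y / 2)\<close>.
  For \<open>k < 2\<close> they are eigenfunctions; in general \<open>- \<Delta>\<close> maps the \<open>k\<close>-th mode to
  a combination of itself and of mode number \<open>k - 2\<close>.\<close>

fun mode_x :: "boundary_condition \<Rightarrow> nat \<Rightarrow> real \<Rightarrow> real" where
  "mode_x Dirichlet k = sin_mode k"
| "mode_x Neumann k = cos_mode k"

fun mode_y :: "boundary_condition \<Rightarrow> real \<Rightarrow> real" where
  "mode_y Dirichlet = (\<lambda>y. sin (y / 2))"
| "mode_y Neumann = (\<lambda>y. 1)"

fun mode_energy :: "boundary_condition \<Rightarrow> nat \<Rightarrow> real" where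
  "mode_energy Dirichlet k = (real k + 1)\<^sup>2 / 16 + 1 / 4"
| "mode_energy Neumann k = (real k)\<^sup>2 / 16"

definition mode :: "boundary_condition \<Rightarrow> real \<Rightarrow> nat \<Rightarrow> real \<times> real \<Rightarrow> real" where
  "mode bc a k = on_cracked a (mode_x bc k) (mode_y bc)"

text \<open>The coefficient of mode \<open>k - 2\<close> in the image of mode \<open>k\<close> under \<open>\<Delta>\<close>. It vanishes for \<open>k < 2\<close>, where
\<open>k - 2\<close> is truncated to 0.\<close>

definition coupling :: "nat \<Rightarrow> real" where
  "coupling k = real k * (real k - 1) / 16"

lemma smooth_mode: "smooth (mode_x bc k)" "smooth (mode_y bc)"
  by (cases bc; simp add: smooth_modes smooth_cos_sin)+

lemma deriv_cos_mode: "deriv (cos_mode k) = (\<lambda>x. - (real k / 4) * sin_mode (k - 1) x)"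
  and deriv_sin_mode: "deriv (sin_mode k) = (\<lambda>x. (real k + 1) / 4 * cos_mode (k + 1) x - real k / 4 * cos_mode (k - 1) x)"
  using DERIV_imp_deriv[OF cos_mode_derivative] DERIV_imp_deriv[OF sin_mode_derivative] by (auto simp: fun_eq_iff)

lemma deriv2_cos_mode:
  "deriv (deriv (cos_mode k)) x = - ((real k)\<^sup>2 / 16) * cos_mode k x + coupling k * cos_mode (k - 2) x"
proof -
  have "deriv (\<lambda>x. - (real k / 4) * sin_mode (k - 1) x) x =
      - (real k / 4) * ((real (k - 1) + 1) / 4 * cos_mode (k - 1 + 1) x - real (k - 1) / 4 * cos_mode (k - 1 - 1) x)"
    by (rule DERIV_imp_deriv[OF DERIV_cmult[OF sin_mode_derivative]])
  also have "\<dots> = - ((real k)\<^sup>2 / 16) * cos_mode k x + coupling k * cos_mode (k - 2) x"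
    by (cases k) (auto simp: coupling_def power2_eq_square field_simps numeral_2_eq_2)
  finally show ?thesis by (simp add: deriv_cos_mode)
qed

lemma deriv2_sin_mode:
  "deriv (deriv (sin_mode k)) x = - ((real k + 1)\<^sup>2 / 16) * sin_mode k x + coupling k * sin_mode (k - 2) x"
proof -
  have "deriv (\<lambda>x. (real k + 1) / 4 * cos_mode (k + 1) x - real k / 4 * cos_mode (k - 1) x) x =
      (real k + 1) / 4 * (- (real (k + 1) / 4) * sin_mode (k + 1 - 1) x) - real k / 4 * (- (real (k - 1) / 4) * sin_mode (k - 1 - 1) x)"
    by (rule DERIV_imp_deriv[OF DERIV_diff[OF DERIV_cmult[OF cos_mode_derivative] DERIV_cmult[OF cos_mode_derivative]]])
  also have "\<dots> = - ((real k + 1)\<^sup>2 / 16) * sin_mode k x + coupling k * sin_mode (k - 2) x"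
    by (cases k) (auto simp: coupling_def power2_eq_square field_simps numeral_2_eq_2)
  finally show ?thesis by (simp add: deriv_sin_mode)
qed

lemma deriv_half_angle:
  "deriv (\<lambda>y::real. sin (y / 2)) = (\<lambda>y. cos (y / 2) / 2)"
  "deriv (\<lambda>y::real. cos (y / 2)) = (\<lambda>y. - sin (y / 2) / 2)"
  "deriv (\<lambda>y::real. cos (y / 2) / 2) = (\<lambda>y. - sin (y / 2) / 4)"
  by (rule ext, rule DERIV_imp_deriv, (rule derivative_eq_intros refl | simp)+)+

section \<open>Admissible functions and the weak equation\<close>

text \<open>Elements of the form domain together with their gradients, in a form which is visibly closed under
linear combinations.\<close>

definition admissible :: "boundary_condition \<Rightarrow> real \<Rightarrow> (real \<times> real \<Rightarrow> real) \<Rightarrow> (real \<times> real \<Rightarrow> real) \<Rightarrow> (real \<times> real \<Rightarrow> real) \<Rightarrow> bool" where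
  "admissible bc a u g1 g2 \<longleftrightarrow> sobolev a u g1 g2 \<and> (bc = Dirichlet \<longrightarrow> zero_boundary a u g1 g2)"

lemma admissible_diff:
  "admissible bc a u g1 g2 \<Longrightarrow> admissible bc a v h1 h2 \<Longrightarrow>
    admissible bc a (\<lambda>z. u z - c * v z) (\<lambda>z. g1 z - c * h1 z) (\<lambda>z. g2 z - c * h2 z)"
  unfolding admissible_def using sobolev_diff zero_boundary_diff by blast

text \<open>In the Neumann case there is no information on boundary values, but the derivative of a mode in \<open>x\<close>
vanishes at both ends, so that the boundary terms disappear.\<close>

lemma by_parts_x_vanishing:
  assumes S: "sobolev a u g1 g2" and p: "smooth p" "p 0 = 0" "p (4*pi) = 0" and q: "locally_bounded_borel q"
  shows "pairing u (deriv p) q + pairing g1 p q = 0"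
proof -
  note L2 = sobolev_L2[OF S]
  note b = smooth_locally_bounded[OF p(1)] smooth_locally_bounded[OF smooth_real_deriv(2)[OF p(1)]]
  note Fu = product_Fubini_y[OF L2_mult_product[OF L2(1) b(2) q] L2_mult_product[OF L2(2) b(1) q]]
  have "AE y in lborel. q y * (LINT x|lborel. u (x, y) * deriv p x + g1 (x, y) * p x) = 0"
    using sobolev_horizontal[OF S]
  proof eventually_elim
    case (elim y)
    show ?case
    proof (cases "0 < y \<and> y < 2*pi")
      case True
      then obtain e where e: "ac_on 0 (4*pi) (\<lambda>x. u (x, y)) (\<lambda>x. g1 (x, y)) e" using elim by blast
      have "(LINT x|lborel. u (x, y) * deriv p x + g1 (x, y) * p x) = (LINT x:{0..4*pi}|lborel. u (x, y) * deriv p x + g1 (x, y) * p x)"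
        by (rule integral_eq_set_integral) (use L2_off[OF L2(1)] L2_off[OF L2(2)] in auto)
      then show ?thesis using ac_on_by_parts[OF e p(1)] p(2,3) by simp
    next
      case False
      then have "u (x, y) = 0" "g1 (x, y) = 0" for x
        using L2_off[OF L2(1), of x y] L2_off[OF L2(2), of x y] by blast+
      then show ?thesis by simp
    qed
  qed
  then have "(LINT y|lborel. q y * (LINT x|lborel. u (x, y) * deriv p x + g1 (x, y) * p x)) = 0"
    by (rule integral_eq_zero_AE)
  then show ?thesis using Fu(1) by simp
qed

lemma L2_times_on_cracked:
  "L2_cracked a u \<Longrightarrow> u z * on_cracked a p q z = u z * (p (fst z) * q (snd z))"
proof -
  assume "L2_cracked a u"
  then have "z \<notin> cracked a \<Longrightarrow> u z = 0" unfolding L2_cracked_def by blast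
  then show ?thesis by (cases "z \<in> cracked a") (simp_all add: on_cracked_def)
qed

definition gradient_product :: "(real \<times> real \<Rightarrow> real) \<Rightarrow> (real \<times> real \<Rightarrow> real) \<Rightarrow> (real \<times> real \<Rightarrow> real) \<Rightarrow> (real \<times> real \<Rightarrow> real) \<Rightarrow> real" where
  "gradient_product g1 g2 h1 h2 = (LINT z|lborel. g1 z * h1 z) + (LINT z|lborel. g2 z * h2 z)"

abbreviation mode_dx :: "boundary_condition \<Rightarrow> real \<Rightarrow> nat \<Rightarrow> real \<times> real \<Rightarrow> real" where
  "mode_dx bc a k \<equiv> on_cracked a (deriv (mode_x bc k)) (mode_y bc)"

abbreviation mode_dy :: "boundary_condition \<Rightarrow> real \<Rightarrow> nat \<Rightarrow> real \<times> real \<Rightarrow> real" where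
  "mode_dy bc a k \<equiv> on_cracked a (mode_x bc k) (deriv (mode_y bc))"

text \<open>Green's formula for a mode. In the Dirichlet case the factor \<open>cos (y / 2)\<close> of its derivative in \<open>y\<close> vanishes at
height \<open>pi\<close>, which is the Neumann condition on the crack.\<close>

lemma mode_weak_equation:
  assumes A: "admissible bc a w g1 g2"
  shows "gradient_product g1 g2 (mode_dx bc a k) (mode_dy bc a k) =
    mode_energy bc k * (LINT z|lborel. w z * mode bc a k z) - coupling k * (LINT z|lborel. w z * mode bc a (k - 2) z)"
proof -
  have S: "sobolev a w g1 g2" using A by (simp add: admissible_def)
  note L2 = sobolev_L2[OF S]
  note sm = smooth_mode(1)[of bc] smooth_mode(2)[of bc]
  note lb = smooth_locally_bounded[OF sm(1)] smooth_locally_bounded[OF sm(2)]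
  note I = L2_mult_product[OF L2(1) lb(1,2)]
  have x: "pairing w (deriv (deriv (mode_x bc k))) (mode_y bc) +
      pairing g1 (deriv (mode_x bc k)) (mode_y bc) = 0"
  proof (cases bc)
    case Dirichlet
    then show ?thesis using A lb(2) smooth_real_deriv(2)[OF sm(1)] unfolding admissible_def zero_boundary_def by blast
  next
    case Neumann
    show ?thesis
      by (rule by_parts_x_vanishing[OF S smooth_real_deriv(2)[OF sm(1)] _ _ lb(2)])
        (simp_all add: Neumann deriv_cos_mode sin_mode_def)
  qed
  define M where "M j = pairing w (mode_x bc j) (mode_y bc)" for j
  define c where "c = mode_energy bc k - (if bc = Dirichlet then 1 / 4 else 0)"
  have d2: "deriv (deriv (mode_x bc k)) x = - c * mode_x bc k x + coupling k * mode_x bc (k - 2) x" for x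
    by (cases bc) (simp_all add: deriv2_sin_mode deriv2_cos_mode c_def)
  have "pairing w (deriv (deriv (mode_x bc k))) (mode_y bc) =
      (LINT z|lborel. - c * (w z * (mode_x bc k (fst z) * mode_y bc (snd z))) + coupling k * (w z * (mode_x bc (k - 2) (fst z) * mode_y bc (snd z))))"
    by (simp add: d2 algebra_simps)
  also have "\<dots> = - c * M k + coupling k * M (k - 2)"
    using I[of k] I[of "k - 2"] by (simp add: M_def)
  finally have 1: "pairing g1 (deriv (mode_x bc k)) (mode_y bc) = c * M k - coupling k * M (k - 2)"
    using x by simp
  have 2: "pairing g2 (mode_x bc k) (deriv (mode_y bc)) = (if bc = Dirichlet then 1 / 4 else 0) * M k"
  proof (cases bc)
    case Dirichlet
    have "smooth (\<lambda>y::real. cos (y / 2) / 2)" using smooth_mult[OF smooth_cos_sin(1)[of 2] smooth_const[of "1 / 2"]] by simp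
    moreover have "zero_boundary a w g1 g2" using A Dirichlet by (simp add: admissible_def)
    ultimately have "(LINT z|lborel. w z * (mode_x bc k (fst z) * deriv (\<lambda>y. cos (y / 2) / 2) (snd z))) +
        (LINT z|lborel. g2 z * (mode_x bc k (fst z) * (cos (snd z / 2) / 2))) = 0"
      using lb(1) unfolding zero_boundary_def by (elim conjE allE[of _ "mode_x bc k"] allE[of _ "\<lambda>y. cos (y / 2) / 2"]) simp
    then have "(LINT z|lborel. g2 z * (mode_x bc k (fst z) * (cos (snd z / 2) / 2))) =
        - (LINT z|lborel. (- 1 / 4) * (w z * (mode_x bc k (fst z) * sin (snd z / 2))))"
      by (simp add: deriv_half_angle mult_ac)
    also have "\<dots> = 1 / 4 * M k" by (subst integral_mult_right_zero) (simp add: M_def Dirichlet)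
    finally show ?thesis by (simp add: Dirichlet deriv_half_angle)
  qed simp
  show ?thesis
    unfolding gradient_product_def mode_def L2_times_on_cracked[OF L2(1)] L2_times_on_cracked[OF L2(2)] L2_times_on_cracked[OF L2(3)]
    unfolding M_def[symmetric] 1 2 by (simp add: c_def algebra_simps)
qed

lemma form_domain_H1: "u \<in> form_domain bc a \<Longrightarrow> u \<in> H1 (cracked a)"
  by (cases bc) auto

lemma form_domain_admissible:
  assumes "u \<in> form_domain bc a"
    and u': "u' \<in> borel_measurable borel" "\<And>z. z \<notin> cracked a \<Longrightarrow> u' z = 0" "AE z in lebesgue_on (cracked a). u z = u' z"
    and S: "sobolev a u' g1 g2" and g: "AE z in lebesgue_on (cracked a). weak_grad (cracked a) u z = (g1 z, g2 z)"
  shows "admissible bc a u' g1 g2"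
  unfolding admissible_def
proof (intro conjI impI S)
  assume "bc = Dirichlet"
  with assms(1) have "u \<in> H1 (cracked a)" "zero_trace a u" by auto
  then show "zero_boundary a u' g1 g2" by (rule zero_boundary_if_zero_trace[OF _ _ u' S g])
qed

lemma dirichlet_form_eq:
  assumes u: "u \<in> H1 (cracked a)" "AE z in lebesgue_on (cracked a). weak_grad (cracked a) u z = (g1 z, g2 z)"
    and w: "w \<in> H1 (cracked a)" "AE z in lebesgue_on (cracked a). weak_grad (cracked a) w z = (h1 z, h2 z)"
    and L2: "L2_cracked a g1" "L2_cracked a g2" "L2_cracked a h1" "L2_cracked a h2"
  shows "dirichlet_form (cracked a) u w = gradient_product g1 g2 h1 h2"
proof -
  note i = L2_mult_integrable[OF L2(1,3)] L2_mult_integrable[OF L2(2,4)]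
  have gm: "weak_grad (cracked a) u \<in> borel_measurable (lebesgue_on (cracked a))" "weak_grad (cracked a) w \<in> borel_measurable (lebesgue_on (cracked a))"
    using weak_grad_has_L2_gradient[OF u(1)] weak_grad_has_L2_gradient[OF w(1)]
    by (auto simp: has_L2_gradient_def square_integrable_def)
  have "dirichlet_form (cracked a) u w = (LINT z|lborel. g1 z * h1 z + g2 z * h2 z)"
    unfolding dirichlet_form_def
  proof (rule lebesgue_on_lborel(1))
    show "(\<lambda>z. weak_grad (cracked a) u z \<bullet> weak_grad (cracked a) w z) \<in> borel_measurable (lebesgue_on (cracked a))"
      by (rule borel_measurable_inner[OF gm])
    show "AE z in lebesgue_on (cracked a). weak_grad (cracked a) u z \<bullet> weak_grad (cracked a) w z = g1 z * h1 z + g2 z * h2 z"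
      using u(2) w(2) by eventually_elim (simp add: inner_prod_def)
  qed (use L2 in \<open>auto simp: L2_cracked_def\<close>)
  then show ?thesis using i by (simp add: gradient_product_def)
qed

lemma mode_boundary:
  assumes "z \<in> frontier rect"
  shows "mode_x Dirichlet k (fst z) * mode_y Dirichlet (snd z) = 0"
proof (cases z)
  case (Pair x y)
  then have "x = 0 \<or> x = 4*pi \<or> y = 0 \<or> y = 2*pi" using assms unfolding frontier_rect by (auto simp: rect_def)
  then show ?thesis using Pair by (auto simp: sin_mode_def)
qed

text \<open>In the Dirichlet case a mode is continuous up to the boundary and vanishes there, so that the constant sequence
witnesses its zero trace.\<close>

lemma mode_in_form_domain:
  assumes "0 < a"
  shows "mode bc a k \<in> form_domain bc a"
proof (cases bc)
  case Neumann
  then show ?thesis using on_cracked_H1(1)[OF smooth_mode(1)[of bc] smooth_mode(2)[of bc] assms] by (simp add: mode_def)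
next
  case Dirichlet
  have H: "mode bc a k \<in> H1 (cracked a)"
    using on_cracked_H1(1)[OF smooth_mode assms] by (simp add: mode_def)
  have c: "continuous_on (cracked a \<union> frontier rect) (mode bc a k)"
  proof (rule continuous_on_eq)
    show "continuous_on (cracked a \<union> frontier rect) (\<lambda>z. mode_x bc k (fst z) * mode_y bc (snd z))"
      by (rule smooth_continuous[OF smooth_mult[OF smooth_fst[OF smooth_mode(1)] smooth_snd[OF smooth_mode(2)]]])
    fix z assume "z \<in> cracked a \<union> frontier rect"
    then show "mode_x bc k (fst z) * mode_y bc (snd z) = mode bc a k z"
      using mode_boundary[of z k] by (auto simp: mode_def on_cracked_def Dirichlet)
  qed
  have 0: "mode bc a k (x, y) = 0" if "\<not> (0 < x \<and> x < 4*pi \<and> 0 < y \<and> y < 2*pi)" for x y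
    using that cracked_iff[of x y a] by (auto simp: mode_def on_cracked_def)
  have "boundary_norm2 (mode bc a k) = 0" unfolding boundary_norm2_def by (simp add: 0)
  moreover have "H1_dist2 (cracked a) (mode bc a k) (mode bc a k) = 0" by (simp add: H1_dist2_def)
  ultimately have "zero_trace a (mode bc a k)"
    unfolding zero_trace_def by (intro exI[of _ "\<lambda>n. mode bc a k"]) (simp add: H c)
  then show ?thesis using H by (simp add: Dirichlet)
qed

lemma mode_admissible:
  assumes "0 < a"
  shows "admissible bc a (mode bc a k) (mode_dx bc a k) (mode_dy bc a k)"
proof (rule form_domain_admissible[OF mode_in_form_domain[OF assms]])
  note o = on_cracked_H1(2,3)[OF smooth_mode assms]
  show S: "sobolev a (mode bc a k) (mode_dx bc a k) (mode_dy bc a k)" using o(1) by (simp add: mode_def)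
  show "AE z in lebesgue_on (cracked a). weak_grad (cracked a) (mode bc a k) z = (mode_dx bc a k z, mode_dy bc a k z)"
    using o(2) by (simp add: mode_def)
  show "mode bc a k \<in> borel_measurable borel" "\<And>z. z \<notin> cracked a \<Longrightarrow> mode bc a k z = 0"
    using sobolev_L2(1)[OF S] by (auto simp: L2_cracked_def)
qed simp

lemma form_domain_representative:
  assumes "w \<in> form_domain bc a"
  obtains w' g1 g2 where "admissible bc a w' g1 g2" "AE z in lebesgue_on (cracked a). w z = w' z"
    "AE z in lebesgue_on (cracked a). weak_grad (cracked a) w z = (g1 z, g2 z)"
proof -
  have H: "w \<in> H1 (cracked a)" using assms by (rule form_domain_H1)
  then have "w \<in> borel_measurable (lebesgue_on (cracked a))" by (simp add: H1_def square_integrable_def)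
  then obtain w' where w': "w' \<in> borel_measurable borel" "\<And>z. z \<notin> cracked a \<Longrightarrow> w' z = 0" "AE z in lebesgue_on (cracked a). w z = w' z"
    using borel_representative[OF cracked_borel] by blast
  obtain g1 g2 where g: "sobolev a w' g1 g2" "AE z in lebesgue_on (cracked a). weak_grad (cracked a) w z = (g1 z, g2 z)"
    using H1_representative[OF H w'] by blast
  from form_domain_admissible[OF assms w' g] w'(3) g(2) show ?thesis by (rule that)
qed

lemma gradient_product_commute: "gradient_product g1 g2 h1 h2 = gradient_product h1 h2 g1 g2"
  by (simp add: gradient_product_def mult.commute)

lemma dirichlet_form_mode:
  assumes "0 < a" and w: "w \<in> form_domain bc a" "admissible bc a w' g1 g2"
    "AE z in lebesgue_on (cracked a). weak_grad (cracked a) w z = (g1 z, g2 z)"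
  shows "dirichlet_form (cracked a) w (mode bc a k) = gradient_product g1 g2 (mode_dx bc a k) (mode_dy bc a k)"
    "dirichlet_form (cracked a) (mode bc a k) w = gradient_product g1 g2 (mode_dx bc a k) (mode_dy bc a k)"
proof -
  have ae: "AE z in lebesgue_on (cracked a). weak_grad (cracked a) (mode bc a k) z = (mode_dx bc a k z, mode_dy bc a k z)"
    using on_cracked_H1(3)[OF smooth_mode \<open>0 < a\<close>] by (simp add: mode_def)
  have "sobolev a w' g1 g2" "sobolev a (mode bc a k) (mode_dx bc a k) (mode_dy bc a k)"
    using w(2) mode_admissible[OF \<open>0 < a\<close>, of bc k] by (auto simp: admissible_def)
  note L2 = sobolev_L2(2,3)[OF this(1)] sobolev_L2(2,3)[OF this(2)]
  note H = form_domain_H1[OF w(1)] form_domain_H1[OF mode_in_form_domain[OF \<open>0 < a\<close>]]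
  show "dirichlet_form (cracked a) w (mode bc a k) = gradient_product g1 g2 (mode_dx bc a k) (mode_dy bc a k)"
    by (rule dirichlet_form_eq[OF H(1) w(3) H(2) ae L2])
  show "dirichlet_form (cracked a) (mode bc a k) w = gradient_product g1 g2 (mode_dx bc a k) (mode_dy bc a k)"
    unfolding gradient_product_commute[of g1]
    by (rule dirichlet_form_eq[OF H(2) ae H(1) w(3) L2(3,4,1,2)])
qed

lemma mode_in_eigenspace:
  assumes "0 < a" "k < 2"
  shows "mode bc a k \<in> eigenspace bc a (mode_energy bc k)"
proof -
  have A: "admissible bc a (mode bc a k) (mode_dx bc a k) (mode_dy bc a k)" by (rule mode_admissible[OF assms(1)])
  then have S: "sobolev a (mode bc a k) (mode_dx bc a k) (mode_dy bc a k)" by (simp add: admissible_def)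
  note L2 = sobolev_L2(1)[OF S]
  have ck: "coupling k = 0" using \<open>k < 2\<close> by (auto simp: coupling_def less_2_cases_iff)
  have off: "mode bc a k z = 0" if "z \<notin> cracked a" for z using that by (simp add: mode_def on_cracked_def)
  have c: "continuous_on (cracked a) (mode bc a k)"
    by (rule continuous_on_eq[OF smooth_continuous[OF smooth_mult[OF smooth_fst[OF smooth_mode(1)] smooth_snd[OF smooth_mode(2)]]]])
      (simp add: mode_def on_cracked_def)
  let ?f = "\<lambda>z. mode_energy bc k * mode bc a k z"
  have sq: "L2_cracked a ?f"
    using L2 by (auto simp: L2_cracked_def power_mult_distrib)
  have "dirichlet_form (cracked a) (mode bc a k) w = (LINT x|lebesgue_on (cracked a). ?f x * w x)" if w: "w \<in> form_domain bc a" for w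
  proof -
    obtain w' g1 g2 where w': "admissible bc a w' g1 g2" "AE z in lebesgue_on (cracked a). w z = w' z"
      "AE z in lebesgue_on (cracked a). weak_grad (cracked a) w z = (g1 z, g2 z)"
      by (rule form_domain_representative[OF w])
    have L2w: "L2_cracked a w'" using w'(1) sobolev_L2(1) by (auto simp: admissible_def)
    have wm: "w \<in> borel_measurable (lebesgue_on (cracked a))"
      using form_domain_H1[OF w] by (simp add: H1_def square_integrable_def)
    have "(LINT x|lebesgue_on (cracked a). ?f x * w x) = (LINT z|lborel. ?f z * w' z)"
    proof (rule lebesgue_on_lborel(1))
      show "AE z in lebesgue_on (cracked a). ?f z * w z = ?f z * w' z" using w'(2) by eventually_elim simp
      show "(\<lambda>z. ?f z * w z) \<in> borel_measurable (lebesgue_on (cracked a))" using L2_lebesgue_on(1)[OF sq] wm by auto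
    qed (use sq L2w in \<open>auto simp: L2_cracked_def\<close>)
    also have "\<dots> = mode_energy bc k * (LINT z|lborel. w' z * mode bc a k z)"
      by (subst integral_mult_right_zero[symmetric]) (simp add: mult_ac)
    also have "\<dots> = dirichlet_form (cracked a) (mode bc a k) w"
      using dirichlet_form_mode(2)[OF \<open>0 < a\<close> w w'(1,3), of k] mode_weak_equation[OF w'(1), of k] ck by simp
    finally show ?thesis by simp
  qed
  then show ?thesis
    unfolding eigenspace_def neg_laplacian_def
    using c off mode_in_form_domain[OF \<open>0 < a\<close>] L2_lebesgue_on(2)[OF sq] by auto
qed

text \<open>Testing the eigenvalue equation with the modes leads to the recursion for the integrals of \<open>u\<close> against them,
testing it with \<open>u\<close> itself gives the energy identity.\<close>

lemma eigenfunction_weak_equation: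
  assumes "0 < a" and u: "u \<in> eigenspace bc a \<nu>"
  obtains g1 g2 where "admissible bc a u g1 g2"
    "\<And>k. gradient_product g1 g2 (mode_dx bc a k) (mode_dy bc a k) = \<nu> * (LINT z|lborel. u z * mode bc a k z)"
    "gradient_product g1 g2 g1 g2 = \<nu> * (LINT z|lborel. (u z)\<^sup>2)"
proof -
  have c: "continuous_on (cracked a) u" and off: "\<And>z. z \<notin> cracked a \<Longrightarrow> u z = 0"
    and nl: "neg_laplacian bc a u (\<lambda>x. \<nu> * u x)" using u by (auto simp: eigenspace_def)
  have fd: "u \<in> form_domain bc a" and eq: "\<And>v. v \<in> form_domain bc a \<Longrightarrow>
      dirichlet_form (cracked a) u v = (LINT x|lebesgue_on (cracked a). \<nu> * u x * v x)"
    using nl by (auto simp: neg_laplacian_def)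
  have um: "u \<in> borel_measurable borel" by (rule borel_measurable_continuous_on_cracked[OF c off])
  obtain g1 g2 where g: "sobolev a u g1 g2" "AE z in lebesgue_on (cracked a). weak_grad (cracked a) u z = (g1 z, g2 z)"
    using H1_representative[OF form_domain_H1[OF fd] um off] by auto
  have A: "admissible bc a u g1 g2" by (rule form_domain_admissible[OF fd um off _ g]) simp_all
  note L2 = sobolev_L2[OF g(1)]
  have tr: "(LINT x|lebesgue_on (cracked a). \<nu> * u x * v x) = \<nu> * (LINT z|lborel. u z * v z)" if v: "L2_cracked a v" for v
  proof -
    have "(LINT x|lebesgue_on (cracked a). \<nu> * u x * v x) = (LINT z|lborel. \<nu> * u z * v z)"
    proof (rule lebesgue_on_lborel(1))
      show "(\<lambda>z. \<nu> * u z * v z) \<in> borel_measurable (lebesgue_on (cracked a))"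
        using L2_lebesgue_on(1)[OF L2(1)] L2_lebesgue_on(1)[OF v] by auto
    qed (use v um off in \<open>auto simp: L2_cracked_def\<close>)
    then show ?thesis by (simp add: mult.assoc)
  qed
  show ?thesis
  proof (rule that[OF A])
    show "gradient_product g1 g2 (mode_dx bc a k) (mode_dy bc a k) = \<nu> * (LINT z|lborel. u z * mode bc a k z)" for k
    proof -
      have "L2_cracked a (mode bc a k)"
        using mode_admissible[OF \<open>0 < a\<close>, of bc k] sobolev_L2(1) by (auto simp: admissible_def)
      from tr[OF this] show ?thesis
        using eq[OF mode_in_form_domain[OF \<open>0 < a\<close>, of bc k]] dirichlet_form_mode(1)[OF \<open>0 < a\<close> fd A g(2), of k] by simp
    qed
    show "gradient_product g1 g2 g1 g2 = \<nu> * (LINT z|lborel. (u z)\<^sup>2)"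
      using eq[OF fd] tr[OF L2(1)] dirichlet_form_eq[OF form_domain_H1[OF fd] g(2) form_domain_H1[OF fd] g(2) L2(2,3,2,3)]
      by (simp add: power2_eq_square)
  qed
qed

section \<open>Completeness of the modes in the first variable\<close>

text \<open>On \<open>[0, 4 * pi]\<close> every continuous function is a continuous function of \<open>cos (x / 4)\<close>, hence by the Weierstrass
theorem a uniform limit of polynomials in it.\<close>

lemma AE_eq_0_if_cos_moments_0:
  fixes W :: "real \<Rightarrow> real"
  assumes W: "integrable lborel W" and zero: "\<And>k. (LINT x:{0..4*pi}|lborel. W x * cos_mode k x) = 0"
  shows "AE x in lborel. 0 < x \<and> x < 4*pi \<longrightarrow> W x = 0"
proof (rule AE_eq_0_if_integral_bumps_0[OF W])
  fix k s t assume st: "0 < s" "s \<le> t" "t < 4*pi" and k: "bump s t k"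
  have sk: "smooth k" using k by (simp add: bump_def)
  define N where "N = (LINT x|lborel. \<bar>W x\<bar>)"
  have N: "0 \<le> N" unfolding N_def by (rule Bochner_Integration.integral_nonneg) simp
  define I where "I = (LINT x|lborel. W x * k x)"
  have le: "\<bar>I\<bar> \<le> \<epsilon> * N" if "\<epsilon> > 0" for \<epsilon>
  proof -
    \<comment> \<open>The substitution \<open>c = cos (x / 4)\<close> has the inverse \<open>x = 4 * arccos c\<close>.\<close>
    have "continuous_on {-1..1} (\<lambda>c. k (4 * arccos c))"
      by (intro continuous_on_compose2[OF smooth_continuous[OF sk, of UNIV]] continuous_intros) auto
    then obtain g where g: "real_polynomial_function g" "\<And>c. c \<in> {-1..1} \<Longrightarrow> \<bar>k (4 * arccos c) - g c\<bar> < \<epsilon>"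
      using Stone_Weierstrass_real_polynomial_function[of "{-1..1::real}"] \<open>\<epsilon> > 0\<close> by (metis compact_Icc)
    then obtain b n where gb: "g = (\<lambda>c. \<Sum>i\<le>n. b i * c ^ i)"
      unfolding real_polynomial_function_iff_sum by blast
    have P: "\<bar>k x - g (cos (x / 4))\<bar> < \<epsilon>" if "x \<in> {0..4*pi}" for x
      using g(2)[of "cos (x / 4)"] that by (simp add: arccos_cos)
    have si: "set_integrable lborel {0..4*pi} (\<lambda>x. W x * cos_mode i x)" for i
      by (rule set_integrable_mult_smooth[OF W smooth_modes(1)])
    have "(LINT x:{0..4*pi}|lborel. W x * g (cos (x / 4))) = (LINT x:{0..4*pi}|lborel. \<Sum>i\<le>n. b i * (W x * cos_mode i x))"
      by (simp add: gb cos_mode_def sum_distrib_left mult_ac)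
    also have "\<dots> = (\<Sum>i\<le>n. LINT x:{0..4*pi}|lborel. b i * (W x * cos_mode i x))"
      using set_integrable_mult_right[OF si] unfolding set_lebesgue_integral_def set_integrable_def scaleR_sum_right
      by (intro Bochner_Integration.integral_sum) blast
    also have "\<dots> = 0" using zero by simp
    finally have 0: "(LINT x:{0..4*pi}|lborel. W x * g (cos (x / 4))) = 0" .
    have sg: "set_integrable lborel {0..4*pi} (\<lambda>x. W x * g (cos (x / 4)))"
    proof -
      have "smooth (\<lambda>x. \<Sum>i\<le>m. b i * cos (x / 4) ^ i)" for m
        by (induction m) (simp_all add: smooth_add smooth_mult smooth_power smooth_cos_sin)
      then show ?thesis unfolding gb by (rule set_integrable_mult_smooth[OF W])
    qed
    have "I = (LINT x:{0..4*pi}|lborel. W x * k x)"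
      unfolding I_def using k st by (intro integral_eq_set_integral) (auto simp: bump_def)
    also have "\<dots> = (LINT x:{0..4*pi}|lborel. W x * k x - W x * g (cos (x / 4)))"
      using set_integral_diff(2)[OF set_integrable_mult_smooth[OF W sk] sg] 0 by simp
    also have "\<bar>\<dots>\<bar> \<le> (LINT x|lborel. \<bar>indicator {0..4*pi} x *\<^sub>R (W x * k x - W x * g (cos (x / 4)))\<bar>)"
      unfolding set_lebesgue_integral_def by (rule integral_abs_bound)
    also have "\<dots> \<le> (LINT x|lborel. \<epsilon> * \<bar>W x\<bar>)"
    proof (rule integral_mono)
      show "integrable lborel (\<lambda>x. \<bar>indicator {0..4*pi} x *\<^sub>R (W x * k x - W x * g (cos (x / 4)))\<bar>)"
        using set_integral_diff(1)[OF set_integrable_mult_smooth[OF W sk] sg] unfolding set_integrable_def by (rule integrable_abs)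
      fix x
      show "\<bar>indicator {0..4*pi} x *\<^sub>R (W x * k x - W x * g (cos (x / 4)))\<bar> \<le> \<epsilon> * \<bar>W x\<bar>"
      proof (cases "x \<in> {0..4*pi}")
        case True
        have "\<bar>W x\<bar> * \<bar>k x - g (cos (x / 4))\<bar> \<le> \<bar>W x\<bar> * \<epsilon>"
          using P[OF True] by (intro mult_left_mono) auto
        then show ?thesis using True by (simp add: abs_mult[symmetric] right_diff_distrib mult.commute)
      qed (use \<open>\<epsilon> > 0\<close> in simp)
    qed (use W in auto)
    finally show ?thesis by (simp add: N_def)
  qed
  have "I = 0"
  proof (rule ccontr)
    assume "I \<noteq> 0"
    then have "\<bar>I\<bar> \<le> \<bar>I\<bar> / (N + 1) * N" using N by (intro le) auto
    then show False using \<open>I \<noteq> 0\<close> N by (simp add: field_simps)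
  qed
  then show "(LINT x|lborel. W x * k x) = 0" by (simp add: I_def)
qed

text \<open>Apart from the factor of mode 0, which has no zeros in \<open>(0, 4 * pi)\<close>, the modes depend on \<open>x\<close> as the powers of \<open>cos (x / 4)\<close>.\<close>

lemma vertical_projection_zero:
  assumes u: "L2_cracked a u" and zero: "\<And>k. (LINT z|lborel. u z * mode bc a k z) = 0"
  shows "AE x in lborel. 0 < x \<and> x < 4*pi \<longrightarrow> (LINT y|lborel. u (x, y) * mode_y bc y) = 0"
proof -
  note lb = smooth_locally_bounded[OF smooth_mode(1)[of bc]] smooth_locally_bounded[OF smooth_mode(2)[of bc]]
  define V where "V x = (LINT y|lborel. u (x, y) * mode_y bc y)" for x
  define W where "W x = mode_x bc 0 x * V x" for x
  have inner: "(LINT y|lborel. u (x, y) * (mode_x bc k (fst (x, y)) * mode_y bc (snd (x, y)))) = mode_x bc k x * V x" for k x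
    unfolding V_def by (subst integral_mult_right_zero[symmetric]) (simp add: mult_ac)
  note Fu = Fubini_lborel'(2,3)[OF L2_mult_product[OF u lb(1) lb(2)], unfolded inner]
  have iW: "integrable lborel W" using Fu(1)[of 0] by (simp add: W_def[abs_def])
  have "AE x in lborel. 0 < x \<and> x < 4*pi \<longrightarrow> W x = 0"
  proof (rule AE_eq_0_if_cos_moments_0[OF iW])
    fix k
    have mx: "mode_x bc k x = mode_x bc 0 x * cos_mode k x" for x
      by (cases bc) (simp_all add: cos_mode_def sin_mode_def)
    have "(LINT x:{0..4*pi}|lborel. W x * cos_mode k x) = (LINT x|lborel. W x * cos_mode k x)"
    proof (rule integral_eq_set_integral[symmetric])
      fix x assume "x \<notin> {0..4*pi}"
      then have "u (x, y) = 0" for y by (intro L2_off[OF u]) auto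
      then show "W x * cos_mode k x = 0" by (simp add: W_def V_def)
    qed
    also have "\<dots> = (LINT x|lborel. mode_x bc k x * V x)" by (simp add: W_def mx mult_ac)
    also have "\<dots> = (LINT z|lborel. u z * mode bc a k z)"
      using Fu(2)[of k] by (simp add: mode_def L2_times_on_cracked[OF u])
    finally show "(LINT x:{0..4*pi}|lborel. W x * cos_mode k x) = 0" using zero by simp
  qed
  then show ?thesis
  proof eventually_elim
    case (elim x)
    have "mode_x bc 0 x \<noteq> 0" if "0 < x" "x < 4*pi"
      using sin_gt_zero[of "x / 4"] that by (cases bc) (auto simp: cos_mode_def sin_mode_def)
    then show ?case using elim by (auto simp: W_def V_def)
  qed
qed

section \<open>Spectral gap on the orthogonal complement\<close>

lemma ac_on_AE:
  assumes ac: "ac_on \<alpha> \<beta> u g e" and "\<alpha> \<le> s" "t \<le> \<beta>"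
  shows "AE x in lborel. x \<in> {s..t} \<longrightarrow> u x = e + primitive g \<alpha> x"
proof -
  have "AE x in lborel. x \<noteq> \<alpha>" "AE x in lborel. x \<noteq> \<beta>" by (rule AE_lborel_singleton)+
  moreover have "AE x in lborel. \<alpha> < x \<and> x < \<beta> \<longrightarrow> u x = e + primitive g \<alpha> x"
    using ac by (simp add: ac_on_def)
  ultimately show ?thesis by eventually_elim (use assms(2,3) in auto)
qed

lemma primitive_measurable:
  "integrable lborel g \<Longrightarrow> primitive g \<alpha> \<in> borel_measurable borel"
  by (rule borel_measurable_continuous_onI[OF primitive_continuous])

lemma ac_on_set_integral_square:
  assumes ac: "ac_on \<alpha> \<beta> u g e" and "\<alpha> \<le> s" "t \<le> \<beta>"
  shows "(LINT x:{s..t}|lborel. (u x)\<^sup>2) = (LINT x:{s..t}|lborel. (e + primitive g \<alpha> x)\<^sup>2)"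
proof -
  have "integrable lborel u" "integrable lborel g" using ac by (auto simp: ac_on_def)
  then have "u \<in> borel_measurable borel" "primitive g \<alpha> \<in> borel_measurable borel" by (auto intro: primitive_measurable)
  with ac_on_AE[OF assms] show ?thesis
    unfolding set_lebesgue_integral_def
    by (intro integral_cong_AE) (auto elim!: eventually_mono split: split_indicator)
qed

lemma ac_on_set_integral_mult:
  assumes ac: "ac_on \<alpha> \<beta> u g e" and "\<alpha> \<le> s" "t \<le> \<beta>" and k: "k \<in> borel_measurable borel"
  shows "(LINT x:{s..t}|lborel. u x * k x) = (LINT x:{s..t}|lborel. (e + primitive g \<alpha> x) * k x)"
proof -
  have "integrable lborel u" "integrable lborel g" using ac by (auto simp: ac_on_def)
  then have "u \<in> borel_measurable borel" "primitive g \<alpha> \<in> borel_measurable borel" by (auto intro: primitive_measurable)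
  with ac_on_AE[OF assms(1-3)] k show ?thesis
    unfolding set_lebesgue_integral_def
    by (intro integral_cong_AE) (auto elim!: eventually_mono split: split_indicator)
qed

lemma set_integral_le_integral:
  fixes f :: "real \<Rightarrow> real"
  assumes "integrable lborel h" "\<And>x. 0 \<le> h x" "\<And>x. x \<in> {s..t} \<Longrightarrow> 0 \<le> f x \<and> f x \<le> h x"
  shows "(LINT x:{s..t}|lborel. f x) \<le> (LINT x|lborel. h x)"
  unfolding set_lebesgue_integral_def
  by (rule integral_mono_AE') (use assms in \<open>auto split: split_indicator\<close>)

definition left_part :: "real \<Rightarrow> (real \<times> real \<Rightarrow> real) \<Rightarrow> real" where
  "left_part a u = (LINT z|lborel. indicator {..<a} (fst z) * (u z)\<^sup>2)"

definition right_part :: "real \<Rightarrow> (real \<times> real \<Rightarrow> real) \<Rightarrow> real" where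
  "right_part a u = (LINT z|lborel. indicator {a..} (fst z) * (u z)\<^sup>2)"

lemma indicator_fst_integrable:
  fixes h :: "real \<times> real \<Rightarrow> real"
  assumes "integrable lborel h" "A \<in> sets borel"
  shows "integrable lborel (\<lambda>z. indicator A (fst z) * h z)"
  by (rule integrable_mult_bounded(2)[OF assms(1), where B=1])
    (use fst_measurable_lborel[of "indicator A"] assms(2) in \<open>auto split: split_indicator\<close>)

lemma left_plus_right:
  assumes "L2_cracked a u"
  shows "left_part b u + right_part b u = (LINT z|lborel. (u z)\<^sup>2)"
proof -
  have i: "integrable lborel (\<lambda>z. (u z)\<^sup>2)" using assms by (simp add: L2_cracked_def)
  have "left_part b u + right_part b u = (LINT z|lborel. indicator {..<b} (fst z) * (u z)\<^sup>2 + indicator {b..} (fst z) * (u z)\<^sup>2)"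
    unfolding left_part_def right_part_def
    by (intro Bochner_Integration.integral_add[symmetric] indicator_fst_integrable i) auto
  also have "\<dots> = (LINT z|lborel. (u z)\<^sup>2)"
    by (intro Bochner_Integration.integral_cong) (auto split: split_indicator)
  finally show ?thesis .
qed

lemma right_part_le:
  assumes S: "sobolev a u g1 g2" and "0 \<le> K"
    and line: "AE x in lborel. a < x \<and> x < 4*pi \<longrightarrow>
      (LINT y:{0..2*pi}|lborel. (u (x, y))\<^sup>2) \<le> K * (LINT y:{0..2*pi}|lborel. (g2 (x, y))\<^sup>2)"
  shows "right_part a u \<le> K * (LINT z|lborel. (g2 z)\<^sup>2)"
proof -
  note L2 = sobolev_L2[OF S] and D = sobolev_D[OF S]
  note i1 = indicator_fst_integrable[OF D(7), of "{a..}"]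
  have si: "(LINT y|lborel. (f (x, y))\<^sup>2) = (LINT y:{0..2*pi}|lborel. (f (x, y))\<^sup>2)"
    if "L2_cracked a f" for f x
    by (rule integral_eq_set_integral) (use L2_off[OF that] in auto)
  have "right_part a u = (LINT x|lborel. indicator {a..} x * (LINT y|lborel. (u (x, y))\<^sup>2))"
    unfolding right_part_def using Fubini_lborel'(3)[OF i1] by simp
  also have "\<dots> \<le> (LINT x|lborel. K * (LINT y|lborel. (g2 (x, y))\<^sup>2))"
  proof (rule integral_mono_AE)
    show "integrable lborel (\<lambda>x. indicator {a..} x * (LINT y|lborel. (u (x, y))\<^sup>2))"
      using Fubini_lborel'(2)[OF i1] by simp
    show "integrable lborel (\<lambda>x. K * (LINT y|lborel. (g2 (x, y))\<^sup>2))"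
      using Fubini_lborel'(2)[OF D(9)] by simp
    have "AE x in lborel. x \<noteq> a" by (rule AE_lborel_singleton)
    then show "AE x in lborel. indicator {a..} x * (LINT y|lborel. (u (x, y))\<^sup>2) \<le> K * (LINT y|lborel. (g2 (x, y))\<^sup>2)"
      using line
    proof eventually_elim
      case (elim x)
      have nn: "0 \<le> K * (LINT y|lborel. (g2 (x, y))\<^sup>2)"
        using \<open>0 \<le> K\<close> by (intro mult_nonneg_nonneg Bochner_Integration.integral_nonneg) auto
      show ?case
      proof (cases "a < x \<and> x < 4*pi")
        case True
        then show ?thesis using elim si[OF L2(1), of x] si[OF L2(3), of x] by simp
      next
        case False
        show ?thesis
        proof (cases "a \<le> x")
          case True
          then have "\<not> x < 4*pi" using False elim by auto
          then have "u (x, y) = 0" for y using L2_off[OF L2(1), of x y] by blast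
          then show ?thesis using nn by simp
        qed (use nn in simp)
      qed
    qed
  qed
  also have "\<dots> = K * (LINT z|lborel. (g2 z)\<^sup>2)"
    using Fubini_lborel'(3)[OF D(9)] by simp
  finally show ?thesis .
qed

lemma left_part_le:
  assumes S: "sobolev a u g1 g2" and "0 \<le> K" "0 \<le> K'" and "0 < a"
    and line: "AE y in lborel. 0 < y \<and> y < 2*pi \<longrightarrow>
      (LINT x:{0..a}|lborel. (u (x, y))\<^sup>2) \<le> K * (LINT x|lborel. indicator {a..} x * (u (x, y))\<^sup>2) + K' * (LINT x|lborel. (g1 (x, y))\<^sup>2)"
  shows "left_part a u \<le> K * right_part a u + K' * (LINT z|lborel. (g1 z)\<^sup>2)"
proof -
  note L2 = sobolev_L2[OF S] and D = sobolev_D[OF S]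
  have s: "{a..} \<in> sets borel" "{..<a} \<in> sets borel" by auto
  note i1 = indicator_fst_integrable[OF D(7) s(1)] and i2 = indicator_fst_integrable[OF D(7) s(2)]
  have "left_part a u = (LINT y|lborel. LINT x|lborel. indicator {..<a} x * (u (x, y))\<^sup>2)"
    unfolding left_part_def using Fubini_lborel(3)[OF i2] by simp
  also have "\<dots> \<le> (LINT y|lborel. K * (LINT x|lborel. indicator {a..} x * (u (x, y))\<^sup>2) + K' * (LINT x|lborel. (g1 (x, y))\<^sup>2))"
  proof (rule integral_mono_AE)
    show "integrable lborel (\<lambda>y. LINT x|lborel. indicator {..<a} x * (u (x, y))\<^sup>2)"
      using Fubini_lborel(2)[OF i2] by simp
    show "integrable lborel (\<lambda>y. K * (LINT x|lborel. indicator {a..} x * (u (x, y))\<^sup>2) + K' * (LINT x|lborel. (g1 (x, y))\<^sup>2))"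
      using Fubini_lborel(2)[OF i1] Fubini_lborel(2)[OF D(8)] by simp
    show "AE y in lborel. (LINT x|lborel. indicator {..<a} x * (u (x, y))\<^sup>2)
        \<le> K * (LINT x|lborel. indicator {a..} x * (u (x, y))\<^sup>2) + K' * (LINT x|lborel. (g1 (x, y))\<^sup>2)"
      using line
    proof eventually_elim
      case (elim y)
      have nn: "0 \<le> K * (LINT x|lborel. indicator {a..} x * (u (x, y))\<^sup>2) + K' * (LINT x|lborel. (g1 (x, y))\<^sup>2)"
        using assms(2,3) by (intro add_nonneg_nonneg mult_nonneg_nonneg Bochner_Integration.integral_nonneg) auto
      show ?case
      proof (cases "0 < y \<and> y < 2*pi")
        case True
        have "AE x in lborel. x \<noteq> a" by (rule AE_lborel_singleton)
        then have "AE x in lborel. indicator {..<a} x * (u (x, y))\<^sup>2 = indicator {0..a} x *\<^sub>R (u (x, y))\<^sup>2"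
        proof eventually_elim
          case (elim x)
          then show ?case using L2_off[OF L2(1), of x y] by (auto split: split_indicator)
        qed
        moreover have "(\<lambda>x. u (x, y)) \<in> borel_measurable borel"
          using L2(1) unfolding L2_cracked_def
          by (intro measurable_compose[of "\<lambda>x. (x, y)" borel borel u]) (auto intro!: borel_measurable_continuous_onI continuous_intros)
        ultimately have "(LINT x|lborel. indicator {..<a} x * (u (x, y))\<^sup>2) = (LINT x:{0..a}|lborel. (u (x, y))\<^sup>2)"
          unfolding set_lebesgue_integral_def by (intro integral_cong_AE) auto
        then show ?thesis using elim True by simp
      next
        case False
        then have "u (x, y) = 0" for x using L2_off[OF L2(1), of x y] by blast
        then show ?thesis using nn by simp
      qed
    qed
  qed
  also have "\<dots> = K * right_part a u + K' * (LINT z|lborel. (g1 z)\<^sup>2)"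
    unfolding right_part_def using Fubini_lborel(2,3)[OF i1] Fubini_lborel(2,3)[OF D(8)] by simp
  finally show ?thesis .
qed

text \<open>\<open>poincare_mean_zero\<close> on the vertical lines that do not meet the crack gives the constant \<open>pi\<^sup>2 / 2 \<le> 8\<close>;
the strip on the left adds at most one half of the right part and one half of the energy, whence \<open>12 = 3 / 2 * 8\<close>. The eigenvalue
\<open>1 / 16\<close> of mode 1 is below \<open>1 / 12\<close>.\<close>

lemma gap_neumann:
  assumes S: "sobolev a u g1 g2" and a: "0 < a" "a \<le> 1 / 8"
    and mean: "AE x in lborel. 0 < x \<and> x < 4*pi \<longrightarrow> (LINT y|lborel. u (x, y)) = 0"
  shows "(LINT z|lborel. (u z)\<^sup>2) \<le> 12 * gradient_product g1 g2 g1 g2"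
proof -
  note L2 = sobolev_L2[OF S] and D = sobolev_D[OF S]
  have pi8: "(2*pi - 0)\<^sup>2 / 8 \<le> 8"
  proof -
    have "pi\<^sup>2 \<le> 4\<^sup>2" using pi_less_4 pi_ge_zero by (intro power_mono) auto
    then show ?thesis by (simp add: power_mult_distrib)
  qed
  have R: "right_part a u \<le> 8 * (LINT z|lborel. (g2 z)\<^sup>2)"
  proof (rule right_part_le[OF S])
    have "AE x in lborel. a < x \<and> x < 4*pi \<longrightarrow> (\<exists>e. ac_on 0 (2*pi) (\<lambda>y. u (x, y)) (\<lambda>y. g2 (x, y)) e)"
      by (rule sobolev_vertical[OF S]) (use a in auto)
    with mean show "AE x in lborel. a < x \<and> x < 4*pi \<longrightarrow>
      (LINT y:{0..2*pi}|lborel. (u (x, y))\<^sup>2) \<le> 8 * (LINT y:{0..2*pi}|lborel. (g2 (x, y))\<^sup>2)"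
    proof eventually_elim
      case (elim x)
      show ?case
      proof
        assume x: "a < x \<and> x < 4*pi"
        then obtain e where e: "ac_on 0 (2*pi) (\<lambda>y. u (x, y)) (\<lambda>y. g2 (x, y)) e" using elim(2) by blast
        then have g: "integrable lborel (\<lambda>y. g2 (x, y))" "integrable lborel (\<lambda>y. (g2 (x, y))\<^sup>2)" by (auto simp: ac_on_def)
        have "(LINT y:{0..2*pi}|lborel. e + primitive (\<lambda>y. g2 (x, y)) 0 y) = (LINT y:{0..2*pi}|lborel. u (x, y))"
          using ac_on_set_integral_mult[OF e, of 0 "2*pi" "\<lambda>y. 1"] by simp
        also have "\<dots> = (LINT y|lborel. u (x, y))"
          by (rule integral_eq_set_integral[symmetric]) (use L2_off[OF L2(1)] in auto)
        also have "\<dots> = 0" using elim(1) x a by simp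
        finally have "(LINT y:{0..2*pi}|lborel. (u (x, y))\<^sup>2) \<le> (2*pi - 0)\<^sup>2 / 8 * (LINT y:{0..2*pi}|lborel. (g2 (x, y))\<^sup>2)"
          using poincare_mean_zero[OF g, of 0 "2*pi" e] ac_on_set_integral_square[OF e, of 0 "2*pi"] by simp
        also have "\<dots> \<le> 8 * (LINT y:{0..2*pi}|lborel. (g2 (x, y))\<^sup>2)"
          by (intro mult_right_mono pi8 set_integral_nonneg') auto
        finally show "(LINT y:{0..2*pi}|lborel. (u (x, y))\<^sup>2) \<le> 8 * (LINT y:{0..2*pi}|lborel. (g2 (x, y))\<^sup>2)" .
      qed
    qed
  qed simp
  have L: "left_part a u \<le> 1 / 2 * right_part a u + 1 / 2 * (LINT z|lborel. (g1 z)\<^sup>2)"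
  proof (rule left_part_le[OF S])
    have s: "{a..} \<in> sets borel" by auto
    note i1 = indicator_fst_integrable[OF D(7) s]
    show "AE y in lborel. 0 < y \<and> y < 2*pi \<longrightarrow>
      (LINT x:{0..a}|lborel. (u (x, y))\<^sup>2) \<le> 1 / 2 * (LINT x|lborel. indicator {a..} x * (u (x, y))\<^sup>2) + 1 / 2 * (LINT x|lborel. (g1 (x, y))\<^sup>2)"
      using sobolev_horizontal[OF S] Fubini_lborel(1)[OF i1]
    proof eventually_elim
      case (elim y)
      show ?case
      proof
        assume "0 < y \<and> y < 2*pi"
        then obtain e where e: "ac_on 0 (4*pi) (\<lambda>x. u (x, y)) (\<lambda>x. g1 (x, y)) e" using elim(1) by blast
        then have g: "integrable lborel (\<lambda>x. g1 (x, y))" "integrable lborel (\<lambda>x. (g1 (x, y))\<^sup>2)" by (auto simp: ac_on_def)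
        have a1: "a + 1 \<le> 4*pi" using a pi_gt3 by linarith
        have "(LINT x:{0..a}|lborel. (u (x, y))\<^sup>2) \<le> 4 * a * (LINT x:{a..a+1}|lborel. (u (x, y))\<^sup>2) + (2 * a + a\<^sup>2) * (LINT x:{0..a+1}|lborel. (g1 (x, y))\<^sup>2)"
          using strip_le_neighbour[OF g, of a e] ac_on_set_integral_square[OF e, of 0 a] ac_on_set_integral_square[OF e, of a "a+1"] a a1 by simp
        also have "\<dots> \<le> 1 / 2 * (LINT x|lborel. indicator {a..} x * (u (x, y))\<^sup>2) + 1 / 2 * (LINT x|lborel. (g1 (x, y))\<^sup>2)"
        proof (rule add_mono)
          have "(LINT x:{a..a+1}|lborel. (u (x, y))\<^sup>2) \<le> (LINT x|lborel. indicator {a..} x * (u (x, y))\<^sup>2)"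
            by (rule set_integral_le_integral) (use elim(2) in \<open>auto split: split_indicator\<close>)
          then show "4 * a * (LINT x:{a..a+1}|lborel. (u (x, y))\<^sup>2) \<le> 1 / 2 * (LINT x|lborel. indicator {a..} x * (u (x, y))\<^sup>2)"
            using a by (intro mult_mono) (auto intro!: set_integral_nonneg')
          have "(LINT x:{0..a+1}|lborel. (g1 (x, y))\<^sup>2) \<le> (LINT x|lborel. (g1 (x, y))\<^sup>2)"
            by (rule set_integral_le_integral[OF g(2)]) auto
          moreover have "2 * a + a\<^sup>2 \<le> 1 / 2"
            using a power_mono[of a "1/8" 2] by (simp add: power2_eq_square)
          ultimately show "(2 * a + a\<^sup>2) * (LINT x:{0..a+1}|lborel. (g1 (x, y))\<^sup>2) \<le> 1 / 2 * (LINT x|lborel. (g1 (x, y))\<^sup>2)"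
            by (intro mult_mono) (auto intro!: set_integral_nonneg')
        qed
        finally show "(LINT x:{0..a}|lborel. (u (x, y))\<^sup>2) \<le> 1 / 2 * (LINT x|lborel. indicator {a..} x * (u (x, y))\<^sup>2) + 1 / 2 * (LINT x|lborel. (g1 (x, y))\<^sup>2)" .
      qed
    qed
  qed (use a in auto)
  have "gradient_product g1 g2 g1 g2 = (LINT z|lborel. (g1 z)\<^sup>2) + (LINT z|lborel. (g2 z)\<^sup>2)"
    by (simp add: gradient_product_def power2_eq_square)
  moreover have "0 \<le> (LINT z|lborel. (g1 z)\<^sup>2)" by (rule Bochner_Integration.integral_nonneg) simp
  ultimately show ?thesis using R L left_plus_right[OF L2(1), of a] by linarith
qed

text \<open>The test functions 1 and \<open>x\<close> give two linear equations for the limits at the two ends of a line, with zero as the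
only solution.\<close>

lemma zero_boundary_horizontal:
  assumes S: "sobolev a u g1 g2" and Z: "zero_boundary a u g1 g2"
  shows "AE y in lborel. 0 < y \<and> y < 2*pi \<longrightarrow> ac_on 0 (4*pi) (\<lambda>x. u (x, y)) (\<lambda>x. g1 (x, y)) 0"
proof -
  note L2 = sobolev_L2[OF S]
  have R: "AE y in lborel. 0 < y \<and> y < 2*pi \<longrightarrow> (LINT x|lborel. u (x, y) * deriv p x + g1 (x, y) * p x) = 0"
    if p: "smooth p" for p
  proof (rule AE_eq_0_if_integral_bumps_0)
    note b = smooth_locally_bounded[OF p] smooth_locally_bounded[OF smooth_real_deriv(2)[OF p]]
    have one: "locally_bounded_borel (\<lambda>y. 1)" by (rule smooth_locally_bounded) simp
    show "integrable lborel (\<lambda>y. LINT x|lborel. u (x, y) * deriv p x + g1 (x, y) * p x)"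
      using product_Fubini_y(2)[OF L2_mult_product[OF L2(1) b(2) one] L2_mult_product[OF L2(2) b(1) one]] by simp
    fix k s t assume "bump s t k"
    then have k: "locally_bounded_borel k" by (auto simp: bump_def intro: smooth_locally_bounded)
    have "pairing u (deriv p) k + pairing g1 p k = 0"
      using Z p k unfolding zero_boundary_def by blast
    then show "(LINT y|lborel. (LINT x|lborel. u (x, y) * deriv p x + g1 (x, y) * p x) * k y) = 0"
      using product_Fubini_y(1)[OF L2_mult_product[OF L2(1) b(2) k] L2_mult_product[OF L2(2) b(1) k]]
      by (simp add: mult.commute)
  qed
  show ?thesis
    using sobolev_horizontal[OF S] R[OF smooth_const[of 1]] R[OF smooth_ident]
  proof eventually_elim
    case (elim y)
    show ?case
    proof
      assume y: "0 < y \<and> y < 2*pi"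
      then obtain e where e: "ac_on 0 (4*pi) (\<lambda>x. u (x, y)) (\<lambda>x. g1 (x, y)) e" using elim(1) by blast
      have IBP: "(LINT x|lborel. u (x, y) * deriv p x + g1 (x, y) * p x) = (e + primitive (\<lambda>x. g1 (x, y)) 0 (4*pi)) * p (4*pi) - e * p 0"
        if "smooth p" for p
      proof -
        have "(LINT x|lborel. u (x, y) * deriv p x + g1 (x, y) * p x) = (LINT x:{0..4*pi}|lborel. u (x, y) * deriv p x + g1 (x, y) * p x)"
          by (rule integral_eq_set_integral) (use L2_off[OF L2(1)] L2_off[OF L2(2)] in auto)
        then show ?thesis using ac_on_by_parts[OF e that] by simp
      qed
      have "e = 0" using IBP[OF smooth_const[of 1]] IBP[OF smooth_ident] elim(2,3) y by simp
      then show "ac_on 0 (4*pi) (\<lambda>x. u (x, y)) (\<lambda>x. g1 (x, y)) 0" using e by simp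
    qed
  qed
qed

lemma zero_boundary_vertical:
  assumes S: "sobolev a u g1 g2" and Z: "zero_boundary a u g1 g2" and q: "smooth q" "q pi = 0"
  shows "AE x in lborel. 0 < x \<and> x < 4*pi \<longrightarrow> (LINT y|lborel. u (x, y) * deriv q y + g2 (x, y) * q y) = 0"
proof (rule AE_eq_0_if_integral_bumps_0)
  note L2 = sobolev_L2[OF S]
  note b = smooth_locally_bounded[OF q(1)] smooth_locally_bounded[OF smooth_real_deriv(2)[OF q(1)]]
  have one: "locally_bounded_borel (\<lambda>y. 1)" by (rule smooth_locally_bounded) simp
  show "integrable lborel (\<lambda>x. LINT y|lborel. u (x, y) * deriv q y + g2 (x, y) * q y)"
    using product_Fubini_x(2)[OF L2_mult_product[OF L2(1) one b(2)] L2_mult_product[OF L2(3) one b(1)]] by simp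
  fix k s t assume "bump s t k"
  then have k: "locally_bounded_borel k" by (auto simp: bump_def intro: smooth_locally_bounded)
  have "pairing u k (deriv q) + pairing g2 k q = 0"
    using Z q k unfolding zero_boundary_def by blast
  then show "(LINT x|lborel. (LINT y|lborel. u (x, y) * deriv q y + g2 (x, y) * q y) * k x) = 0"
    using product_Fubini_x(1)[OF L2_mult_product[OF L2(1) k b(2)] L2_mult_product[OF L2(3) k b(1)]]
    by (simp add: mult.commute)
qed

text \<open>To the right of the crack tip \<open>poincare_second_dirichlet\<close> applies on vertical lines, and on the left the zero
boundary values at \<open>x = 0\<close> make the strip harmless. The eigenvalue \<open>1 / 2\<close> of mode 1 is below \<open>8 / pi\<^sup>2\<close>.\<close>

lemma gap_dirichlet:
  assumes S: "sobolev a u g1 g2" and Z: "zero_boundary a u g1 g2" and a: "0 < a" "a \<le> 1"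
    and mean: "AE x in lborel. 0 < x \<and> x < 4*pi \<longrightarrow> (LINT y|lborel. u (x, y) * sin (y / 2)) = 0"
  shows "(LINT z|lborel. (u z)\<^sup>2) \<le> pi\<^sup>2 / 8 * gradient_product g1 g2 g1 g2"
proof -
  note L2 = sobolev_L2[OF S] and D = sobolev_D[OF S]
  have R: "right_part a u \<le> pi\<^sup>2 / 8 * (LINT z|lborel. (g2 z)\<^sup>2)"
  proof (rule right_part_le[OF S])
    have ac: "AE x in lborel. a < x \<and> x < 4*pi \<longrightarrow> (\<exists>e. ac_on 0 (2*pi) (\<lambda>y. u (x, y)) (\<lambda>y. g2 (x, y)) e)"
      by (rule sobolev_vertical[OF S]) (use a in auto)
    \<comment> \<open>Admissible test functions vanish at height \<open>pi\<close>. These two determine both boundary values, the first one also shows that the derivative is orthogonal to \<open>cos (y / 2)\<close>.\<close>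
    let ?c = "\<lambda>y::real. cos (y / 2)" and ?s = "\<lambda>y::real. (y - pi) * (y - pi)"
    have sm: "smooth ?c" "smooth ?s"
      by (rule smooth_cos_sin(1), intro smooth_mult[OF smooth_diff[OF smooth_ident smooth_const] smooth_diff[OF smooth_ident smooth_const]])
    have "AE x in lborel. 0 < x \<and> x < 4*pi \<longrightarrow> (LINT y|lborel. u (x, y) * deriv ?c y + g2 (x, y) * ?c y) = 0"
      "AE x in lborel. 0 < x \<and> x < 4*pi \<longrightarrow> (LINT y|lborel. u (x, y) * deriv ?s y + g2 (x, y) * ?s y) = 0"
      by (rule zero_boundary_vertical[OF S Z], rule sm, simp)+
    with mean ac show "AE x in lborel. a < x \<and> x < 4*pi \<longrightarrow>
      (LINT y:{0..2*pi}|lborel. (u (x, y))\<^sup>2) \<le> pi\<^sup>2 / 8 * (LINT y:{0..2*pi}|lborel. (g2 (x, y))\<^sup>2)"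
    proof eventually_elim
      case (elim x)
      show ?case
      proof
        assume x: "a < x \<and> x < 4*pi"
        then obtain e where e: "ac_on 0 (2*pi) (\<lambda>y. u (x, y)) (\<lambda>y. g2 (x, y)) e" using elim(2) by blast
        then have u: "integrable lborel (\<lambda>y. u (x, y))" and g: "integrable lborel (\<lambda>y. g2 (x, y))" "integrable lborel (\<lambda>y. (g2 (x, y))\<^sup>2)" by (auto simp: ac_on_def)
        let ?A = "primitive (\<lambda>y. g2 (x, y)) 0"
        have set: "(LINT y|lborel. u (x, y) * k y + g2 (x, y) * l y) = (LINT y:{0..2*pi}|lborel. u (x, y) * k y + g2 (x, y) * l y)" for k l
          by (rule integral_eq_set_integral) (use L2_off[OF L2(1)] L2_off[OF L2(3)] in auto)
        have "(e + ?A (2*pi)) * ?c (2*pi) - e * ?c 0 = 0" "(e + ?A (2*pi)) * ?s (2*pi) - e * ?s 0 = 0"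
          using ac_on_by_parts[OF e sm(1)] ac_on_by_parts[OF e sm(2)] elim(3,4) x a unfolding set by simp_all
        then have "e = 0" and end0: "?A (2*pi) = 0" by (simp_all add: algebra_simps)
        have sin0: "(LINT y:{0..2*pi}|lborel. ?A y * sin (y / 2)) = 0"
        proof -
          have "(LINT y:{0..2*pi}|lborel. ?A y * sin (y / 2)) = (LINT y:{0..2*pi}|lborel. u (x, y) * sin (y / 2))"
            using ac_on_set_integral_mult[OF e, of 0 "2*pi" "\<lambda>y. sin (y / 2)"] smooth_measurable[OF smooth_cos_sin(2)[of 2]] \<open>e = 0\<close> by simp
          also have "\<dots> = (LINT y|lborel. u (x, y) * sin (y / 2))"
            by (rule integral_eq_set_integral[symmetric]) (use L2_off[OF L2(1)] in auto)
          finally show ?thesis using elim(1) x a by simp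
        qed
        have cos0: "(LINT y:{0..2*pi}|lborel. g2 (x, y) * cos (y / 2)) = 0"
        proof -
          have i: "set_integrable lborel {0..2*pi} (\<lambda>y. u (x, y) * deriv ?c y)" "set_integrable lborel {0..2*pi} (\<lambda>y. g2 (x, y) * ?c y)"
            by (intro set_integrable_mult_smooth u g smooth_real_deriv sm)+
          have "0 = (LINT y:{0..2*pi}|lborel. u (x, y) * deriv ?c y) + (LINT y:{0..2*pi}|lborel. g2 (x, y) * ?c y)"
            using elim(3) x a set[of "deriv ?c" ?c] set_integral_add(2)[OF i] by simp
          also have "(LINT y:{0..2*pi}|lborel. u (x, y) * deriv ?c y) = (LINT y|lborel. u (x, y) * deriv ?c y)"
            by (rule integral_eq_set_integral[symmetric]) (use L2_off[OF L2(1)] in auto)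
          also have "\<dots> = (LINT y|lborel. (- 1 / 2) * (u (x, y) * sin (y / 2)))"
            by (simp add: deriv_half_angle mult.commute)
          also have "\<dots> = 0" using elim(1) x a by (subst integral_mult_right_zero) simp
          finally show ?thesis by simp
        qed
        show "(LINT y:{0..2*pi}|lborel. (u (x, y))\<^sup>2) \<le> pi\<^sup>2 / 8 * (LINT y:{0..2*pi}|lborel. (g2 (x, y))\<^sup>2)"
          using poincare_second_dirichlet[OF g end0 sin0 cos0] ac_on_set_integral_square[OF e, of 0 "2*pi"] \<open>e = 0\<close> by simp
      qed
    qed
  qed simp
  have L: "left_part a u \<le> 0 * right_part a u + 1 / 2 * (LINT z|lborel. (g1 z)\<^sup>2)"
  proof (rule left_part_le[OF S])
    show "AE y in lborel. 0 < y \<and> y < 2*pi \<longrightarrow>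
      (LINT x:{0..a}|lborel. (u (x, y))\<^sup>2) \<le> 0 * (LINT x|lborel. indicator {a..} x * (u (x, y))\<^sup>2) + 1 / 2 * (LINT x|lborel. (g1 (x, y))\<^sup>2)"
      using zero_boundary_horizontal[OF S Z]
    proof eventually_elim
      case (elim y)
      show ?case
      proof
        assume "0 < y \<and> y < 2*pi"
        then have e: "ac_on 0 (4*pi) (\<lambda>x. u (x, y)) (\<lambda>x. g1 (x, y)) 0" using elim by blast
        then have g: "integrable lborel (\<lambda>x. g1 (x, y))" "integrable lborel (\<lambda>x. (g1 (x, y))\<^sup>2)" by (auto simp: ac_on_def)
        have a1: "a \<le> 4*pi" using a pi_gt3 by linarith
        have "(LINT x:{0..a}|lborel. (u (x, y))\<^sup>2) \<le> (a - 0)\<^sup>2 / 2 * (LINT x:{0..a}|lborel. (g1 (x, y))\<^sup>2)"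
          using poincare_left_end[OF g, of 0 0 a] ac_on_set_integral_square[OF e, of 0 a] a a1 by simp
        also have "\<dots> \<le> 1 / 2 * (LINT x|lborel. (g1 (x, y))\<^sup>2)"
        proof (rule mult_mono)
          show "(LINT x:{0..a}|lborel. (g1 (x, y))\<^sup>2) \<le> (LINT x|lborel. (g1 (x, y))\<^sup>2)"
            by (rule set_integral_le_integral[OF g(2)]) auto
          show "(a - 0)\<^sup>2 / 2 \<le> 1 / 2" using a power_mono[of a 1 2] by simp
        qed (auto intro!: set_integral_nonneg')
        finally show "(LINT x:{0..a}|lborel. (u (x, y))\<^sup>2) \<le> 0 * (LINT x|lborel. indicator {a..} x * (u (x, y))\<^sup>2) + 1 / 2 * (LINT x|lborel. (g1 (x, y))\<^sup>2)" by simp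
      qed
    qed
  qed (use a in auto)
  have "9 \<le> pi\<^sup>2" using power_mono[of 3 pi 2] pi_gt3 by simp
  then have "1 / 2 * (LINT z|lborel. (g1 z)\<^sup>2) \<le> pi\<^sup>2 / 8 * (LINT z|lborel. (g1 z)\<^sup>2)"
    by (intro mult_right_mono Bochner_Integration.integral_nonneg) auto
  moreover have "gradient_product g1 g2 g1 g2 = (LINT z|lborel. (g1 z)\<^sup>2) + (LINT z|lborel. (g2 z)\<^sup>2)"
    by (simp add: gradient_product_def power2_eq_square)
  ultimately show ?thesis using R L left_plus_right[OF L2(1), of a] by (simp add: distrib_left)
qed

section \<open>The first two eigenvalues\<close>

lemma mode_energy_mono: "j < k \<Longrightarrow> mode_energy bc j < mode_energy bc k"
  by (cases bc) (auto intro!: power_strict_mono divide_strict_right_mono)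

lemma mode_energy_inj: "mode_energy bc j = mode_energy bc k \<Longrightarrow> j = k"
  using mode_energy_mono[of j k bc] mode_energy_mono[of k j bc] by (metis less_irrefl nat_neq_iff)

text \<open>By the two-term recursion all integrals against modes vanish: for \<open>k \<ge> 2\<close> the factor \<open>mode_energy bc k - \<nu>\<close> is
positive, and for \<open>k < 2\<close> the coupling is zero. The energy identity and the spectral gap then leave only zero.\<close>

lemma orthogonal_to_modes_imp_zero:
  assumes a: "0 < a" "a \<le> 1 / 8" and A: "admissible bc a u g1 g2"
    and weak: "\<And>k. gradient_product g1 g2 (mode_dx bc a k) (mode_dy bc a k) = \<nu> * (LINT z|lborel. u z * mode bc a k z)"
    and energy: "gradient_product g1 g2 g1 g2 = \<nu> * (LINT z|lborel. (u z)\<^sup>2)"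
    and \<nu>: "\<nu> \<le> mode_energy bc 1"
    and orth: "\<And>k. k < 2 \<Longrightarrow> mode_energy bc k = \<nu> \<Longrightarrow> (LINT z|lborel. u z * mode bc a k z) = 0"
  shows "(LINT z|lborel. (u z)\<^sup>2) = 0"
proof -
  have S: "sobolev a u g1 g2" using A by (simp add: admissible_def)
  define M where "M k = (LINT z|lborel. u z * mode bc a k z)" for k
  have rec: "(mode_energy bc k - \<nu>) * M k = coupling k * M (k - 2)" for k
    using mode_weak_equation[OF A, of k] weak[of k] by (simp add: M_def algebra_simps)
  have "M k = 0" for k
  proof (induction k rule: less_induct)
    case (less k)
    show ?case
    proof (cases "k < 2")
      case True
      then have "coupling k = 0" by (auto simp: coupling_def less_2_cases_iff)
      then show ?thesis using rec[of k] orth[OF True] by (auto simp: M_def)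
    next
      case False
      then have "mode_energy bc k > \<nu>" using mode_energy_mono[of 1 k bc] \<nu> by linarith
      moreover have "M (k - 2) = 0" using False by (intro less) auto
      ultimately show ?thesis using rec[of k] by simp
    qed
  qed
  then have zero: "AE x in lborel. 0 < x \<and> x < 4*pi \<longrightarrow> (LINT y|lborel. u (x, y) * mode_y bc y) = 0"
    by (intro vertical_projection_zero[OF sobolev_L2(1)[OF S]]) (simp add: M_def)
  define U where "U = (LINT z|lborel. (u z)\<^sup>2)"
  have U: "0 \<le> U" unfolding U_def by (rule Bochner_Integration.integral_nonneg) simp
  have \<nu>U: "\<nu> * U \<le> mode_energy bc 1 * U" using \<nu> U by (rule mult_right_mono)
  have "U \<le> 0"
  proof (cases bc)
    case Neumann
    have "U \<le> 12 * (\<nu> * U)"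
      using gap_neumann[OF S a] zero energy by (simp add: Neumann U_def)
    then show ?thesis using \<nu>U by (simp add: Neumann)
  next
    case Dirichlet
    have "zero_boundary a u g1 g2" using A Dirichlet by (simp add: admissible_def)
    then have "U \<le> pi\<^sup>2 / 8 * (\<nu> * U)"
      using gap_dirichlet[OF S] zero energy a by (simp add: Dirichlet U_def)
    also have "\<dots> \<le> pi\<^sup>2 / 8 * (U / 2)" using \<nu>U by (intro mult_left_mono) (auto simp: Dirichlet)
    finally have "(1 - pi\<^sup>2 / 16) * U \<le> 0" by (simp add: algebra_simps)
    moreover have "pi\<^sup>2 < 4\<^sup>2" using pi_less_4 pi_ge_zero by (intro power_strict_mono) auto
    ultimately show ?thesis by (simp add: mult_le_0_iff)
  qed
  with U show ?thesis unfolding U_def by linarith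
qed

lemma continuous_square_integral_zero:
  assumes c: "continuous_on (cracked a) f" and L2: "L2_cracked a f" and 0: "(LINT z|lborel. (f z)\<^sup>2) = 0"
  shows "f z = 0"
proof (cases "z \<in> cracked a")
  case True
  have "AE z in lborel. (f z)\<^sup>2 = 0"
    using integral_nonneg_eq_0_iff_AE[of lborel "\<lambda>z. (f z)\<^sup>2"] L2 0 by (simp add: L2_cracked_def)
  then have "AE z in lborel. z \<in> cracked a \<longrightarrow> f z = 0" by eventually_elim simp
  from continuous_AE_imp_all[OF crack_open c this True] show ?thesis .
next
  case False
  then show ?thesis using L2 unfolding L2_cracked_def by blast
qed

lemma mode_nonzero: "(x, y) \<in> cracked a \<Longrightarrow> mode bc a 0 (x, y) \<noteq> 0"
proof -
  assume z: "(x, y) \<in> cracked a"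
  then have "0 < sin (x / 4)" "0 < sin (y / 2)" by (auto simp: cracked_iff intro!: sin_gt_zero)
  then show ?thesis using z by (cases bc) (auto simp: mode_def on_cracked_def cos_mode_def sin_mode_def)
qed

lemma mode_1: "mode bc a 1 (x, y) = cos (x / 4) * mode bc a 0 (x, y)"
  by (cases bc) (auto simp: mode_def on_cracked_def cos_mode_def sin_mode_def)

lemma mode_nontrivial:
  assumes "0 < a" "a \<le> 1 / 8" "k < 2"
  shows "\<exists>z. mode bc a k z \<noteq> 0"
proof -
  have "(1, 1) \<in> cracked a" using assms pi_gt3 by (auto simp: cracked_iff)
  then have "mode bc a 0 (1, 1) \<noteq> 0" by (rule mode_nonzero)
  moreover have "cos (1 / 4 :: real) > 0" using pi_gt3 by (intro cos_gt_zero) auto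
  ultimately have "mode bc a k (1, 1) \<noteq> 0" using mode_1[of bc a 1 1] \<open>k < 2\<close> by (auto simp: less_2_cases_iff)
  then show ?thesis by blast
qed

lemma gradient_product_diff:
  assumes "L2_cracked a g1" "L2_cracked a g2" "L2_cracked a h1" "L2_cracked a h2"
    "L2_cracked a p1" "L2_cracked a p2"
  shows "gradient_product (\<lambda>z. g1 z - c * h1 z) (\<lambda>z. g2 z - c * h2 z) p1 p2 = gradient_product g1 g2 p1 p2 - c * gradient_product h1 h2 p1 p2"
proof -
  have *: "(LINT z|lborel. (g z - c * h z) * p z) = (LINT z|lborel. g z * p z) - c * (LINT z|lborel. h z * p z)"
    if "L2_cracked a g" "L2_cracked a h" "L2_cracked a p" for g h p
    using L2_mult_integrable[OF that(1,3)] L2_mult_integrable[OF that(2,3)] by (simp add: left_diff_distrib mult.assoc)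
  show ?thesis unfolding gradient_product_def *[OF assms(1,3,5)] *[OF assms(2,4,6)] by (simp add: algebra_simps)
qed

lemma eigenspace_L2:
  assumes "0 < a" "u \<in> eigenspace bc a \<nu>"
  shows "continuous_on (cracked a) u" "L2_cracked a u"
proof -
  show "continuous_on (cracked a) u" using assms(2) by (simp add: eigenspace_def)
  obtain g1 g2 where "admissible bc a u g1 g2" by (rule eigenfunction_weak_equation[OF assms])
  then show "L2_cracked a u" using sobolev_L2(1) by (auto simp: admissible_def)
qed

text \<open>After subtracting its projection on the mode of the same energy, if there is one, an eigenfunction satisfies the
hypotheses of \<open>orthogonal_to_modes_imp_zero\<close>. The difference is handled by its weak equations alone.\<close>

lemma low_eigenfunction:
  assumes a: "0 < a" "a \<le> 1 / 8" and u: "u \<in> eigenspace bc a \<nu>" and \<nu>: "\<nu> \<le> mode_energy bc 1" and nz: "u \<noteq> 0"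
  shows "\<exists>k<2. \<exists>c. \<nu> = mode_energy bc k \<and> u = (\<lambda>z. c * mode bc a k z)"
proof -
  obtain g1 g2 where A: "admissible bc a u g1 g2"
    and weak: "\<And>k. gradient_product g1 g2 (mode_dx bc a k) (mode_dy bc a k) = \<nu> * (LINT z|lborel. u z * mode bc a k z)"
    and energy: "gradient_product g1 g2 g1 g2 = \<nu> * (LINT z|lborel. (u z)\<^sup>2)"
    using eigenfunction_weak_equation[OF a(1) u] by blast
  note uc = eigenspace_L2[OF a(1) u]
  show ?thesis
  proof (cases "\<exists>k<2. mode_energy bc k = \<nu>")
    case False
    then have "(LINT z|lborel. (u z)\<^sup>2) = 0"
      by (intro orthogonal_to_modes_imp_zero[OF a A weak energy \<nu>]) auto
    then have "u z = 0" for z by (rule continuous_square_integral_zero[OF uc])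
    then show ?thesis using nz by (auto simp: fun_eq_iff)
  next
    case True
    then obtain k where k: "k < 2" "mode_energy bc k = \<nu>" by blast
    let ?v = "mode bc a k" and ?h1 = "mode_dx bc a k" and ?h2 = "mode_dy bc a k"
    note B = mode_admissible[OF a(1), of bc]
    have v: "?v \<in> eigenspace bc a \<nu>" using mode_in_eigenspace[OF a(1) k(1), of bc] k(2) by simp
    note vc = eigenspace_L2[OF a(1) v]
    have S: "sobolev a u g1 g2" "\<And>j. sobolev a (mode bc a j) (mode_dx bc a j) (mode_dy bc a j)"
      using A B by (auto simp: admissible_def)
    note L = sobolev_L2[OF S(1)] and Lm = sobolev_L2[OF S(2)]
    define N where "N = (LINT z|lborel. ?v z * ?v z)"
    have "N \<noteq> 0"
    proof
      assume "N = 0"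
      then have "(LINT z|lborel. (?v z)\<^sup>2) = 0" by (simp add: N_def power2_eq_square)
      then have "?v z = 0" for z by (rule continuous_square_integral_zero[OF vc])
      then show False using mode_nontrivial[OF a k(1), of bc] by blast
    qed
    define c where "c = (LINT z|lborel. u z * ?v z) / N"
    let ?u = "\<lambda>z. u z - c * ?v z" and ?g1 = "\<lambda>z. g1 z - c * ?h1 z" and ?g2 = "\<lambda>z. g2 z - c * ?h2 z"
    have ck: "coupling k = 0" using k(1) by (auto simp: coupling_def less_2_cases_iff)
    have M: "(LINT z|lborel. ?u z * w z) = (LINT z|lborel. u z * w z) - c * (LINT z|lborel. ?v z * w z)"
      if "L2_cracked a w" for w
      using L2_mult_integrable[OF L(1) that] L2_mult_integrable[OF Lm(1) that, of k] by (simp add: left_diff_distrib mult.assoc)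
    have vw: "gradient_product ?h1 ?h2 (mode_dx bc a j) (mode_dy bc a j) = \<nu> * (LINT z|lborel. ?v z * mode bc a j z)" for j
      using mode_weak_equation[OF B, of j k] ck k(2) by (subst gradient_product_commute) (simp add: mult.commute)
    have uL: "L2_cracked a ?u" by (rule L2_diff[OF L(1) Lm(1)])
    have "(LINT z|lborel. (?u z)\<^sup>2) = 0"
    proof (rule orthogonal_to_modes_imp_zero[OF a admissible_diff[OF A B] _ _ \<nu>])
      show weak': "gradient_product ?g1 ?g2 (mode_dx bc a j) (mode_dy bc a j) = \<nu> * (LINT z|lborel. ?u z * mode bc a j z)" for j
        unfolding gradient_product_diff[OF L(2,3) Lm(2,3) Lm(2,3)] weak vw M[OF Lm(1)] by (simp add: algebra_simps)
      have "gradient_product g1 g2 ?g1 ?g2 = \<nu> * (LINT z|lborel. ?u z * u z)"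
        unfolding gradient_product_commute[of g1 g2 ?g1] gradient_product_diff[OF L(2,3) Lm(2,3) L(2,3)] energy
          gradient_product_commute[of ?h1 ?h2 g1] weak M[OF L(1)]
        by (simp add: algebra_simps power2_eq_square)
      moreover have "gradient_product ?h1 ?h2 ?g1 ?g2 = \<nu> * (LINT z|lborel. ?u z * ?v z)"
        using weak'[of k] by (subst gradient_product_commute)
      ultimately have "gradient_product ?g1 ?g2 ?g1 ?g2 = \<nu> * (LINT z|lborel. ?u z * u z) - c * (\<nu> * (LINT z|lborel. ?u z * ?v z))"
        using gradient_product_diff[OF L(2,3) Lm(2)[of k] Lm(3)[of k] L2_diff[OF L(2) Lm(2)[of k], of c] L2_diff[OF L(3) Lm(3)[of k], of c], where c=c]
        by simp
      also have "\<dots> = \<nu> * (LINT z|lborel. ?u z * ?u z)"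
      proof -
        have "(LINT z|lborel. ?u z * u z) = (LINT z|lborel. u z * ?u z)" "(LINT z|lborel. ?u z * ?v z) = (LINT z|lborel. ?v z * ?u z)"
          by (simp_all only: mult.commute)
        then show ?thesis unfolding M[OF uL] by (simp only: right_diff_distrib mult.left_commute)
      qed
      finally show "gradient_product ?g1 ?g2 ?g1 ?g2 = \<nu> * (LINT z|lborel. (?u z)\<^sup>2)"
        by (simp add: power2_eq_square)
      fix j :: nat assume "j < 2" "mode_energy bc j = \<nu>"
      then have "j = k" using k(2) by (intro mode_energy_inj[of bc]) simp
      then show "(LINT z|lborel. ?u z * mode bc a j z) = 0"
        using M[OF Lm(1), of k] \<open>N \<noteq> 0\<close> by (simp add: c_def N_def)
    qed
    then have "?u z = 0" for z
      by (rule continuous_square_integral_zero[OF continuous_on_diff[OF uc(1) continuous_on_mult_left[OF vc(1)]] uL])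
    then show ?thesis using k by (intro exI[of _ k] conjI exI[of _ c]) (auto simp: fun_eq_iff)
  qed
qed

lemma low_eigenvalues:
  assumes a: "0 < a" "a \<le> 1 / 8" and "\<nu> \<le> mode_energy bc 1"
  shows "eigenvalue bc a \<nu> \<longleftrightarrow> \<nu> = mode_energy bc 0 \<or> \<nu> = mode_energy bc 1"
proof
  assume "eigenvalue bc a \<nu>"
  then obtain u where u: "u \<in> eigenspace bc a \<nu>" "u \<noteq> 0" unfolding eigenvalue_def by blast
  obtain k :: nat where k: "k < 2" "\<nu> = mode_energy bc k" using low_eigenfunction[OF a u(1) assms(3) u(2)] by blast
  then show "\<nu> = mode_energy bc 0 \<or> \<nu> = mode_energy bc 1" unfolding less_2_cases_iff One_nat_def by blast
next
  assume "\<nu> = mode_energy bc 0 \<or> \<nu> = mode_energy bc 1"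
  then have "\<nu> = mode_energy bc (0::nat) \<and> (0::nat) < 2 \<or> \<nu> = mode_energy bc (1::nat) \<and> (1::nat) < 2" by simp
  then obtain k :: nat where k: "k < 2" "\<nu> = mode_energy bc k" by blast
  have "mode bc a k \<noteq> 0" using mode_nontrivial[OF a k(1)] by (auto simp: fun_eq_iff)
  then show "eigenvalue bc a \<nu>" using mode_in_eigenspace[OF a(1) k(1), of bc] unfolding k(2) eigenvalue_def by blast
qed

lemma low_multiplicity:
  assumes a: "0 < a" "a \<le> 1 / 8" and k: "k < 2"
  shows "multiplicity bc a (mode_energy bc k) = 1"
  unfolding multiplicity_def
proof (rule real_fun.dim_unique)
  let ?v = "mode bc a k"
  have le: "mode_energy bc k \<le> mode_energy bc 1"
    using k mode_energy_mono[of 0 1 bc] by (auto simp: less_2_cases_iff)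
  show "{?v} \<subseteq> eigenspace bc a (mode_energy bc k)" using mode_in_eigenspace[OF a(1) k] by blast
  show "eigenspace bc a (mode_energy bc k) \<subseteq> real_fun.span {?v}"
  proof
    fix u assume u: "u \<in> eigenspace bc a (mode_energy bc k)"
    show "u \<in> real_fun.span {?v}"
    proof (cases "u = 0")
      case True
      show ?thesis unfolding True by (rule real_fun.span_zero)
    next
      case False
      obtain j c where j: "j < 2" "mode_energy bc k = mode_energy bc j" "u = (\<lambda>z. c * mode bc a j z)"
        using low_eigenfunction[OF a u le False] by blast
      have "j = k" by (rule mode_energy_inj) (rule j(2)[symmetric])
      show ?thesis unfolding j(3) \<open>j = k\<close> by (intro real_fun.span_scale real_fun.span_base insertI1)
    qed
  qed
  have "?v \<noteq> 0"
  proof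
    assume "?v = 0"
    then have "?v z = 0" for z by simp
    then show False using mode_nontrivial[OF a k] by blast
  qed
  then show "\<not> real_fun.dependent {?v}" unfolding real_fun.dependent_single .
qed simp

text \<open>The eigenvalues up to \<open>mode_energy bc 1\<close> are the energies of the first two modes, and both are simple.\<close>

lemma second_eigenvalue:
  assumes a: "0 < a" "a \<le> 1 / 8"
  shows "eigval bc a 2 = mode_energy bc 1"
  unfolding eigval_def
proof (rule Least_equality)
  have lt: "mode_energy bc 0 < mode_energy bc 1" by (rule mode_energy_mono) simp
  have "{\<nu>. eigenvalue bc a \<nu> \<and> \<nu> \<le> mode_energy bc 1} = {mode_energy bc 0, mode_energy bc 1}"
    using low_eigenvalues[OF a] lt by auto
  then show "2 \<le> eigenvalue_count bc a (mode_energy bc 1)"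
    using lt low_multiplicity[OF a, of 0] low_multiplicity[OF a, of 1] by (simp add: eigenvalue_count_def)
  fix \<mu> assume \<mu>: "2 \<le> eigenvalue_count bc a \<mu>"
  show "mode_energy bc 1 \<le> \<mu>"
  proof (rule ccontr)
    assume "\<not> mode_energy bc 1 \<le> \<mu>"
    then have "{\<nu>. eigenvalue bc a \<nu> \<and> \<nu> \<le> \<mu>} \<subseteq> {mode_energy bc 0}"
      using low_eigenvalues[OF a] by fastforce
    then have "eigenvalue_count bc a \<mu> \<le> (\<Sum>\<nu>\<in>{mode_energy bc 0}. multiplicity bc a \<nu>)"
      unfolding eigenvalue_count_def by (intro sum_mono2) auto
    then show False using \<mu> low_multiplicity[OF a, of 0] by simp
  qed
qed

lemma kappa_second_eigenvalue:
  assumes "0 < a" "a \<le> 1 / 8"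
  shows "kappa bc a (eigval bc a 2) \<le> 2"
  unfolding kappa_def by (rule Least_le) simp

section \<open>A combination with three nodal domains\<close>

text \<open>The combination that vanishes on the line \<open>x = a / 2\<close>, halfway along the crack.\<close>

definition crossing :: "boundary_condition \<Rightarrow> real \<Rightarrow> real \<times> real \<Rightarrow> real" where
  "crossing bc a = (\<lambda>z. mode bc a 1 z - cos (a / 8) * mode bc a 0 z)"

lemma crossing_zero_iff:
  assumes "0 < a" "a \<le> 1 / 8" "(x, y) \<in> cracked a"
  shows "crossing bc a (x, y) = 0 \<longleftrightarrow> x = a / 2"
proof -
  have "crossing bc a (x, y) = (cos (x / 4) - cos (a / 8)) * mode bc a 0 (x, y)"
    by (simp only: crossing_def mode_1 left_diff_distrib)
  then have "crossing bc a (x, y) = 0 \<longleftrightarrow> cos (x / 4) = cos (a / 8)"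
    using mode_nonzero[OF assms(3)] by simp
  also have "\<dots> \<longleftrightarrow> x / 4 = a / 8"
    using cos_inj_pi[of "x / 4" "a / 8"] assms pi_gt3 by (auto simp: cracked_iff)
  finally show ?thesis by auto
qed

lemma crossing_combination:
  assumes "0 < a" "a \<le> 1 / 8"
  shows "crossing bc a \<in> eigenfunction_combinations bc a (mode_energy bc 1)"
proof -
  have lt: "mode_energy bc 0 < mode_energy bc 1" by (rule mode_energy_mono) simp
  have in0: "mode bc a k \<in> (\<Union>\<nu>\<in>{..mode_energy bc 1}. eigenspace bc a \<nu>)" if "k < 2" for k
    using mode_in_eigenspace[OF assms(1) that, of bc] lt that by (auto simp: less_2_cases_iff)
  have "mode bc a 1 - (\<lambda>z. cos (a / 8) * mode bc a 0 z) \<in> eigenfunction_combinations bc a (mode_energy bc 1)"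
    unfolding eigenfunction_combinations_def
    by (intro real_fun.span_diff real_fun.span_scale real_fun.span_base in0) auto
  moreover have "mode bc a 1 - (\<lambda>z. cos (a / 8) * mode bc a 0 z) = crossing bc a"
    by (simp add: crossing_def fun_eq_iff)
  ultimately show ?thesis by simp
qed

lemma component_subset:
  assumes "S \<subseteq> A \<union> B" "open A" "open B" "A \<inter> B = {}" "z \<in> A"
  shows "connected_component_set S z \<subseteq> A"
proof (rule ccontr)
  assume "\<not> connected_component_set S z \<subseteq> A"
  then obtain w where w: "w \<in> connected_component_set S z" "w \<notin> A" by blast
  have C: "connected_component_set S z \<subseteq> S" by (rule connected_component_subset)
  then have "z \<in> connected_component_set S z" using w(1) connected_component_in connected_component_refl by fastforce
  moreover have "w \<in> B" using w C assms(1) by blast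
  ultimately show False
    using connectedD[OF connected_connected_component[of S z] assms(2,3)] w(1) assms C by blast
qed

text \<open>It is enough to place three points in three disjoint open sets covering the complement of the nodal line, for
then they lie in different components.\<close>

lemma crossing_nodal_domains:
  assumes a: "0 < a" "a \<le> 1 / 8"
  shows "beta0 (cracked a) (crossing bc a) > enat 2"
proof -
  define S where "S = cracked a - nodal_set (cracked a) (crossing bc a)"
  let ?L = "{z::real \<times> real. fst z = a / 2}"
  let ?A = "{z::real \<times> real. fst z < a / 2 \<and> snd z < pi}" and ?B = "{z::real \<times> real. fst z < a / 2 \<and> pi < snd z}"
    and ?C = "{z::real \<times> real. a / 2 < fst z}"
  have "closed ?L" by (intro closed_Collect_eq continuous_intros)
  then have "nodal_set (cracked a) (crossing bc a) \<subseteq> ?L"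
    unfolding nodal_set_def using crossing_zero_iff[OF a] by (intro closure_minimal) auto
  moreover have "{z \<in> cracked a. crossing bc a z = 0} \<subseteq> nodal_set (cracked a) (crossing bc a)"
    unfolding nodal_set_def by (rule closure_subset)
  ultimately have S: "S = cracked a - ?L"
    unfolding S_def using crossing_zero_iff[OF a] by fastforce
  have sub: "S \<subseteq> ?A \<union> (?B \<union> ?C)"
  proof
    fix z assume "z \<in> S"
    then show "z \<in> ?A \<union> (?B \<union> ?C)" using a unfolding S by (cases z) (auto simp: cracked_iff)
  qed
  have op: "open ?A" "open ?B" "open ?C"
    by (intro open_Collect_conj open_Collect_less continuous_intros)+
  let ?C1 = "connected_component_set S (a / 4, 1)" and ?C2 = "connected_component_set S (a / 4, 4)" and ?C3 = "connected_component_set S (1, 1)"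
  have pts: "(a / 4, 1) \<in> S" "(a / 4, 4) \<in> S" "(1, 1) \<in> S"
    using a pi_gt3 pi_less_4 unfolding S by (auto simp: cracked_iff)
  have s2: "?C2 \<subseteq> ?B"
    by (rule component_subset[where B="?A \<union> ?C"]) (use a pi_less_4 op sub in \<open>auto intro: open_Un\<close>)
  have s3: "?C3 \<subseteq> ?C"
    by (rule component_subset[where B="?A \<union> ?B"]) (use a op sub in \<open>auto intro: open_Un\<close>)
  have m: "(a / 4, 1) \<in> ?C1" "(a / 4, 4) \<in> ?C2"
    using pts by (simp_all add: connected_component_refl)
  have n: "(a / 4, 1) \<notin> ?B" "(a / 4, 1) \<notin> ?C" "(a / 4, 4) \<notin> ?C"
    using a pi_gt3 by auto
  have ne: "?C1 \<noteq> ?C2" "?C1 \<noteq> ?C3" "?C2 \<noteq> ?C3"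
    using m s2 s3 n by blast+
  have comp: "{?C1, ?C2, ?C3} \<subseteq> components S" using pts by (auto simp: components_def)
  have "card {?C1, ?C2, ?C3} = 3" using ne by simp
  then have "3 \<le> card (components S)" if "finite (components S)" using card_mono[OF that comp] by simp
  then show ?thesis by (auto simp: beta0_def Let_def S_def[symmetric])
qed

theorem proposition4p2:
  shows "\<exists>a0. 0 < a0 \<and> a0 \<le> 1 \<and>
    (\<forall>a. 0 < a \<and> a \<le> a0 \<longrightarrow>
      (\<forall>bc\<in>{Dirichlet, Neumann}.
        \<not> extended_courant_property bc a \<and>
        (\<exists>m\<ge>1. \<exists>v\<in>eigenfunction_combinations bc a (eigval bc a m).
           beta0 (cracked a) v > enat (kappa bc a (eigval bc a m)))))"
proof (intro exI[of _ "1 / 8"] conjI allI impI ballI)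
  fix a :: real and bc assume a: "0 < a \<and> a \<le> 1 / 8"
  have "enat (kappa bc a (eigval bc a 2)) \<le> enat 2"
    using kappa_second_eigenvalue a by simp
  also have "\<dots> < beta0 (cracked a) (crossing bc a)"
    using crossing_nodal_domains a by blast
  finally have "enat (kappa bc a (eigval bc a 2)) < beta0 (cracked a) (crossing bc a)" .
  moreover have "crossing bc a \<in> eigenfunction_combinations bc a (eigval bc a 2)"
    using crossing_combination[of a bc] second_eigenvalue[of a bc] a by simp
  ultimately have *: "\<exists>m\<ge>1. \<exists>v\<in>eigenfunction_combinations bc a (eigval bc a m).
      beta0 (cracked a) v > enat (kappa bc a (eigval bc a m))"
    by (intro exI[of _ "2::nat"] conjI bexI[of _ "crossing bc a"]) simp_all
  then show "\<exists>m\<ge>1. \<exists>v\<in>eigenfunction_combinations bc a (eigval bc a m).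
      beta0 (cracked a) v > enat (kappa bc a (eigval bc a m))" .
  from * show "\<not> extended_courant_property bc a"
    unfolding extended_courant_property_def by (meson leD)
qed simp_all

end
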